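(* Let $N,n\ge 1$ be integers, let $A$ be a real deterministic $N\times n$ matrix, and let $(\sigma_{ij})_{1\le i\le N,\,1\le j\le n}$ be real numbers. Put $D_j=\mathrm{diag}(\sigma_{ij}^2;\,1\le i\le N)$ for $1\le j\le n$ and $\tilde D_i=\mathrm{diag}(\sigma_{ij}^2;\,1\le j\le n)$ for $1\le i\le N$. Then the system of $N+n$ equations (for $z\in\mathbb{C}-\mathbb{R}^+$) $$\psi_i(z)=\frac{-1}{z\left(1+\frac1n\mathrm{Tr}\,\tilde D_i\tilde T(z)\right)}\quad(1\le i\le N),\qquad \tilde\psi_j(z)=\frac{-1}{z\left(1+\frac1n\mathrm{Tr}\,D_jT(z)\right)}\quad(1\le j\le n),$$ where $$\Psi(z)=\mathrm{diag}(\psi_i(z),1\le i\le N),\qquad \tilde\Psi(z)=\mathrm{diag}(\tilde\psi_j(z),1\le j\le n),$$ $$T(z)=\left(\Psi^{-1}(z)-zA\tilde\Psi(z)A^T\right)^{-1},\qquad \tilde T(z)=\left(\tilde\Psi^{-1}(z)-zA^T\Psi(z)A\right)^{-1},$$ admits a unique solution $(\psi_1,\dots,\psi_N,\tilde\psi_1,\dots,\tilde\psi_n)$ in $\mathcal{S}(\mathbb{R}^+)^{N+n}$. Moreover, there exist a positive $N\times N$ matrix-valued measure $\mu=(\mu_{ij})$ and a positive $n\times n$ matrix-valued measure $\tilde\mu=(\tilde\mu_{ij})$ such that $\mu(\mathbb{R}^+)=I_N$, $\tilde\mu(\mathbb{R}^+)=I_n$ and $$T(z)=\int_{\mathbb{R}^+}\frac{\mu(d\lambda)}{\lambda-z},\qquad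 \tilde T(z)=\int_{\mathbb{R}^+}\frac{\tilde\mu(d\lambda)}{\lambda-z}\qquad\text{for } z\in\mathbb{C}-\mathbb{R}^+.$$ In particular, $\frac1N\mathrm{Tr}\,T(z)$ and $\frac1n\mathrm{Tr}\,\tilde T(z)$ are Stieltjes transforms of probability measures.
   Context: $\mathbb{R}^+=[0,\infty)$. $\mathcal{S}(\mathbb{R}^+)$ denotes the set of Stieltjes transforms $f(z)=\int_{\mathbb{R}^+}\frac{\nu(d\lambda)}{\lambda-z}$ of probability measures $\nu$ on $\mathbb{R}^+$, viewed as analytic functions on $\mathbb{C}-\mathbb{R}^+$ (they do not vanish there). A positive $m\times m$ matrix-valued measure $\mu$ on the Borel sets is an $m\times m$ matrix whose entries are complex measures and such that $\mu(\Delta)$ is Hermitian positive semi-definite for every Borel set $\Delta$. *)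

theory Defs
  imports "HOL-Analysis.Analysis" "HOL-Probability.Probability_Measure"
begin

section \<open>Stieltjes transforms of probability measures on the half line\<close>

abbreviation borel_nonneg :: "real measure" where
  "borel_nonneg \<equiv> restrict_space borel {0..}"

abbreviation cut_plane :: "complex set" where
  "cut_plane \<equiv> - (complex_of_real ` {0..})"

definition stieltjes :: "real measure \<Rightarrow> complex \<Rightarrow> complex" where
  "stieltjes \<nu> z = (LINT t|\<nu>. 1 / (complex_of_real t - z))"

text \<open>
  The elements of this set are functions on the cut plane only: with \<^const>\<open>restrict\<close> they take the
  value \<^const>\<open>undefined\<close> off the cut plane, so that equality of two members is
  equality on the cut plane.
\<close>

definition stieltjes_class :: "(complex \<Rightarrow> complex) set" where
  "stieltjes_class =
     {restrict (stieltjes \<nu>) cut_plane |\<nu>. prob_space \<nu> \<and> sets \<nu> = sets borel_nonneg}"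


section \<open>Complex measures and positive matrix-valued measures\<close>

text \<open>
  Countable additivity for values in the complex numbers; it forces the empty set to have measure
  zero, and the series converges unconditionally because every rearrangement of the sets is again
  such a sequence.
\<close>

definition complex_measure :: "'a measure \<Rightarrow> ('a set \<Rightarrow> complex) \<Rightarrow> bool" where
  "complex_measure M c \<longleftrightarrow>
     (\<forall>F :: nat \<Rightarrow> 'a set. range F \<subseteq> sets M \<longrightarrow> disjoint_family F \<longrightarrow>
        (\<lambda>k. c (F k)) sums c (\<Union>k. F k))"

text \<open>
  The integral against a complex measure, through a decomposition of the real and imaginary
  parts into differences of finite positive measures. By uniqueness (proved below) the value
  does not depend on the decomposition, so it is the one given by the Jordan decomposition.
\<close>

definition has_cm_integral ::
    "'a measure \<Rightarrow> ('a set \<Rightarrow> complex) \<Rightarrow> ('a \<Rightarrow> complex) \<Rightarrow> complex \<Rightarrow> bool" where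
  "has_cm_integral M c f I \<longleftrightarrow>
     (\<exists>p q r s. (\<forall>\<nu>\<in>{p, q, r, s}. finite_measure \<nu> \<and> sets \<nu> = sets M \<and> integrable \<nu> f) \<and>
        (\<forall>B\<in>sets M. c B = Complex (measure p B - measure q B) (measure r B - measure s B)) \<and>
        I = (integral\<^sup>L p f - integral\<^sup>L q f) + \<i> * (integral\<^sup>L r f - integral\<^sup>L s f))"

definition hermitian_psd :: "complex^'m^'m \<Rightarrow> bool" where
  "hermitian_psd H \<longleftrightarrow>
     (\<forall>i j. H $ i $ j = cnj (H $ j $ i)) \<and>
     (\<forall>x :: complex^'m. 0 \<le> Re (\<Sum>i\<in>UNIV. \<Sum>j\<in>UNIV. cnj (x $ i) * H $ i $ j * x $ j))"

definition positive_matrix_measure :: "'a measure \<Rightarrow> ('a set \<Rightarrow> complex^'m^'m) \<Rightarrow> bool" where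
  "positive_matrix_measure M \<mu> \<longleftrightarrow>
     (\<forall>i j. complex_measure M (\<lambda>B. \<mu> B $ i $ j)) \<and> (\<forall>B\<in>sets M. hermitian_psd (\<mu> B))"

definition is_matrix_stieltjes ::
    "(real set \<Rightarrow> complex^'m^'m) \<Rightarrow> (complex \<Rightarrow> complex^'m^'m) \<Rightarrow> bool" where
  "is_matrix_stieltjes \<mu> F \<longleftrightarrow>
     (\<forall>z\<in>cut_plane. \<forall>i j.
        has_cm_integral borel_nonneg (\<lambda>B. \<mu> B $ i $ j) (\<lambda>t. 1 / (complex_of_real t - z)) (F z $ i $ j))"

lemma nn_integral_cross_eq:
  fixes g :: "'a \<Rightarrow> ennreal"
  assumes s: "sets q = sets p" "sets p' = sets p" "sets q' = sets p"
    and eq: "\<And>B. B \<in> sets p \<Longrightarrow> emeasure p B + emeasure q' B = emeasure p' B + emeasure q B"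
    and g: "g \<in> borel_measurable p"
  shows "(\<integral>\<^sup>+x. g x \<partial>p) + (\<integral>\<^sup>+x. g x \<partial>q') = (\<integral>\<^sup>+x. g x \<partial>p') + (\<integral>\<^sup>+x. g x \<partial>q)"
proof -
  have m: "borel_measurable q = (borel_measurable p :: ('a \<Rightarrow> ennreal) set)"
      "borel_measurable p' = (borel_measurable p :: ('a \<Rightarrow> ennreal) set)"
      "borel_measurable q' = (borel_measurable p :: ('a \<Rightarrow> ennreal) set)"
    using s by (auto intro!: measurable_cong_sets)
  have sp: "space q = space p" "space p' = space p" "space q' = space p"
    using s sets_eq_imp_space_eq by metis+
  show ?thesis using g
  proof (induction rule: borel_measurable_induct)
    case (cong f g)
    then show ?case using sp by (metis (no_types, lifting) nn_integral_cong)
  next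
    case (set A)
    then show ?case using s eq by simp
  next
    case (mult u c)
    then show ?case using m by (simp add: nn_integral_cmult flip: distrib_left)
  next
    case (add u v)
    have "(\<integral>\<^sup>+x. v x + u x \<partial>p) + (\<integral>\<^sup>+x. v x + u x \<partial>q') =
        ((\<integral>\<^sup>+x. v x \<partial>p) + (\<integral>\<^sup>+x. v x \<partial>q')) + ((\<integral>\<^sup>+x. u x \<partial>p) + (\<integral>\<^sup>+x. u x \<partial>q'))"
      using add m by (simp add: nn_integral_add ac_simps)
    also have "\<dots> = ((\<integral>\<^sup>+x. v x \<partial>p') + (\<integral>\<^sup>+x. v x \<partial>q)) + ((\<integral>\<^sup>+x. u x \<partial>p') + (\<integral>\<^sup>+x. u x \<partial>q))"
      using add by simp
    also have "\<dots> = (\<integral>\<^sup>+x. v x + u x \<partial>p') + (\<integral>\<^sup>+x. v x + u x \<partial>q)"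
      using add m by (simp add: nn_integral_add ac_simps)
    finally show ?case .
  next
    case (seq U)
    have S: "(\<integral>\<^sup>+x. (SUP i. U i) x \<partial>\<nu>) = (SUP i. \<integral>\<^sup>+x. U i x \<partial>\<nu>)"
      if "borel_measurable \<nu> = (borel_measurable p :: ('a \<Rightarrow> ennreal) set)" for \<nu>
      unfolding SUP_apply using seq that by (intro nn_integral_monotone_convergence_SUP) auto
    have I: "incseq (\<lambda>i. \<integral>\<^sup>+x. U i x \<partial>\<nu>)" for \<nu>
      using seq by (auto simp: incseq_def le_fun_def intro!: nn_integral_mono)
    show ?case
      by (simp only: S[OF refl] S[OF m(1)] S[OF m(2)] S[OF m(3)] ennreal_SUP_add[OF I I, symmetric] seq.IH)
  qed
qed

lemma integral_cross_eq_real: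
  fixes g :: "'a \<Rightarrow> real"
  assumes s: "sets q = sets p" "sets p' = sets p" "sets q' = sets p"
    and eq: "\<And>B. B \<in> sets p \<Longrightarrow> emeasure p B + emeasure q' B = emeasure p' B + emeasure q B"
    and g: "integrable p g" "integrable q g" "integrable p' g" "integrable q' g"
  shows "integral\<^sup>L p g - integral\<^sup>L q g = integral\<^sup>L p' g - integral\<^sup>L q' g"
proof -
  have *: "enn2real (\<integral>\<^sup>+x. ennreal (h x) \<partial>p) + enn2real (\<integral>\<^sup>+x. ennreal (h x) \<partial>q') =
      enn2real (\<integral>\<^sup>+x. ennreal (h x) \<partial>p') + enn2real (\<integral>\<^sup>+x. ennreal (h x) \<partial>q)"
    if h: "integrable p h" "integrable q h" "integrable p' h" "integrable q' h" for h :: "'a \<Rightarrow> real"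
  proof -
    have fin: "(\<integral>\<^sup>+x. ennreal (h x) \<partial>\<nu>) < top" if "integrable \<nu> h" for \<nu>
      using that by (simp add: real_integrable_def less_top)
    show ?thesis
      using nn_integral_cross_eq[OF s eq, of "\<lambda>x. ennreal (h x)"] h
      by (simp add: fin flip: enn2real_plus)
  qed
  show ?thesis
    using *[of g] *[of "\<lambda>x. - g x"] g by (simp add: real_lebesgue_integral_def)
qed

lemma integral_cross_eq:
  fixes f :: "'a \<Rightarrow> complex"
  assumes fin: "finite_measure p" "finite_measure q" "finite_measure p'" "finite_measure q'"
    and s: "sets p = sets M" "sets q = sets M" "sets p' = sets M" "sets q' = sets M"
    and eq: "\<And>B. B \<in> sets M \<Longrightarrow> measure p B - measure q B = measure p' B - measure q' B"
    and f: "integrable p f" "integrable q f" "integrable p' f" "integrable q' f"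
  shows "integral\<^sup>L p f - integral\<^sup>L q f = integral\<^sup>L p' f - integral\<^sup>L q' f"
proof -
  have e: "emeasure p B + emeasure q' B = emeasure p' B + emeasure q B" if "B \<in> sets p" for B
  proof -
    have "measure p B + measure q' B = measure p' B + measure q B"
      using eq[of B] that s by simp
    then show ?thesis
      by (simp add: finite_measure.emeasure_eq_measure fin flip: ennreal_plus)
  qed
  have r: "integral\<^sup>L p g - integral\<^sup>L q g = integral\<^sup>L p' g - integral\<^sup>L q' g"
    if "integrable p g" "integrable q g" "integrable p' g" "integrable q' g" for g :: "'a \<Rightarrow> real"
    by (rule integral_cross_eq_real) (use s e that in auto)
  show ?thesis
    using r[of "\<lambda>x. Re (f x)"] r[of "\<lambda>x. Im (f x)"] f by (simp add: complex_eq_iff)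
qed

lemma has_cm_integral_unique:
  assumes "has_cm_integral M c f I" "has_cm_integral M c f J"
  shows "I = J"
proof -
  obtain p q r s where
    1: "\<forall>\<nu>\<in>{p, q, r, s}. finite_measure \<nu> \<and> sets \<nu> = sets M \<and> integrable \<nu> f"
      "\<forall>B\<in>sets M. c B = Complex (measure p B - measure q B) (measure r B - measure s B)"
      "I = (integral\<^sup>L p f - integral\<^sup>L q f) + \<i> * (integral\<^sup>L r f - integral\<^sup>L s f)"
    using assms(1) unfolding has_cm_integral_def by blast
  obtain p' q' r' s' where
    2: "\<forall>\<nu>\<in>{p', q', r', s'}. finite_measure \<nu> \<and> sets \<nu> = sets M \<and> integrable \<nu> f"
      "\<forall>B\<in>sets M. c B = Complex (measure p' B - measure q' B) (measure r' B - measure s' B)"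
      "J = (integral\<^sup>L p' f - integral\<^sup>L q' f) + \<i> * (integral\<^sup>L r' f - integral\<^sup>L s' f)"
    using assms(2) unfolding has_cm_integral_def by blast
  have "integral\<^sup>L p f - integral\<^sup>L q f = integral\<^sup>L p' f - integral\<^sup>L q' f"
    by (rule integral_cross_eq[where M = M]) (use 1 2 in auto)
  moreover have "integral\<^sup>L r f - integral\<^sup>L s f = integral\<^sup>L r' f - integral\<^sup>L s' f"
    by (rule integral_cross_eq[where M = M]) (use 1 2 in auto)
  ultimately show ?thesis using 1 2 by simp
qed


section \<open>The system of equations\<close>

definition diag_matrix :: "('m \<Rightarrow> 'a::zero) \<Rightarrow> 'a^'m^'m" where
  "diag_matrix d = (\<chi> i j. if i = j then d i else 0)"

text \<open>
  A rectangular matrix with \<open>CARD('N)\<close> rows and \<open>CARD('n)\<close> columns has type \<open>real^'n^'N\<close>.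
\<close>

abbreviation cmat :: "real^'n^'N \<Rightarrow> complex^'n^'N" where
  "cmat A \<equiv> map_matrix complex_of_real A"

definition D_mat :: "('N \<Rightarrow> 'n \<Rightarrow> real) \<Rightarrow> 'n \<Rightarrow> complex^'N^'N" where
  "D_mat \<sigma> j = diag_matrix (\<lambda>i. complex_of_real ((\<sigma> i j)\<^sup>2))"

definition D_tilde_mat :: "('N \<Rightarrow> 'n \<Rightarrow> real) \<Rightarrow> 'N \<Rightarrow> complex^'n^'n" where
  "D_tilde_mat \<sigma> i = diag_matrix (\<lambda>j. complex_of_real ((\<sigma> i j)\<^sup>2))"

definition Psi :: "('m \<Rightarrow> complex \<Rightarrow> complex) \<Rightarrow> complex \<Rightarrow> complex^'m^'m" where
  "Psi \<psi> z = diag_matrix (\<lambda>i. \<psi> i z)"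

definition T_inverse :: "real^'n^'N \<Rightarrow> ('N \<Rightarrow> complex \<Rightarrow> complex) \<Rightarrow> ('n \<Rightarrow> complex \<Rightarrow> complex) \<Rightarrow>
    complex \<Rightarrow> complex^'N^'N" where
  "T_inverse A \<psi> \<psi>' z =
     matrix_inv (Psi \<psi> z) - map_matrix ((*) z) (cmat A ** Psi \<psi>' z ** transpose (cmat A))"

definition T_tilde_inverse :: "real^'n^'N \<Rightarrow> ('N \<Rightarrow> complex \<Rightarrow> complex) \<Rightarrow>
    ('n \<Rightarrow> complex \<Rightarrow> complex) \<Rightarrow> complex \<Rightarrow> complex^'n^'n" where
  "T_tilde_inverse A \<psi> \<psi>' z =
     matrix_inv (Psi \<psi>' z) - map_matrix ((*) z) (transpose (cmat A) ** Psi \<psi> z ** cmat A)"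

definition T_mat :: "real^'n^'N \<Rightarrow> ('N \<Rightarrow> complex \<Rightarrow> complex) \<Rightarrow> ('n \<Rightarrow> complex \<Rightarrow> complex) \<Rightarrow>
    complex \<Rightarrow> complex^'N^'N" where
  "T_mat A \<psi> \<psi>' z = matrix_inv (T_inverse A \<psi> \<psi>' z)"

definition T_tilde_mat :: "real^'n^'N \<Rightarrow> ('N \<Rightarrow> complex \<Rightarrow> complex) \<Rightarrow> ('n \<Rightarrow> complex \<Rightarrow> complex) \<Rightarrow>
    complex \<Rightarrow> complex^'n^'n" where
  "T_tilde_mat A \<psi> \<psi>' z = matrix_inv (T_tilde_inverse A \<psi> \<psi>' z)"

text \<open>
  Since \<^const>\<open>matrix_inv\<close> is total, being a solution includes that the matrices to be inverted
  are invertible. The denominators of the two equations need no such clause: invertibility of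
  \<open>Psi \<psi> z\<close> and \<open>Psi \<psi>' z\<close> makes the left-hand sides nonzero, while division by zero gives zero.
\<close>

definition is_solution :: "real^'n^'N \<Rightarrow> ('N \<Rightarrow> 'n \<Rightarrow> real) \<Rightarrow>
    ('N \<Rightarrow> complex \<Rightarrow> complex) \<Rightarrow> ('n \<Rightarrow> complex \<Rightarrow> complex) \<Rightarrow> bool" where
  "is_solution A \<sigma> \<psi> \<psi>' \<longleftrightarrow>
     (\<forall>i. \<psi> i \<in> stieltjes_class) \<and> (\<forall>j. \<psi>' j \<in> stieltjes_class) \<and>
     (\<forall>z\<in>cut_plane.
        invertible (Psi \<psi> z) \<and> invertible (Psi \<psi>' z) \<and>
        invertible (T_inverse A \<psi> \<psi>' z) \<and> invertible (T_tilde_inverse A \<psi> \<psi>' z) \<and>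
        (\<forall>i. \<psi> i z = -1 / (z * (1 + 1 / of_nat CARD('n) * trace (D_tilde_mat \<sigma> i ** T_tilde_mat A \<psi> \<psi>' z)))) \<and>
        (\<forall>j. \<psi>' j z = -1 / (z * (1 + 1 / of_nat CARD('n) * trace (D_mat \<sigma> j ** T_mat A \<psi> \<psi>' z)))))"

end

theory Submission
  imports Defs "HOL-Probability.Probability" "HOL-Complex_Analysis.Complex_Analysis"
begin

text \<open>
  With \<open>z = - s\<^sup>2\<close>, \<open>Re s > 0\<close>, the cut plane becomes a half-plane and
  \<open>R = s T\<close>, \<open>R' = s T'\<close> (\<open>T'\<close> being the matrix written with a tilde in the paper) satisfy
  \<open>R = (diag (s + d) + A diag (1 / (s + e)) A\<^sup>T)\<^sup>-\<^sup>1\<close>,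
  \<open>R' = (diag (s + e) + A\<^sup>T diag (1 / (s + d)) A)\<^sup>-\<^sup>1\<close>, where
  \<open>d\<^sub>i = (1/n) \<Sum>\<^sub>j \<sigma>\<^sub>i\<^sub>j\<^sup>2 R'\<^sub>j\<^sub>j\<close>,
  \<open>e\<^sub>j = (1/n) \<Sum>\<^sub>i \<sigma>\<^sub>i\<^sub>j\<^sup>2 R\<^sub>i\<^sub>i\<close> and
  \<open>\<psi>\<^sub>i = 1 / (s (s + d\<^sub>i))\<close>, \<open>\<psi>'\<^sub>j = 1 / (s (s + e\<^sub>j))\<close>.
  All matrices being inverted are accretive: their Hermitian part is at least \<open>Re s\<close>. Hence the
  map \<open>(d, e) \<mapsto> (d, e)\<close> preserves nonnegative real parts, has values bounded by a multiple of
  \<open>1 / Re s\<close>, and is a contraction for large \<open>Re s\<close>. Uniqueness follows on large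
  positive \<open>s\<close> and then everywhere by the identity theorem; for existence, Montel's theorem gives a
  limit of the iterates, which is a fixed point for large \<open>Re s\<close> and hence everywhere.

  A holomorphic \<open>\<phi>\<close> with \<open>Re \<phi> > 0\<close> on the half-plane, real on the real
  axis and with \<open>x \<phi>(x) \<longlongrightarrow> m\<close>, is \<open>s\<close> times the Stieltjes transform at
  \<open>- s\<^sup>2\<close> of a measure of mass \<open>m\<close> on the half line: a Cayley transform reduces this to
  Herglotz' representation on the disc, obtained from the Poisson formula and Helly's theorem. Applied to
  the quadratic forms \<open>y\<^sup>T R y\<close> with real \<open>y\<close> this gives the matrix measure by polarization; it is
  positive because a measure is determined by its Stieltjes transform.
\<close>

(* Formal power series would make $ ambiguous. *)
unbundle no Formal_Power_Series.fps_syntax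

section \<open>Stieltjes transforms of finite measures\<close>

text \<open>In the variable s the two families of equations become mirror images (exchange
  \<open>A\<close> with its transpose, d with e, and the weights), and positivity of real parts is
  their natural invariant: it makes the inverses exist, bounds them by \<open>1 / Re s\<close> and
  passes to them. The contraction constant, however, is of order \<open>1 / (Re s)\<^sup>2\<close>
  for large \<open>Re s\<close>, so it gives no information near the imaginary axis; there only
  compactness and analytic continuation help. The representing measure lives on the half line rather
  than the whole line because, for a function real on the real axis, the kernel can be averaged over
  the angles \<theta> and -\<theta> and then depends only on u = (1 - cos \<theta>) / 2. On the
  half-plane it becomes s / (1 - u + u s^2), which is s / u times 1 / (t + s^2) with t = (1 - u) /
  u. The delicate point is u = 0, that is t = \<infinity>: mass there would add a linear term to
  \<phi>, and the existence of the limit of x \<phi>(x) excludes it.\<close>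

lemma closed_nonneg_reals_complex: "closed (complex_of_real ` {0..})"
proof -
  have "complex_of_real ` {0..} = \<real>\<^sub>\<ge>\<^sub>0"
    by (auto simp: nonneg_Reals_def)
  then show ?thesis
    using closed_nonneg_Reals_complex by simp
qed

lemma open_cut_plane: "open cut_plane"
  using closed_nonneg_reals_complex by (simp add: open_Compl)

text \<open>The radius is halved so that one lower bound for the distance to the half line serves
  every point of a neighbourhood of \<open>z\<close>; this uniform bound later dominates difference
  quotients.\<close>

lemma cut_plane_dist:
  assumes "z \<in> cut_plane"
  obtains d where "d > 0" "ball z d \<subseteq> cut_plane" "\<And>t w. 0 \<le> t \<Longrightarrow> w \<in> ball z d \<Longrightarrow> d \<le> cmod (of_real t - w)"
proof -
  obtain e where e: "e > 0" "ball z e \<subseteq> cut_plane"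
    using open_cut_plane assms open_contains_ball by blast
  show thesis
  proof (rule that[of "e / 2"])
    show "ball z (e/2) \<subseteq> cut_plane" using e by (auto simp: subset_iff)
    fix t :: real and w assume t: "0 \<le> t" and w: "w \<in> ball z (e/2)"
    have "of_real t \<notin> ball z e" using e t by auto
    then have "e \<le> dist z (of_real t)" by (simp add: not_less)
    also have "\<dots> \<le> dist z w + dist w (of_real t)" by (rule dist_triangle)
    finally show "e / 2 \<le> cmod (of_real t - w)" using w by (auto simp: dist_norm norm_minus_commute)
  qed (use e in auto)
qed

section \<open>Differentiating the transform under the integral sign\<close>

lemma borel_measurable_borel_nonneg:
  assumes "sets \<nu> = sets borel_nonneg" "f \<in> borel_measurable borel"
  shows "f \<in> borel_measurable \<nu>"
  using assms by (metis measurable_cong_sets measurable_restrict_space1)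

lemma space_borel_nonneg: "sets \<nu> = sets borel_nonneg \<Longrightarrow> space \<nu> = {0..}"
  by (metis Int_UNIV_right sets_eq_imp_space_eq space_borel space_restrict_space)

lemma integrable_cauchy_power:
  assumes "finite_measure \<nu>" "sets \<nu> = sets borel_nonneg" "z \<in> cut_plane"
  shows "integrable \<nu> (\<lambda>t. 1 / (complex_of_real t - z) ^ m)"
proof -
  interpret finite_measure \<nu> by fact
  obtain d where d: "d > 0" "\<And>t w. 0 \<le> t \<Longrightarrow> w \<in> ball z d \<Longrightarrow> d \<le> cmod (of_real t - w)"
    using cut_plane_dist[OF assms(3)] by metis
  show ?thesis
  proof (rule integrable_const_bound)
    show "AE t in \<nu>. norm (1 / (complex_of_real t - z) ^ m) \<le> 1 / d ^ m"
      using d(2)[of _ z] d(1)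
      by (auto intro!: AE_I2 frac_le power_mono zero_less_power simp: space_borel_nonneg[OF assms(2)] norm_divide norm_power)
    show "(\<lambda>t. 1 / (complex_of_real t - z) ^ m) \<in> borel_measurable \<nu>"
      by (rule borel_measurable_borel_nonneg[OF assms(2)]) measurable
  qed
qed

text \<open>The derivative of the integrand is at most \<open>m / d ^ Suc m\<close> on a ball away
  from the half line, so the mean value inequality bounds all difference quotients by this constant,
  which is integrable for a finite measure. All powers are treated at once because the moments need
  higher derivatives.\<close>

lemma has_field_derivative_cauchy_power:
  assumes fin: "finite_measure \<nu>" and s: "sets \<nu> = sets borel_nonneg" and z: "z \<in> cut_plane"
  shows "((\<lambda>z. LINT t|\<nu>. 1 / (complex_of_real t - z) ^ m) has_field_derivative
           of_nat m * (LINT t|\<nu>. 1 / (complex_of_real t - z) ^ Suc m)) (at z)"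
proof -
  interpret finite_measure \<nu> by fact
  obtain d where d: "d > 0" "ball z d \<subseteq> cut_plane"
      "\<And>t w. 0 \<le> t \<Longrightarrow> w \<in> ball z d \<Longrightarrow> d \<le> cmod (of_real t - w)"
    using cut_plane_dist[OF z] by metis
  define g where "g t w = 1 / (complex_of_real t - w) ^ m" for t :: real and w
  define g' where "g' t w = of_nat m * (1 / (complex_of_real t - w) ^ Suc m)" for t :: real and w
  have der: "(g t has_field_derivative g' t w) (at w)" if "0 \<le> t" "w \<in> ball z d" for t w
  proof -
    have nz: "complex_of_real t - w \<noteq> 0" using d(3)[OF that] d(1) by auto
    have "((\<lambda>w. 1 / (complex_of_real t - w) ^ m) has_field_derivative
        of_nat m * (1 / (complex_of_real t - w) ^ Suc m)) (at w)"
    proof -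
      have "((\<lambda>w. 1 / (complex_of_real t - w)) has_field_derivative (1 / (complex_of_real t - w)) ^ 2) (at w)"
        using nz by (auto intro!: derivative_eq_intros simp: power2_eq_square)
      from DERIV_power[OF this, of m] show ?thesis
        by (cases m) (simp_all add: power2_eq_square power_one_over mult_ac)
    qed
    then show ?thesis unfolding g_def g'_def .
  qed
  have bnd: "norm (g' t w) \<le> m / d ^ Suc m" if "0 \<le> t" "w \<in> ball z d" for t w
    using d(3)[OF that] d(1) unfolding g'_def
    by (auto simp: norm_mult norm_divide norm_power simp del: power_Suc intro!: divide_left_mono power_mono zero_less_power mult_pos_pos)
  have lip: "norm (g t w - g t z) \<le> m / d ^ Suc m * norm (w - z)" if "0 \<le> t" "w \<in> ball z d" for t w
    by (rule field_differentiable_bound[of "ball z d" "g t" "g' t"])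
       (use that d bnd der in \<open>auto intro: has_field_derivative_at_within\<close>)
  have int: "integrable \<nu> (\<lambda>t. g t w)" if "w \<in> cut_plane" for w
    unfolding g_def by (rule integrable_cauchy_power[OF fin s that])
  have "((\<lambda>w. ((LINT t|\<nu>. g t w) - (LINT t|\<nu>. g t z)) / (w - z)) \<longlongrightarrow> (LINT t|\<nu>. g' t z)) (at z)"
    unfolding tendsto_at_iff_sequentially comp_def
  proof (intro allI impI)
    fix X assume X0: "\<forall>i. X i \<in> UNIV - {z}" and X: "X \<longlonglongrightarrow> z"
    from X have "\<forall>\<^sub>F i in sequentially. X i \<in> ball z d"
      using d(1) by (simp add: tendsto_iff dist_commute)
    then obtain N where N: "\<And>i. i \<ge> N \<Longrightarrow> X i \<in> ball z d" by (auto simp: eventually_sequentially)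
    \<comment> \<open>Only a tail of the sequence is known to stay in the ball where the domination
      holds.\<close>
    define Y where "Y i = X (i + N)" for i
    have Y: "Y i \<in> ball z d" "Y i \<noteq> z" for i using N[of "i+N"] X0 by (auto simp: Y_def)
    have Yl: "Y \<longlonglongrightarrow> z" unfolding Y_def using X by (rule LIMSEQ_ignore_initial_segment)
    have "(\<lambda>i. LINT t|\<nu>. (g t (Y i) - g t z) / (Y i - z)) \<longlonglongrightarrow> (LINT t|\<nu>. g' t z)"
    proof (rule integral_dominated_convergence[where w="\<lambda>_. m / d ^ Suc m"])
      show "(\<lambda>t. g' t z) \<in> borel_measurable \<nu>"
        unfolding g'_def by (rule borel_measurable_borel_nonneg[OF s]) measurable
      show "(\<lambda>t. (g t (Y i) - g t z) / (Y i - z)) \<in> borel_measurable \<nu>" for i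
        unfolding g_def by (rule borel_measurable_borel_nonneg[OF s]) measurable
      show "AE t in \<nu>. (\<lambda>i. (g t (Y i) - g t z) / (Y i - z)) \<longlonglongrightarrow> g' t z"
      proof (rule AE_I2)
        fix t assume "t \<in> space \<nu>"
        then have "t \<ge> 0" using space_borel_nonneg[OF s] by auto
        then have "(g t has_field_derivative g' t z) (at z)" using der d(1) by auto
        then have "((\<lambda>w. (g t w - g t z) / (w - z)) \<longlongrightarrow> g' t z) (at z)"
          by (simp add: has_field_derivative_iff)
        then show "(\<lambda>i. (g t (Y i) - g t z) / (Y i - z)) \<longlonglongrightarrow> g' t z"
          using Y Yl unfolding tendsto_at_iff_sequentially comp_def by simp
      qed
      show "AE t in \<nu>. norm ((g t (Y i) - g t z) / (Y i - z)) \<le> m / d ^ Suc m" for i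
      proof (rule AE_I2)
        fix t assume "t \<in> space \<nu>"
        then have "t \<ge> 0" using space_borel_nonneg[OF s] by auto
        then show "norm ((g t (Y i) - g t z) / (Y i - z)) \<le> m / d ^ Suc m"
          using lip[of t "Y i"] Y[of i] by (simp add: norm_divide divide_le_eq)
      qed
    qed simp
    moreover have "(LINT t|\<nu>. (g t (Y i) - g t z) / (Y i - z)) =
        ((LINT t|\<nu>. g t (Y i)) - (LINT t|\<nu>. g t z)) / (Y i - z)" for i
    proof -
      have "integrable \<nu> (\<lambda>t. g t (Y i))" "integrable \<nu> (\<lambda>t. g t z)"
        using int Y[of i] d(2) z by auto
      then show ?thesis by simp
    qed
    ultimately have "(\<lambda>i. ((LINT t|\<nu>. g t (X (i+N))) - (LINT t|\<nu>. g t z)) / (X (i+N) - z)) \<longlonglongrightarrow> (LINT t|\<nu>. g' t z)"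
      by (simp only: Y_def)
    then show "(\<lambda>i. ((LINT t|\<nu>. g t (X i)) - (LINT t|\<nu>. g t z)) / (X i - z)) \<longlonglongrightarrow> (LINT t|\<nu>. g' t z)"
      by (rule LIMSEQ_offset)
  qed
  moreover have "(LINT t|\<nu>. g' t z) = of_nat m * (LINT t|\<nu>. 1 / (complex_of_real t - z) ^ Suc m)"
    unfolding g'_def by (rule integral_mult_right_zero)
  ultimately show ?thesis
    unfolding has_field_derivative_iff g_def by simp
qed

lemma stieltjes_holomorphic:
  assumes "finite_measure \<nu>" "sets \<nu> = sets borel_nonneg"
  shows "stieltjes \<nu> holomorphic_on cut_plane"
proof -
  have eq: "stieltjes \<nu> = (\<lambda>z. LINT t|\<nu>. 1 / (complex_of_real t - z) ^ 1)"
    by (simp add: stieltjes_def fun_eq_iff)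
  show ?thesis unfolding eq
  proof (rule holomorphic_onI)
    fix z assume "z \<in> cut_plane"
    from has_field_derivative_cauchy_power[OF assms this, of 1]
    show "(\<lambda>z. LINT t|\<nu>. 1 / (complex_of_real t - z) ^ 1) field_differentiable at z within cut_plane"
      by (metis field_differentiable_at_within field_differentiable_def)
  qed
qed

section \<open>Injectivity of the transform on signed combinations of measures\<close>

text \<open>Differentiating the vanishing combination \<open>m\<close> times raises the Cauchy
  kernel to the power \<open>Suc m\<close>, up to nonzero integer factors that cancel. At the point
  -1 the kernel is 1 / (1 + t), which takes values in [0, 1] and so brings the problem to a compact
  interval.\<close>

lemma stieltjes_combination_moments:
  assumes K: "finite K" "\<And>k. k \<in> K \<Longrightarrow> finite_measure (\<nu> k)"
      "\<And>k. k \<in> K \<Longrightarrow> sets (\<nu> k) = sets borel_nonneg"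
    and 0: "\<And>z. z \<in> cut_plane \<Longrightarrow> (\<Sum>k\<in>K. complex_of_real (c k) * stieltjes (\<nu> k) z) = 0"
  shows "(\<Sum>k\<in>K. c k * (LINT t|\<nu> k. (1 / (1 + t)) ^ Suc m)) = 0"
proof -
  define F where "F k m z = (LINT t|\<nu> k. 1 / (complex_of_real t - z) ^ m)" for k m z
  have F0: "(\<Sum>k\<in>K. complex_of_real (c k) * F k (Suc m) z) = 0" if "z \<in> cut_plane" for m z
    using that
  proof (induction m arbitrary: z)
    case 0
    then show ?case using assms(4) by (simp add: F_def stieltjes_def)
  next
    case (Suc m)
    have "((\<lambda>z. \<Sum>k\<in>K. complex_of_real (c k) * F k (Suc m) z) has_field_derivative
        (\<Sum>k\<in>K. complex_of_real (c k) * (of_nat (Suc m) * F k (Suc (Suc m)) z))) (at z)"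
      unfolding F_def
      by (intro DERIV_sum DERIV_cmult has_field_derivative_cauchy_power K Suc.prems)
    moreover have "((\<lambda>z. \<Sum>k\<in>K. complex_of_real (c k) * F k (Suc m) z) has_field_derivative 0) (at z)"
    proof (rule has_field_derivative_transform_within_open[of "\<lambda>_. 0"])
      show "open cut_plane" by (rule open_cut_plane)
    qed (use Suc in auto)
    ultimately have "(\<Sum>k\<in>K. complex_of_real (c k) * (of_nat (Suc m) * F k (Suc (Suc m)) z)) = 0"
      by (rule DERIV_unique)
    then have "of_nat (Suc m) * (\<Sum>k\<in>K. complex_of_real (c k) * F k (Suc (Suc m)) z) = 0"
      by (simp only: sum_distrib_left mult.left_commute)
    then show ?case by (simp del: of_nat_Suc)
  qed
  have m1: "-1 \<in> cut_plane" by (auto simp: complex_eq_iff)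
  have "F k (Suc m) (-1) = complex_of_real (LINT t|\<nu> k. (1 / (1 + t)) ^ Suc m)" for k
    unfolding F_def integral_complex_of_real[symmetric]
    by (rule Bochner_Integration.integral_cong) (auto simp: power_divide add.commute)
  with F0[OF m1, of m] have "complex_of_real (\<Sum>k\<in>K. c k * (LINT t|\<nu> k. (1 / (1 + t)) ^ Suc m)) = 0"
    by simp
  then show ?thesis by (metis of_real_eq_0_iff)
qed

text \<open>
  Uniqueness is needed for signed combinations, which positivity of the matrix measure involves. The moments
  of \<open>u = 1 / (1 + t)\<close> vanish, hence by Weierstrass the integrals of \<open>u g(u)\<close> for
  continuous \<open>g\<close>, hence the measures of \<open>[0, b]\<close>.
\<close>

lemma stieltjes_combination_eq_0:
  assumes K: "finite K" "\<And>k. k \<in> K \<Longrightarrow> finite_measure (\<nu> k)"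
      "\<And>k. k \<in> K \<Longrightarrow> sets (\<nu> k) = sets borel_nonneg"
    and 0: "\<And>z. z \<in> cut_plane \<Longrightarrow> (\<Sum>k\<in>K. complex_of_real (c k) * stieltjes (\<nu> k) z) = 0"
    and B: "B \<in> sets borel_nonneg"
  shows "(\<Sum>k\<in>K. c k * measure (\<nu> k) B) = 0"
proof -
  define u :: "real \<Rightarrow> real" where "u t = 1 / (1 + t)" for t
  have u01: "u t \<in> {0..1}" if "t \<ge> 0" for t using that by (auto simp: u_def)
  have um [measurable]: "u \<in> borel_measurable borel" unfolding u_def by measurable
  have int: "integrable (\<nu> k) f" if "k \<in> K" "f \<in> borel_measurable borel" "\<And>t. t \<ge> 0 \<Longrightarrow> \<bar>f t\<bar> \<le> M"
    for k M and f :: "real \<Rightarrow> real"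
  proof (rule finite_measure.integrable_const_bound[where B=M])
    show "finite_measure (\<nu> k)" using K that(1) by simp
    show "f \<in> borel_measurable (\<nu> k)" using K that by (simp add: borel_measurable_borel_nonneg)
    show "AE t in \<nu> k. norm (f t) \<le> M"
      using that(3) space_borel_nonneg[OF K(3)[OF that(1)]] by (intro AE_I2) auto
  qed
  have um_pow: "integrable (\<nu> k) (\<lambda>t. u t ^ m)" if "k \<in> K" for k m
  proof (rule int[OF that, of _ 1])
    fix t :: real assume "t \<ge> 0"
    then show "\<bar>u t ^ m\<bar> \<le> 1"
      using u01[of t] by (simp add: power_abs power_le_one)
  qed measurable
  have poly: "(\<Sum>k\<in>K. c k * (LINT t|\<nu> k. u t * (\<Sum>i\<le>n. a i * u t ^ i))) = 0" for a and n :: nat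
  proof -
    have "(LINT t|\<nu> k. u t * (\<Sum>i\<le>n. a i * u t ^ i)) = (\<Sum>i\<le>n. a i * (LINT t|\<nu> k. u t ^ Suc i))"
      if "k \<in> K" for k
    proof -
      have "(LINT t|\<nu> k. u t * (\<Sum>i\<le>n. a i * u t ^ i)) = (LINT t|\<nu> k. (\<Sum>i\<le>n. a i * u t ^ Suc i))"
        by (simp add: sum_distrib_left mult.left_commute)
      also have "\<dots> = (\<Sum>i\<le>n. a i * (LINT t|\<nu> k. u t ^ Suc i))"
        using um_pow[OF that] by (simp del: power_Suc)
      finally show ?thesis .
    qed
    then have "(\<Sum>k\<in>K. c k * (LINT t|\<nu> k. u t * (\<Sum>i\<le>n. a i * u t ^ i))) =
        (\<Sum>k\<in>K. c k * (\<Sum>i\<le>n. a i * (LINT t|\<nu> k. u t ^ Suc i)))" by simp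
    also have "\<dots> = (\<Sum>i\<le>n. a i * (\<Sum>k\<in>K. c k * (LINT t|\<nu> k. u t ^ Suc i)))"
      unfolding sum_distrib_left by (subst sum.swap) (simp add: mult.left_commute)
    also have "\<dots> = 0"
      using stieltjes_combination_moments[OF K 0] unfolding u_def by simp
    finally show ?thesis .
  qed
  have cont: "(\<Sum>k\<in>K. c k * (LINT t|\<nu> k. u t * g (u t))) = 0" if g: "continuous_on UNIV g" for g
  proof (rule ccontr)
    define C where "C = (\<Sum>k\<in>K. \<bar>c k\<bar> * measure (\<nu> k) (space (\<nu> k)))"
    define S where "S = (\<Sum>k\<in>K. c k * (LINT t|\<nu> k. u t * g (u t)))"
    have C0: "C \<ge> 0" unfolding C_def by (intro sum_nonneg) auto
    assume "(\<Sum>k\<in>K. c k * (LINT t|\<nu> k. u t * g (u t))) \<noteq> 0"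
    then have S: "\<bar>S\<bar> > 0" by (simp add: S_def)
    \<comment> \<open>The added 1 covers \<open>C = 0\<close> and makes \<open>e * C\<close>
      strictly smaller than \<open>\<bar>S\<bar>\<close>, which is the contradiction at the
      end.\<close>
    define e where "e = \<bar>S\<bar> / (C + 1)"
    have e: "e > 0" using S C0 by (simp add: e_def)
    obtain p where p: "real_polynomial_function p" "\<And>x. x \<in> {0..1} \<Longrightarrow> \<bar>g x - p x\<bar> < e"
      using Stone_Weierstrass_real_polynomial_function[of "{0..1::real}" g e] e continuous_on_subset[OF g]
      by auto
    then obtain a n where an: "p = (\<lambda>x. \<Sum>i\<le>n. a i * x ^ i)"
      using real_polynomial_function_iff_sum by blast
    have gm [measurable]: "g \<in> borel_measurable borel" using g by (rule borel_measurable_continuous_onI)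
    have pm [measurable]: "p \<in> borel_measurable borel" unfolding an by measurable
    have "continuous_on {0..1} g" using g continuous_on_subset by blast
    then have "compact (g ` {0..1})" by (intro compact_continuous_image) auto
    then obtain M where M: "\<And>x. x \<in> {0..1} \<Longrightarrow> \<bar>g x\<bar> \<le> M"
      using compact_imp_bounded bounded_iff by (metis imageI real_norm_def)
    have ig: "integrable (\<nu> k) (\<lambda>t. u t * g (u t))" if "k \<in> K" for k
    proof (rule int[OF that, of _ M])
      fix t :: real assume "t \<ge> 0"
      then have "\<bar>u t\<bar> \<le> 1" "\<bar>g (u t)\<bar> \<le> M" using u01[of t] M by auto
      then show "\<bar>u t * g (u t)\<bar> \<le> M"
        unfolding abs_mult by (metis abs_ge_zero mult_left_le_one_le order_trans)
    qed measurable
    have close: "\<bar>u t * g (u t) - u t * p (u t)\<bar> \<le> e" if "t \<ge> 0" for t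
    proof -
      have "\<bar>u t * g (u t) - u t * p (u t)\<bar> = \<bar>u t\<bar> * \<bar>g (u t) - p (u t)\<bar>"
        by (simp add: abs_mult flip: right_diff_distrib)
      also have "\<dots> \<le> 1 * e" using u01[OF that] p(2)[OF u01[OF that]] by (intro mult_mono) auto
      finally show ?thesis by simp
    qed
    have ip: "integrable (\<nu> k) (\<lambda>t. u t * p (u t))" if "k \<in> K" for k
    proof (rule int[OF that, of _ "M + e"])
      fix t :: real assume t: "t \<ge> 0"
      have "\<bar>u t * g (u t)\<bar> \<le> M" using u01[OF t] M[OF u01[OF t]]
        unfolding abs_mult by (smt (verit) atLeastAtMost_iff mult_left_le_one_le abs_of_nonneg)
      then show "\<bar>u t * p (u t)\<bar> \<le> M + e" using close[OF t] by linarith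
    qed measurable
    have "S = (\<Sum>k\<in>K. c k * (LINT t|\<nu> k. u t * g (u t))) - (\<Sum>k\<in>K. c k * (LINT t|\<nu> k. u t * p (u t)))"
      using poly[of a n] by (simp add: S_def an)
    also have "\<dots> = (\<Sum>k\<in>K. c k * (LINT t|\<nu> k. u t * g (u t) - u t * p (u t)))"
      using ig ip by (simp add: right_diff_distrib flip: sum_subtractf)
    also have "\<bar>\<dots>\<bar> \<le> (\<Sum>k\<in>K. \<bar>c k\<bar> * (e * measure (\<nu> k) (space (\<nu> k))))"
    proof (rule order_trans[OF sum_abs sum_mono])
      fix k assume k: "k \<in> K"
      interpret finite_measure "\<nu> k" using K k by auto
      have "\<bar>LINT t|\<nu> k. u t * g (u t) - u t * p (u t)\<bar> \<le> (LINT t|\<nu> k. \<bar>u t * g (u t) - u t * p (u t)\<bar>)"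
        by (rule integral_abs_bound)
      also have "\<dots> \<le> (LINT t|\<nu> k. e)"
        using ig[OF k] ip[OF k] close space_borel_nonneg[OF K(3)[OF k]] by (intro integral_mono) auto
      finally show "\<bar>c k * (LINT t|\<nu> k. u t * g (u t) - u t * p (u t))\<bar> \<le> \<bar>c k\<bar> * (e * measure (\<nu> k) (space (\<nu> k)))"
        by (simp add: abs_mult mult.commute mult_left_mono)
    qed
    also have "\<dots> = e * C" by (simp add: C_def sum_distrib_left mult_ac)
    also have "\<dots> < \<bar>S\<bar>" using S C0 by (simp add: e_def field_simps)
    finally show False by simp
  qed
  have ray: "(\<Sum>k\<in>K. c k * measure (\<nu> k) ({..b} \<inter> {0..})) = 0" for b :: real
  proof (cases "b \<ge> 0")
    case True
    define \<beta> where "\<beta> = u b"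
    have \<beta>: "\<beta> > 0" using True by (simp add: \<beta>_def u_def)
    \<comment> \<open>For positive \<open>n\<close> the numerator is a ramp from 0 at
      \<open>\<beta> - 1 / n\<close> to 1 at \<open>\<beta>\<close>. Dividing by
      \<open>max x \<beta>\<close> undoes the factor \<open>u t\<close> where \<open>u t\<close> is
      at least \<open>\<beta>\<close>, that is for \<open>t \<le> b\<close>, and stays continuous at
      0. So \<open>u t * g n (u t)\<close> tends to the indicator of the ray.\<close>
    define g where "g n x = max 0 (min 1 (1 + real n * (x - \<beta>))) / max x \<beta>" for n x
    have gc: "continuous_on UNIV (g n)" for n
      using \<beta> unfolding g_def by (intro continuous_intros) auto
    have gm [measurable]: "g n \<in> borel_measurable borel" for n using gc by (rule borel_measurable_continuous_onI)
    have ub: "\<beta> \<le> u t \<longleftrightarrow> t \<le> b" if "t \<ge> 0" for t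
      using that True by (auto simp: \<beta>_def u_def divide_simps)
    have lim: "(\<lambda>n. LINT t|\<nu> k. u t * g n (u t)) \<longlonglongrightarrow> measure (\<nu> k) ({..b} \<inter> {0..})" if k: "k \<in> K" for k
    proof -
      interpret finite_measure "\<nu> k" using K k by auto
      have sp: "space (\<nu> k) = {0..}" using K k space_borel_nonneg by auto
      have "(\<lambda>n. LINT t|\<nu> k. u t * g n (u t)) \<longlonglongrightarrow> (LINT t|\<nu> k. indicator {..b} t)"
      proof (rule integral_dominated_convergence[where w="\<lambda>_. 1"])
        show "(\<lambda>t. indicat_real {..b} t) \<in> borel_measurable (\<nu> k)"
          by (rule borel_measurable_borel_nonneg[OF K(3)[OF k]]) simp
        show "(\<lambda>t. u t * g n (u t)) \<in> borel_measurable (\<nu> k)" for n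
          by (rule borel_measurable_borel_nonneg[OF K(3)[OF k]]) measurable
        show "AE t in \<nu> k. norm (u t * g n (u t)) \<le> 1" for n
        proof (rule AE_I2)
          fix t assume "t \<in> space (\<nu> k)"
          then have "u t \<ge> 0" using sp u01 by auto
          then have "\<bar>u t * g n (u t)\<bar> = u t / max (u t) \<beta> * max 0 (min 1 (1 + real n * (u t - \<beta>)))"
            using \<beta> by (simp add: g_def abs_mult)
          also have "\<dots> \<le> 1 * 1" using \<open>u t \<ge> 0\<close> \<beta> by (intro mult_mono) (auto simp: divide_le_eq)
          finally show "norm (u t * g n (u t)) \<le> 1" by simp
        qed
        show "AE t in \<nu> k. (\<lambda>n. u t * g n (u t)) \<longlonglongrightarrow> indicator {..b} t"
        proof (rule AE_I2)
          fix t assume "t \<in> space (\<nu> k)"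
          then have t: "t \<ge> 0" using sp by auto
          show "(\<lambda>n. u t * g n (u t)) \<longlonglongrightarrow> indicator {..b} t"
          proof (cases "t \<le> b")
            case True
            then have "u t \<ge> \<beta>" using ub t by auto
            then have "u t * g n (u t) = 1" for n using \<beta> by (simp add: g_def)
            then show ?thesis using True by simp
          next
            case False
            then have lt: "u t < \<beta>" using ub t by (simp add: not_le[symmetric])
            obtain N where N: "real N * (\<beta> - u t) > 1" using lt reals_Archimedean3[of "\<beta> - u t"] by auto
            have "u t * g n (u t) = 0" if "n \<ge> N" for n
            proof -
              have "real N * (\<beta> - u t) \<le> real n * (\<beta> - u t)" using lt that
                by (intro mult_right_mono) auto
              with N have "1 < real n * (\<beta> - u t)" by linarith
              then have "1 + real n * (u t - \<beta>) \<le> 0" by (simp add: algebra_simps)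
              then show ?thesis by (simp add: g_def)
            qed
            then have "(\<lambda>n. u t * g n (u t)) \<longlonglongrightarrow> 0"
              by (intro tendsto_eventually eventually_sequentiallyI[of N]) auto
            then show ?thesis using False by simp
          qed
        qed
      qed simp
      moreover have "(LINT t|\<nu> k. indicator {..b} t) = measure (\<nu> k) ({..b} \<inter> {0..})"
        using sp by simp
      ultimately show ?thesis by simp
    qed
    have "(\<lambda>n. \<Sum>k\<in>K. c k * (LINT t|\<nu> k. u t * g n (u t))) \<longlonglongrightarrow> (\<Sum>k\<in>K. c k * measure (\<nu> k) ({..b} \<inter> {0..}))"
      by (intro tendsto_sum tendsto_mult lim tendsto_const)
    then show ?thesis using cont[OF gc] by (simp add: LIMSEQ_const_iff)
  next
    case False
    then have "{..b} \<inter> {0..} = {}" by auto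
    then show ?thesis by simp
  qed
  have in_sets: "X \<inter> {0..} \<in> sets (\<nu> k)" if "X \<in> sets borel" "k \<in> K" for X k
    using that K(3) by (auto simp: sets_restrict_space Int_commute)
  \<comment> \<open>Complements in the Dynkin induction below are taken inside the half line, so the
    relation is needed for the whole half line too.\<close>
  have total: "(\<Sum>k\<in>K. c k * measure (\<nu> k) {0..}) = 0"
  proof -
    have "(\<lambda>n. measure (\<nu> k) ({..real n} \<inter> {0..})) \<longlonglongrightarrow> measure (\<nu> k) {0..}" if k: "k \<in> K" for k
    proof -
      interpret finite_measure "\<nu> k" using K k by auto
      have "(\<lambda>n. measure (\<nu> k) ({..real n} \<inter> {0..})) \<longlonglongrightarrow> measure (\<nu> k) (\<Union>n. {..real n} \<inter> {0..})"
        using in_sets k by (intro finite_Lim_measure_incseq) (auto simp: incseq_def)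
      moreover have "(\<Union>n. {..real n} \<inter> {0..}) = {0..}" by (auto simp: real_arch_simple)
      ultimately show ?thesis by simp
    qed
    then have "(\<lambda>n. \<Sum>k\<in>K. c k * measure (\<nu> k) ({..real n} \<inter> {0..})) \<longlonglongrightarrow> (\<Sum>k\<in>K. c k * measure (\<nu> k) {0..})"
      by (intro tendsto_sum tendsto_mult tendsto_const)
    then show ?thesis using ray by (simp add: LIMSEQ_const_iff)
  qed
  \<comment> \<open>A signed combination need not be a measure, so the Dynkin argument runs on the
    linear relation itself; the rays form a generator stable under intersection.\<close>
  have "(\<Sum>k\<in>K. c k * measure (\<nu> k) (X \<inter> {0..})) = 0" if "X \<in> sets borel" for X
  proof -
    have gen: "sets borel = sigma_sets UNIV (range (\<lambda>a::real. {..a}))"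
      by (subst borel_eq_atMost) (simp add: sets_measure_of_conv)
    have st: "Int_stable (range (\<lambda>a::real. {..a}))"
      by (auto simp: Int_stable_def)
    have sub: "range (\<lambda>a::real. {..a}) \<subseteq> Pow UNIV" by simp
    have "X \<in> sigma_sets UNIV (range (\<lambda>a::real. {..a}))" using that gen by simp
    with st sub show ?thesis
    proof (induction rule: sigma_sets_induct_disjoint)
      case (basic A)
      then show ?case using ray by auto
    next
      case empty
      then show ?case by simp
    next
      case (compl A)
      have "measure (\<nu> k) ((UNIV - A) \<inter> {0..}) = measure (\<nu> k) {0..} - measure (\<nu> k) (A \<inter> {0..})" if k: "k \<in> K" for k
      proof -
        interpret finite_measure "\<nu> k" using K k by auto
        have "(UNIV - A) \<inter> {0..} = space (\<nu> k) - A \<inter> {0..}" using space_borel_nonneg[OF K(3)[OF k]] by auto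
        then show ?thesis
          using finite_measure_compl[of "A \<inter> {0..}"] in_sets[of A k] compl(1) gen k space_borel_nonneg[OF K(3)[OF k]] by simp
      qed
      then show ?case using total compl(2) by (simp add: right_diff_distrib sum_subtractf)
    next
      case (union A)
      have "(\<lambda>i. measure (\<nu> k) (A i \<inter> {0..})) sums measure (\<nu> k) (\<Union>(range A) \<inter> {0..})" if k: "k \<in> K" for k
      proof -
        interpret finite_measure "\<nu> k" using K k by auto
        have "(\<lambda>i. measure (\<nu> k) (A i \<inter> {0..})) sums measure (\<nu> k) (\<Union>i. A i \<inter> {0..})"
        proof (rule finite_measure_UNION)
          show "range (\<lambda>i. A i \<inter> {0..}) \<subseteq> sets (\<nu> k)" using in_sets union(2) gen k by auto
          show "disjoint_family (\<lambda>i. A i \<inter> {0..})" using union(1) by (auto simp: disjoint_family_on_def)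
        qed
        then show ?thesis by simp
      qed
      then have "(\<lambda>i. \<Sum>k\<in>K. c k * measure (\<nu> k) (A i \<inter> {0..})) sums (\<Sum>k\<in>K. c k * measure (\<nu> k) (\<Union>(range A) \<inter> {0..}))"
        by (intro sums_sum sums_mult)
      then show ?case using union(3) by (simp add: sums_iff)
    qed
  qed
  moreover obtain X where "X \<in> sets borel" "B = X \<inter> {0..}"
    using B by (auto simp: sets_restrict_space Int_commute)
  ultimately show ?thesis by simp
qed

section \<open>The Stieltjes representation on the right half-plane\<close>

text \<open>The Herglotz kernel (exp(i x) + w) / (exp(i x) - w) averaged over the angles x and -x,
  in terms of \<open>c\<close> = cos x. Unlike the real Poisson kernel it is holomorphic in
  \<open>w\<close>.\<close>

definition poisson_kernel :: "complex \<Rightarrow> real \<Rightarrow> complex" where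
  "poisson_kernel w c = (1 - w\<^sup>2) / (1 - 2 * of_real c * w + w\<^sup>2)"

lemma poisson_kernel_denominator:
  "1 - 2 * of_real (cos x) * w + w\<^sup>2 = (1 - w * cis x) * (1 - w * cis (- x))"
proof -
  have "cis x + cis (- x) = 2 * of_real (cos x)" by (simp add: complex_eq_iff)
  moreover have "cis x * cis (- x) = 1" by (simp add: cis_mult)
  ultimately show ?thesis by (simp add: algebra_simps power2_eq_square) (metis distrib_left mult.commute)
qed

lemma poisson_kernel_denominator_bound:
  fixes w :: complex
  assumes "norm w < 1"
  shows "(1 - norm w)\<^sup>2 \<le> norm (1 - 2 * of_real (cos x) * w + w\<^sup>2)"
proof -
  have "1 - norm w \<le> norm (1 - w * cis y)" for y
    using norm_triangle_ineq2[of 1 "w * cis y"] by (simp add: norm_mult)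
  then show ?thesis
    unfolding poisson_kernel_denominator norm_mult
    unfolding power2_eq_square
    using assms by (intro mult_mono) auto
qed

lemma poisson_kernel_bound:
  assumes "norm w < 1"
  shows "norm (poisson_kernel w (cos x)) \<le> 2 / (1 - norm w)\<^sup>2"
proof -
  have "norm (1 - w\<^sup>2) \<le> 1 + norm w ^ 2"
    by (metis norm_one norm_power norm_triangle_ineq4)
  also have "\<dots> \<le> 2" using assms by (simp add: power_le_one)
  finally show ?thesis
    unfolding poisson_kernel_def norm_divide
    using poisson_kernel_denominator_bound[OF assms, of x] assms
    by (intro frac_le) auto
qed

lemma continuous_poisson_kernel:
  assumes "norm w < 1"
  shows "continuous_on UNIV (\<lambda>t. poisson_kernel w (cos (2 * pi * t)))"
proof -
  have "1 - 2 * of_real (cos x) * w + w\<^sup>2 \<noteq> 0" for x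
  proof
    assume "1 - 2 * of_real (cos x) * w + w\<^sup>2 = 0"
    with poisson_kernel_denominator_bound[OF assms, of x] have "(1 - norm w)\<^sup>2 \<le> 0" by simp
    with assms show False by simp
  qed
  then show ?thesis unfolding poisson_kernel_def by (intro continuous_intros) auto
qed

section \<open>Herglotz representation of symmetric functions on the disc\<close>

text \<open>Cauchy's formula is added to an integral that vanishes, because the integrand has at
  most a pole at 1 / w, outside the closed unit disc. The two kernels sum to the averaged Herglotz
  kernel. Using 1 / w instead of the conjugate reflected point keeps the kernel holomorphic in
  \<open>w\<close>.\<close>

lemma poisson_formula_disc:
  assumes H: "H holomorphic_on ball 0 R" and R: "R > 1" and w: "norm w < 1"
    and sym: "\<And>w. norm w \<le> 1 \<Longrightarrow> H (cnj w) = cnj (H w)"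
  shows "((\<lambda>t. of_real (Re (H (cis (2 * pi * t)))) * poisson_kernel w (cos (2 * pi * t)))
           has_integral H w) {0..1}"
proof -
  define E where "E t = H (cis (2 * pi * t))" for t
  define K where "K w t = poisson_kernel w (cos (2 * pi * t))" for w t
  have *: "((\<lambda>t. E t * K w t) has_integral H w) {0..1}" if w: "norm w < 1" for w
  proof -
    \<comment> \<open>For nonzero \<open>w\<close> the number \<open>2 / (1 + norm w)\<close> lies
      strictly between 1 and \<open>1 / norm w\<close>, so the disc of radius \<open>e\<close>
      contains the closed unit disc but no zero of \<open>1 - w * z\<close>; the choice also makes
      sense at \<open>w = 0\<close>.\<close>
    define e where "e = min R (2 / (1 + norm w))"
    have wp: "1 + norm w > 0" by (simp add: add_pos_nonneg)
    have e: "e > 1" "e \<le> R" using R w wp by (auto simp: e_def less_divide_eq)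
    have we: "1 - w * z \<noteq> 0" if "norm z < e" for z
    proof
      assume "1 - w * z = 0"
      then have "norm w * norm z = 1" by (metis eq_iff_diff_eq_0 norm_mult norm_one)
      moreover have "norm z < 2 / (1 + norm w)" using that by (simp add: e_def)
      then have "norm z * (1 + norm w) < 2" by (simp add: less_divide_eq add_pos_nonneg)
      ultimately have "norm z < 1" by (simp add: algebra_simps)
      then have "norm w * norm z < 1 * 1" using w by (intro mult_strict_mono') auto
      with \<open>norm w * norm z = 1\<close> show False by simp
    qed
    have "((\<lambda>z. H z / (z - w)) has_contour_integral 2 * of_real pi * \<i> * H w) (circlepath 0 1)"
      using R w by (intro Cauchy_integral_circlepath_simple holomorphic_on_subset[OF H]) auto
    moreover have "((\<lambda>z. H z * (w / (1 - w * z))) has_contour_integral 0) (circlepath 0 1)"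
      using e we by (intro Cauchy_theorem_disc_simple[of _ 0 e] holomorphic_intros holomorphic_on_subset[OF H]) auto
    ultimately have "((\<lambda>z. H z / (z - w) + H z * (w / (1 - w * z))) has_contour_integral
        2 * of_real pi * \<i> * H w + 0) (circlepath 0 1)"
      by (rule has_contour_integral_add)
    then have "((\<lambda>t. (H (circlepath 0 1 t) / (circlepath 0 1 t - w) + H (circlepath 0 1 t) * (w / (1 - w * circlepath 0 1 t)))
        * vector_derivative (circlepath 0 1) (at t within {0..1})) has_integral 2 * of_real pi * \<i> * H w) {0..1}"
      by (simp add: has_contour_integral_def)
    then have "((\<lambda>t. (2 * of_real pi * \<i>) * (E t * K w t)) has_integral (2 * of_real pi * \<i>) * H w) {0..1}"
    proof (rule has_integral_eq[rotated])
      fix t :: real assume t: "t \<in> {0..1}"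
      define z where "z = cis (2 * pi * t)"
      have cp: "circlepath 0 1 t = z"
        by (simp add: circlepath z_def cis_conv_exp mult_ac)
      have vd: "vector_derivative (circlepath 0 1) (at t within {0..1}) = 2 * of_real pi * \<i> * z"
        using t by (simp add: vector_derivative_circlepath01 z_def cis_conv_exp mult_ac)
      have nz: "norm z = 1" by (simp add: z_def)
      have 1: "z - w \<noteq> 0" using nz w by auto
      have 2: "1 - w * z \<noteq> 0" using we[of z] nz e by auto
      have zi: "cis (- (2 * pi * t)) * z = 1" by (simp add: z_def cis_mult)
      have d: "1 - 2 * of_real (cos (2 * pi * t)) * w + w\<^sup>2 = (1 - w * z) * (1 - w * cis (- (2 * pi * t)))"
        unfolding z_def by (rule poisson_kernel_denominator)
      have d': "z * (1 - 2 * of_real (cos (2 * pi * t)) * w + w\<^sup>2) = (1 - w * z) * (z - w)"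
      proof -
        have "z * ((1 - w * z) * (1 - w * cis (- (2 * pi * t)))) = (1 - w * z) * (z - w * (cis (- (2 * pi * t)) * z))"
          by (simp add: algebra_simps)
        then show ?thesis unfolding d zi by simp
      qed
      have "K w t = (z * (1 - w\<^sup>2)) / (z * (1 - 2 * of_real (cos (2 * pi * t)) * w + w\<^sup>2))"
        using nz by (auto simp: K_def poisson_kernel_def)
      also have "\<dots> = (1 / (z - w) + w / (1 - w * z)) * z"
        unfolding d' using 1 2 by (simp add: field_simps power2_eq_square)
      finally have K: "K w t = (1 / (z - w) + w / (1 - w * z)) * z" .
      show "(H (circlepath 0 1 t) / (circlepath 0 1 t - w) + H (circlepath 0 1 t) * (w / (1 - w * circlepath 0 1 t)))
        * vector_derivative (circlepath 0 1) (at t within {0..1}) = (2 * of_real pi * \<i>) * (E t * K w t)"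
        unfolding cp vd K E_def z_def[symmetric] by (simp add: algebra_simps)
    qed
    from has_integral_mult_right[OF this, of "inverse (2 * of_real pi * \<i>)"]
    show ?thesis by (simp add: field_simps)
  qed
  \<comment> \<open>Averaging with the conjugate of the formula at \<open>cnj w\<close> replaces \<open>H\<close> by its real part.\<close>
  have cK: "cnj (K (cnj w) t) = K w t" for t
    by (simp add: K_def poisson_kernel_def)
  have "((cnj \<circ> (\<lambda>t. E t * K (cnj w) t)) has_integral cnj (H (cnj w))) {0..1}"
    using w by (intro has_integral_linear[OF *] bounded_linear_cnj) auto
  then have "((\<lambda>t. cnj (E t) * K w t) has_integral H w) {0..1}"
    using w sym[of w] by (simp add: o_def cK)
  from has_integral_mult_right[OF has_integral_add[OF *[OF w] this], of "1/2"]
  have "((\<lambda>t. 1/2 * (E t * K w t + cnj (E t) * K w t)) has_integral H w) {0..1}"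
    by simp
  moreover have "1/2 * (E t * K w t + cnj (E t) * K w t) = of_real (Re (E t)) * K w t" for t
    using complex_add_cnj[of "E t"] by (simp flip: distrib_right)
  ultimately show ?thesis by (simp add: E_def K_def)
qed

text \<open>The function of \<open>w\<close> given by G (r w) is holomorphic beyond the closed unit
  disc, so its real part on the unit circle, divided by \<open>G 0\<close>, can serve as a density.
  At \<open>w = 0\<close> the kernel is 1, and the Poisson formula there shows that the mass is 1.
  Symmetry makes \<open>G 0\<close> real.\<close>

lemma poisson_density:
  assumes G: "G holomorphic_on ball 0 1" and pos: "\<And>w. norm w < 1 \<Longrightarrow> Re (G w) > 0"
    and sym: "\<And>w. norm w < 1 \<Longrightarrow> G (cnj w) = cnj (G w)" and r: "0 < r" "r < 1"
  obtains \<mu> where "real_distribution \<mu>" "measure \<mu> {0..1} = 1"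
    "\<And>w. norm w < 1 \<Longrightarrow> G (of_real r * w) = G 0 * (LINT t|\<mu>. poisson_kernel w (cos (2 * pi * t)))"
proof -
  define H where "H w = G (of_real r * w)" for w
  have rb: "norm (of_real r * w) < 1" if "norm w \<le> 1" for w :: complex
  proof -
    have "norm (of_real r * w) \<le> r * 1" using r that by (simp add: norm_mult mult_left_le)
    then show ?thesis using r by simp
  qed
  have "(\<lambda>w. of_real r * w) ` ball 0 (1 / r) \<subseteq> (ball 0 1 :: complex set)"
    using r by (auto simp: norm_mult less_divide_eq mult.commute)
  then have H: "H holomorphic_on ball 0 (1 / r)"
    unfolding H_def using holomorphic_on_compose_gen[of "\<lambda>w. of_real r * w" "ball 0 (1/r)" G "ball 0 1"] G
    by (auto simp: o_def intro: holomorphic_intros)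
  have r1: "1 / r > 1" using r by simp
  have symH: "H (cnj w) = cnj (H w)" if "norm w \<le> 1" for w
    using sym[OF rb[OF that]] by (simp add: H_def)
  define g where "g t = Re (H (cis (2 * pi * t)))" for t
  have g0: "g t \<ge> 0" for t using pos[of "of_real r * cis (2 * pi * t)"] r by (simp add: g_def H_def norm_mult)
  have "continuous_on UNIV (\<lambda>t. H (cis (2 * pi * t)))"
    using r1 by (intro continuous_on_compose2[OF holomorphic_on_imp_continuous_on[OF H]] continuous_intros)
      (auto simp: less_divide_eq)
  then have gc: "continuous_on UNIV g" unfolding g_def by (intro continuous_intros)
  have gm [measurable]: "g \<in> borel_measurable borel" by (rule borel_measurable_continuous_onI[OF gc])
  define a where "a = Re (G 0)"
  have G0: "G 0 = of_real a" using sym[of 0] by (simp add: a_def complex_eq_iff)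
  have a: "a > 0" using pos[of 0] by (simp add: a_def)
  define d where "d t = indicator {0..1} t * g t / a" for t
  have d0: "d t \<ge> 0" for t using g0 a by (simp add: d_def)
  have dm [measurable]: "d \<in> borel_measurable borel" unfolding d_def by measurable
  define \<mu> where "\<mu> = density lborel (\<lambda>t. ennreal (d t))"
  have key: "G (of_real r * w) = G 0 * (LINT t|\<mu>. poisson_kernel w (cos (2 * pi * t)))" if w: "norm w < 1" for w
  proof -
    let ?K = "\<lambda>t. poisson_kernel w (cos (2 * pi * t))"
    have Km [measurable]: "?K \<in> borel_measurable borel"
      by (rule borel_measurable_continuous_onI[OF continuous_poisson_kernel[OF w]])
    have c: "continuous_on {0..1} (\<lambda>t. of_real (g t) * ?K t)"
      by (intro continuous_intros continuous_on_subset[OF gc] continuous_on_subset[OF continuous_poisson_kernel[OF w]]) auto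
    have "((\<lambda>t. of_real (g t) * ?K t) has_integral H w) {0..1}"
      using poisson_formula_disc[OF H r1 w] symH unfolding g_def by blast
    then have "integral {0..1} (\<lambda>t. of_real (g t) * ?K t) = H w" by (rule integral_unique)
    moreover have "(LINT t:{0..1}|lborel. of_real (g t) * ?K t) = integral {0..1} (\<lambda>t. of_real (g t) * ?K t)"
      by (intro set_borel_integral_eq_integral borel_integrable_atLeastAtMost' c)
    moreover have "(LINT t|\<mu>. ?K t) = (LINT t|lborel. d t *\<^sub>R ?K t)"
      unfolding \<mu>_def by (subst integral_density) (use d0 in auto)
    moreover have "(LINT t|lborel. d t *\<^sub>R ?K t) = (LINT t:{0..1}|lborel. of_real (g t) * ?K t) / of_real a"
      unfolding set_lebesgue_integral_def
      by (subst integral_divide_zero[symmetric]) (auto simp: d_def scaleR_conv_of_real intro!: Bochner_Integration.integral_cong)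
    ultimately show ?thesis using a by (simp add: G0 H_def)
  qed
  have int_d: "integrable lborel d"
    unfolding d_def using borel_integrable_atLeastAtMost'[OF continuous_on_subset[OF gc subset_UNIV], of 0 1]
    unfolding set_integrable_def by (intro integrable_divide) simp
  have "((\<lambda>t. of_real (g t) * poisson_kernel 0 (cos (2 * pi * t))) has_integral H 0) {0..1}"
    using poisson_formula_disc[OF H r1, of 0] symH unfolding g_def by simp
  then have "((\<lambda>t. complex_of_real (g t)) has_integral of_real a) {0..1}"
    by (simp add: poisson_kernel_def H_def G0)
  from has_integral_linear[OF this bounded_linear_Re]
  have "(g has_integral a) {0..1}" by (simp add: o_def)
  moreover have "(LINT t:{0..1}|lborel. g t) = integral {0..1} g"
    by (intro set_borel_integral_eq_integral borel_integrable_atLeastAtMost' continuous_on_subset[OF gc subset_UNIV])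
  ultimately have "(LINT t:{0..1}|lborel. g t) = a" by (simp add: integral_unique)
  then have "(LINT t|lborel. d t) = 1"
    using a unfolding d_def set_lebesgue_integral_def by simp
  then have nn: "(\<integral>\<^sup>+t. ennreal (d t) \<partial>lborel) = 1"
    using nn_integral_eq_integral[OF int_d] d0 by simp
  then have "emeasure \<mu> (space \<mu>) = 1"
    by (simp add: \<mu>_def emeasure_density)
  then interpret prob_space \<mu> by (rule prob_spaceI)
  have "emeasure \<mu> {0..1} = (\<integral>\<^sup>+t. ennreal (d t) \<partial>lborel)"
    unfolding \<mu>_def by (subst emeasure_density) (auto intro!: nn_integral_cong simp: d_def indicator_def)
  then have "measure \<mu> {0..1} = 1" using nn by (simp add: measure_def)
  moreover have "real_distribution \<mu>"
    by unfold_locales (auto simp: \<mu>_def)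
  ultimately show thesis using that key by blast
qed

text \<open>Boundary values of \<open>G\<close> need not exist, so the densities on smaller circles
  are replaced by a weak limit of their measures. For fixed \<open>w\<close> the kernel is bounded
  and continuous in \<open>t\<close>, hence its integrals converge along the subsequence.\<close>

theorem herglotz_disc_symmetric:
  assumes G: "G holomorphic_on ball 0 1" and pos: "\<And>w. norm w < 1 \<Longrightarrow> Re (G w) > 0"
    and sym: "\<And>w. norm w < 1 \<Longrightarrow> G (cnj w) = cnj (G w)"
  obtains P where "real_distribution P"
    "\<And>w. norm w < 1 \<Longrightarrow> G w = G 0 * (LINT t|P. poisson_kernel w (cos (2 * pi * t)))"
proof -
  define r where "r n = 1 - 1 / (real n + 2)" for n
  have r: "0 < r n" "r n < 1" for n by (auto simp: r_def field_simps)
  have rlim: "r \<longlonglongrightarrow> 1" unfolding r_def by real_asymp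
  have "\<exists>\<mu>. real_distribution \<mu> \<and> measure \<mu> {0..1} = 1 \<and>
      (\<forall>w. norm w < 1 \<longrightarrow> G (of_real (r n) * w) = G 0 * (LINT t|\<mu>. poisson_kernel w (cos (2 * pi * t))))" for n
    using poisson_density[OF G pos sym r[of n]] by metis
  then obtain \<mu> where \<mu>: "\<And>n. real_distribution (\<mu> n)" "\<And>n. measure (\<mu> n) {0..1} = 1"
      "\<And>n w. norm w < 1 \<Longrightarrow> G (of_real (r n) * w) = G 0 * (LINT t|\<mu> n. poisson_kernel w (cos (2 * pi * t)))"
    by metis
  have "tight \<mu>"
    unfolding tight_def
  proof (intro conjI allI impI \<mu>)
    fix e :: real assume "e > 0"
    \<comment> \<open>\<open>tight\<close> asks for half-open intervals; starting at -1 makes one of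
      them contain all of [0, 1].\<close>
    have "1 \<le> measure (\<mu> n) {-1<..1}" for n
    proof -
      interpret real_distribution "\<mu> n" by (rule \<mu>)
      have "{0..1} \<subseteq> {-1<..1::real}" by auto
      then have "measure (\<mu> n) {0..1} \<le> measure (\<mu> n) {-1<..1}"
        by (rule finite_measure_mono) simp
      then show ?thesis using \<mu>(2)[of n] by simp
    qed
    then show "\<exists>a b. a < b \<and> (\<forall>n. 1 - e < measure (\<mu> n) {a<..b})"
      using \<open>e > 0\<close> by (intro exI[of _ "-1"] exI[of _ 1]) (smt (verit))
  qed
  then obtain k P where k: "strict_mono k" and P: "real_distribution P" and wc: "weak_conv_m (\<mu> \<circ> id \<circ> k) P"
    using tight_imp_convergent_subsubsequence[of \<mu> id] by (auto simp: strict_mono_id)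
  have "G w = G 0 * (LINT t|P. poisson_kernel w (cos (2 * pi * t)))" if w: "norm w < 1" for w
  proof -
    have "(\<lambda>n. LINT t|(\<mu> \<circ> id \<circ> k) n. poisson_kernel w (cos (2 * pi * t))) \<longlonglongrightarrow>
        (LINT t|P. poisson_kernel w (cos (2 * pi * t)))"
    proof (rule weak_conv_imp_integral_bdd_continuous_conv[OF _ P wc])
      show "real_distribution ((\<mu> \<circ> id \<circ> k) n)" for n using \<mu>(1) by simp
      show "isCont (\<lambda>t. poisson_kernel w (cos (2 * pi * t))) x" for x
        using continuous_poisson_kernel[OF w] by (simp add: continuous_on_eq_continuous_at)
      show "norm (poisson_kernel w (cos (2 * pi * x))) \<le> 2 / (1 - norm w)\<^sup>2" for x
        by (rule poisson_kernel_bound[OF w])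
    qed
    from tendsto_mult_left[OF this, of "G 0"]
    have "(\<lambda>n. G (of_real (r (k n)) * w)) \<longlonglongrightarrow> G 0 * (LINT t|P. poisson_kernel w (cos (2 * pi * t)))"
      by (simp add: \<mu>(3)[OF w] o_def)
    moreover have "(\<lambda>n. of_real (r (k n)) * w) \<longlonglongrightarrow> of_real 1 * w"
      using LIMSEQ_subseq_LIMSEQ[OF rlim k] by (intro tendsto_intros) (simp add: o_def)
    then have "(\<lambda>n. G (of_real (r (k n)) * w)) \<longlonglongrightarrow> G (of_real 1 * w)"
      using w G by (intro isCont_tendsto_compose[where g=G])
        (auto dest!: holomorphic_on_imp_continuous_on simp: continuous_on_eq_continuous_at)
    ultimately show ?thesis by (simp add: LIMSEQ_unique)
  qed
  then show thesis using that P by blast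
qed

section \<open>Passage from the disc to the half-plane and the half line\<close>

theorem half_plane_stieltjes_representation:
  fixes m :: real
  assumes hol: "\<phi> holomorphic_on {s. Re s > 0}" and pos: "\<And>s. Re s > 0 \<Longrightarrow> Re (\<phi> s) > 0"
    and sym: "\<And>s. Re s > 0 \<Longrightarrow> \<phi> (cnj s) = cnj (\<phi> s)"
    and lim: "((\<lambda>x::real. of_real x * \<phi> (of_real x)) \<longlongrightarrow> of_real m) at_top"
  obtains \<nu> where "finite_measure \<nu>" "sets \<nu> = sets borel_nonneg" "measure \<nu> {0..} = m"
    "\<And>s. Re s > 0 \<Longrightarrow> stieltjes \<nu> (- s\<^sup>2) = \<phi> s / s"
proof -
  define G where "G w = \<phi> ((1 + w) / (1 - w))" for w
  have w1: "w \<noteq> 1" if "norm w < 1" for w :: complex using that by auto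
  have Re_cayley: "Re ((1 + w) / (1 - w)) > 0" if "norm w < 1" for w
  proof -
    have "(Re w)\<^sup>2 + (Im w)\<^sup>2 < 1" using that by (simp add: cmod_def)
    moreover have "(1 - Re w)\<^sup>2 + (Im w)\<^sup>2 > 0"
    proof -
      have "1 - w \<noteq> 0" using w1[OF that] by simp
      then have "cmod (1 - w) ^ 2 > 0" by simp
      then show ?thesis by (simp add: cmod_power2)
    qed
    ultimately show ?thesis
      by (simp add: Re_divide power2_eq_square algebra_simps divide_simps)
  qed
  have cayley_image: "(\<lambda>w. (1 + w) / (1 - w)) ` ball 0 1 \<subseteq> {s. Re s > 0}"
    using Re_cayley by auto
  have "(\<lambda>w::complex. (1 + w) / (1 - w)) holomorphic_on ball 0 1"
    using w1 by (intro holomorphic_intros) auto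
  then have G: "G holomorphic_on ball 0 1"
    unfolding G_def using holomorphic_on_compose_gen[OF _ hol cayley_image] by (simp add: o_def)
  have symG: "G (cnj w) = cnj (G w)" if "norm w < 1" for w
    using sym[OF Re_cayley[OF that]] by (simp add: G_def)
  obtain P where P: "real_distribution P"
    "\<And>w. norm w < 1 \<Longrightarrow> G w = G 0 * (LINT t|P. poisson_kernel w (cos (2 * pi * t)))"
    using herglotz_disc_symmetric[OF G _ symG] pos Re_cayley by (auto simp: G_def)
  interpret real_distribution P by (rule P)
  define a where "a = Re (\<phi> 1)"
  have G0: "G 0 = of_real a" using sym[of 1] by (simp add: a_def G_def complex_eq_iff)
  have a: "a > 0" using pos[of 1] by (simp add: a_def)
  define u where "u t = (1 - cos (2 * pi * t)) / 2" for t :: real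
  have u01: "0 \<le> u t" "u t \<le> 1" for t using cos_le_one[of "2*pi*t"] cos_ge_minus_one[of "2*pi*t"] by (auto simp: u_def)
  have um [measurable]: "u \<in> borel_measurable borel" unfolding u_def by measurable
  have rep: "\<phi> s = of_real a * (LINT t|P. s / (1 - of_real (u t) + of_real (u t) * s\<^sup>2))" if s: "Re s > 0" for s
  proof -
    define w where "w = (s - 1) / (s + 1)"
    have s1: "s + 1 \<noteq> 0" using s by (auto simp: complex_eq_iff)
    have "cmod (s - 1) < cmod (s + 1)"
      using s by (intro power2_less_imp_less[OF _ norm_ge_zero], unfold cmod_power2)
        (simp add: power2_eq_square algebra_simps)
    then have w: "norm w < 1" using s1 by (simp add: w_def norm_divide divide_less_eq)
    have "(1 + w) / (1 - w) = s"
    proof -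
      have "1 + w = 2 * s / (s + 1)" "1 - w = 2 / (s + 1)"
        using s1 by (simp_all add: w_def field_simps)
      then show ?thesis using s1 by simp
    qed
    then have "\<phi> s = G w" by (simp add: G_def)
    also have "\<dots> = of_real a * (LINT t|P. poisson_kernel w (cos (2 * pi * t)))"
      using P(2)[OF w] G0 by simp
    also have "(\<lambda>t. poisson_kernel w (cos (2 * pi * t))) = (\<lambda>t. s / (1 - of_real (u t) + of_real (u t) * s\<^sup>2))"
    proof
      fix t
      define c where "c = complex_of_real (cos (2 * pi * t))"
      have uc: "complex_of_real (u t) = (1 - c) / 2" by (simp add: u_def c_def)
      have n: "(1 - w\<^sup>2) * (s + 1)\<^sup>2 = 4 * s"
      proof -
        have ws: "w * (s + 1) = s - 1" using s1 by (simp add: w_def)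
        have "(1 - w\<^sup>2) * (s + 1)\<^sup>2 = (s + 1)\<^sup>2 - (w * (s + 1))\<^sup>2"
          by (simp add: power2_eq_square algebra_simps)
        also have "\<dots> = 4 * s" unfolding ws by (simp add: power2_eq_square algebra_simps)
        finally show ?thesis .
      qed
      have d: "(1 - 2 * c * w + w\<^sup>2) * (s + 1)\<^sup>2 = 4 * (1 - (1 - c) / 2 + (1 - c) / 2 * s\<^sup>2)"
      proof -
        have ws: "w * (s + 1) = s - 1" using s1 by (simp add: w_def)
        have "(1 - 2 * c * w + w\<^sup>2) * (s + 1)\<^sup>2 = (s + 1)\<^sup>2 - 2 * c * (w * (s + 1)) * (s + 1) + (w * (s + 1))\<^sup>2"
          by (simp add: power2_eq_square algebra_simps)
        also have "\<dots> = 4 * (1 - (1 - c) / 2 + (1 - c) / 2 * s\<^sup>2)"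
          unfolding ws by (simp add: power2_eq_square field_simps)
        finally show ?thesis .
      qed
      have "poisson_kernel w (cos (2 * pi * t)) = ((1 - w\<^sup>2) * (s + 1)\<^sup>2) / ((1 - 2 * c * w + w\<^sup>2) * (s + 1)\<^sup>2)"
        using s1 by (simp add: poisson_kernel_def c_def)
      then show "poisson_kernel w (cos (2 * pi * t)) = s / (1 - of_real (u t) + of_real (u t) * s\<^sup>2)"
        unfolding n d uc mult_divide_mult_cancel_left_if by simp
    qed
    finally show ?thesis .
  qed
  define x where "x n = real n + 1" for n
  have x: "x n > 0" "x n \<ge> 1" for n by (auto simp: x_def)
  have xlim: "filterlim x at_top sequentially" unfolding x_def by real_asymp
  \<comment> \<open>Up to the factor \<open>a\<close> this is the integrand of x \<phi>(x) in
    \<open>rep\<close>. Where u > 0 it equals 1 / ((1 - u) / x^2 + u) and so increases with x to 1 /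
    u; monotone convergence then gives integrability of 1 / u and the value of its integral.\<close>
  define f where "f n t = (x n)\<^sup>2 / (1 - u t + u t * (x n)\<^sup>2)" for n t
  have den: "1 \<le> 1 - u t + u t * y\<^sup>2" if "y \<ge> 1" for t y
  proof -
    have "u t * 1 \<le> u t * y\<^sup>2" using that u01 by (intro mult_left_mono) auto
    then show ?thesis by simp
  qed
  have f0: "f n t \<ge> 0" for n t using den[OF x(2), of t n] by (simp add: f_def)
  have fm [measurable]: "f n \<in> borel_measurable borel" for n unfolding f_def by measurable
  have fint: "integrable P (f n)" for n
  proof (rule integrable_const_bound[of _ "(x n)\<^sup>2"])
    have "norm (f n t) \<le> (x n)\<^sup>2" for t
    proof -
      have D: "1 \<le> 1 - u t + u t * (x n)\<^sup>2" by (rule den[OF x(2)])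
      then have "norm (f n t) = (x n)\<^sup>2 / (1 - u t + u t * (x n)\<^sup>2)" by (simp add: f_def)
      also have "\<dots> \<le> (x n)\<^sup>2 / 1" using D by (intro divide_left_mono) auto
      finally show ?thesis by simp
    qed
    then show "AE t in P. norm (f n t) \<le> (x n)\<^sup>2" by simp
  qed simp
  have fval: "(LINT t|P. f n t) = x n * Re (\<phi> (of_real (x n))) / a" for n
  proof -
    have "\<phi> (of_real (x n)) = of_real a * (LINT t|P. complex_of_real (f n t / x n))"
      unfolding rep[of "of_real (x n)", simplified, OF x(1)]
      using x(1)[of n] by (simp add: f_def power2_eq_square mult.assoc)
    also have "\<dots> = of_real (a * ((LINT t|P. f n t) / x n))"
      by (simp only: integral_complex_of_real integral_divide_zero of_real_mult)
    finally have "Re (\<phi> (of_real (x n))) = a * ((LINT t|P. f n t) / x n)" by simp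
    then show ?thesis using a x(1)[of n] by simp
  qed
  have Ilim: "(\<lambda>n. LINT t|P. f n t) \<longlonglongrightarrow> m / a"
  proof -
    have "(\<lambda>n. Re (of_real (x n) * \<phi> (of_real (x n)))) \<longlonglongrightarrow> Re (of_real m)"
      by (intro tendsto_Re filterlim_compose[OF lim xlim])
    then show ?thesis unfolding fval using a by (intro tendsto_divide tendsto_const) auto
  qed
  have fmono: "f n t \<le> f k t" if "n \<le> k" for n k t
  proof -
    have "(x n)\<^sup>2 \<le> (x k)\<^sup>2" using that by (intro power_mono) (auto simp: x_def)
    then have "(x n)\<^sup>2 * (1 - u t) \<le> (x k)\<^sup>2 * (1 - u t)" using u01[of t] by (intro mult_right_mono) auto
    then have "(x n)\<^sup>2 * (1 - u t + u t * (x k)\<^sup>2) \<le> (x k)\<^sup>2 * (1 - u t + u t * (x n)\<^sup>2)"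
      by (simp add: algebra_simps)
    moreover have "0 < 1 - u t + u t * (x n)\<^sup>2" "0 < 1 - u t + u t * (x k)\<^sup>2"
      using den[OF x(2), of t n] den[OF x(2), of t k] by linarith+
    ultimately show ?thesis by (simp add: f_def divide_simps mult.commute)
  qed
  define Z where "Z = {t. u t = 0}"
  have Zm [measurable]: "Z \<in> sets borel" unfolding Z_def by measurable
  \<comment> \<open>On \<open>Z\<close> the integrand \<open>f n\<close> equals
    \<open>(x n)\<^sup>2\<close>, while the integral of \<open>f n\<close> converges; so
    \<open>Z\<close> is a null set.\<close>
  have "measure P Z \<le> (LINT t|P. f n t) / (x n)\<^sup>2" for n
  proof -
    have "integrable P (\<lambda>t. (x n)\<^sup>2 * indicat_real Z t)"
      by (intro integrable_mult_right integrable_real_indicator) (auto simp: emeasure_eq_measure)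
    then have "(LINT t|P. (x n)\<^sup>2 * indicator Z t) \<le> (LINT t|P. f n t)"
    proof (rule integral_mono[OF _ fint])
      show "(x n)\<^sup>2 * indicator Z t \<le> f n t" for t
        using f0[of n t] by (cases "u t = 0") (auto simp: Z_def f_def)
    qed
    then have "(x n)\<^sup>2 * measure P Z \<le> (LINT t|P. f n t)" by simp
    then show ?thesis using x(1)[of n] by (simp add: pos_le_divide_eq mult.commute)
  qed
  moreover have "(\<lambda>n. (LINT t|P. f n t) / (x n)\<^sup>2) \<longlonglongrightarrow> 0"
    by (rule real_tendsto_divide_at_top[OF Ilim]) (use filterlim_pow_at_top[OF _ xlim, of 2] in simp)
  ultimately have "measure P Z \<le> 0" using LIMSEQ_le_const by blast
  then have "emeasure P Z = 0" by (simp add: emeasure_eq_measure measure_le_0_iff)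
  then have AEu: "AE t in P. u t > 0"
    using u01 by (intro AE_I[of _ _ Z]) (auto simp: Z_def less_le)
  have flim: "(\<lambda>n. f n t) \<longlonglongrightarrow> 1 / u t" if "u t > 0" for t
  proof -
    have "(\<lambda>n. f n t) \<longlonglongrightarrow> inverse (u t)"
      unfolding f_def x_def using that by real_asymp
    then show ?thesis by (simp add: inverse_eq_divide)
  qed
  have inv: "integrable P (\<lambda>t. 1 / u t)" "(LINT t|P. 1 / u t) = m / a"
  proof -
    have 1: "AE t in P. mono (\<lambda>n. f n t)" using fmono by (simp add: mono_def)
    have 2: "AE t in P. (\<lambda>n. f n t) \<longlonglongrightarrow> 1 / u t" using AEu by eventually_elim (rule flim)
    have 3: "(\<lambda>t. 1 / u t) \<in> borel_measurable P" by simp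
    show "integrable P (\<lambda>t. 1 / u t)" "(LINT t|P. 1 / u t) = m / a"
      by (rule integrable_monotone_convergence integral_monotone_convergence, (rule fint 1 2 Ilim 3)+)+
  qed
  \<comment> \<open>This inverts u = 1 / (1 + t). Where \<open>u\<close> vanishes, division by zero
    makes \<open>h\<close> equal to 0, so \<open>h\<close> maps everything into the half line; that
    set is null and does not affect the integrals.\<close>
  define h where "h t = (1 - u t) / u t" for t
  have h0: "h t \<ge> 0" for t using u01[of t] by (simp add: h_def)
  have hb [measurable]: "h \<in> borel_measurable borel" unfolding h_def by measurable
  have hm: "h \<in> measurable borel borel_nonneg"
    using h0 by (intro measurable_restrict_space2) auto
  \<comment> \<open>The factor 1 / u is what remains when the kernel is rewritten in terms of
    \<open>h\<close>, and \<open>a\<close> restores the normalisation of \<open>\<phi>\<close>; the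
    total mass becomes a (m / a) = m.\<close>
  define Q where "Q = density P (\<lambda>t. ennreal (a / u t))"
  have hQ: "h \<in> measurable Q borel_nonneg"
    using hm by (metis M_is_borel Q_def measurable_cong_sets sets_density)
  define \<nu> where "\<nu> = distr Q borel_nonneg h"
  have s: "sets \<nu> = sets borel_nonneg" by (simp add: \<nu>_def)
  have "emeasure \<nu> (space \<nu>) = emeasure Q (space Q)"
  proof -
    have "emeasure \<nu> (space \<nu>) = emeasure Q (h -` space borel_nonneg \<inter> space Q)"
      unfolding \<nu>_def space_distr by (rule emeasure_distr[OF hQ sets.top])
    also have "h -` space borel_nonneg \<inter> space Q = space Q"
      using h0 by (auto simp: space_restrict_space)
    finally show ?thesis .
  qed
  also have "\<dots> = (\<integral>\<^sup>+t. ennreal (a / u t) \<partial>P)"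
    unfolding Q_def by (subst emeasure_density) auto
  also have "\<dots> = ennreal (LINT t|P. a / u t)"
  proof (rule nn_integral_eq_integral)
    show "integrable P (\<lambda>t. a / u t)" using integrable_mult_right[OF inv(1), of a] by simp
  qed (use u01 a in auto)
  also have "(LINT t|P. a / u t) = a * (LINT t|P. 1 / u t)" by (subst integral_mult_right_zero[symmetric]) simp
  also have "\<dots> = m" using inv(2) a by simp
  finally have mass: "emeasure \<nu> (space \<nu>) = ennreal m" .
  have m0: "m \<ge> 0"
  proof -
    have "(LINT t|P. 1 / u t) \<ge> 0" using u01 by (intro integral_nonneg_AE AE_I2) auto
    then show ?thesis using inv(2) a by (simp add: zero_le_divide_iff)
  qed
  have sp: "space \<nu> = {0..}" by (simp add: \<nu>_def space_restrict_space)
  have "stieltjes \<nu> (- s\<^sup>2) = \<phi> s / s" if s: "Re s > 0" for s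
  proof -
    have s0: "s \<noteq> 0" using s by auto
    have m1: "(\<lambda>t. 1 / (complex_of_real t - - s\<^sup>2)) \<in> borel_measurable borel_nonneg"
      by (rule measurable_restrict_space1) measurable
    have "stieltjes \<nu> (- s\<^sup>2) = (LINT t|Q. 1 / (complex_of_real (h t) - - s\<^sup>2))"
      unfolding stieltjes_def \<nu>_def by (rule integral_distr[OF hQ m1])
    also have "\<dots> = (LINT t|P. (a / u t) *\<^sub>R (1 / (complex_of_real (h t) - - s\<^sup>2)))"
      unfolding Q_def using u01 a
      by (intro integral_density AE_I2 borel_measurable_divide) auto
    also have "\<dots> = (LINT t|P. of_real a * (1 / (1 - of_real (u t) + of_real (u t) * s\<^sup>2)))"
    proof (rule integral_cong_AE)
      show "AE t in P. (a / u t) *\<^sub>R (1 / (complex_of_real (h t) - - s\<^sup>2)) =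
          of_real a * (1 / (1 - of_real (u t) + of_real (u t) * s\<^sup>2))"
        using AEu
      proof eventually_elim
        case (elim t)
        have "complex_of_real (h t) - - s\<^sup>2 = (1 - of_real (u t) + of_real (u t) * s\<^sup>2) / of_real (u t)"
          using elim by (simp add: h_def add_divide_distrib)
        then show ?case using elim by (simp add: scaleR_conv_of_real)
      qed
    qed auto
    also have "\<dots> = of_real a * (LINT t|P. s / (1 - of_real (u t) + of_real (u t) * s\<^sup>2)) / s"
    proof -
      have "(LINT t|P. s / (1 - of_real (u t) + of_real (u t) * s\<^sup>2)) =
          s * (LINT t|P. 1 / (1 - of_real (u t) + of_real (u t) * s\<^sup>2))"
        by (subst integral_mult_right_zero[symmetric]) simp
      then show ?thesis using s0 by (subst integral_mult_right_zero) simp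
    qed
    finally show ?thesis using rep[OF s] by simp
  qed
  moreover have "finite_measure \<nu>" using mass by (intro finite_measureI) simp
  moreover have "measure \<nu> {0..} = m" using mass m0 sp by (simp add: measure_def)
  ultimately show thesis using that s by blast
qed

section \<open>Accretive resolvents\<close>

lemma norm_axis_complex [simp]: "norm (axis j (1 :: complex) :: complex^'m) = 1"
  by (simp add: norm_eq_sqrt_inner inner_axis_axis)

lemma matrix_inv_inverse:
  assumes "invertible M"
  shows "M ** matrix_inv M = mat 1" "matrix_inv M ** M = mat 1"
  using someI_ex[OF assms[unfolded invertible_def]] unfolding matrix_inv_def by auto

lemma matrix_inv_eqI:
  fixes M :: "'a::field^'m^'m"
  assumes "M ** B = mat 1"
  shows "matrix_inv M = B" "invertible M"
proof -
  have B: "B ** M = mat 1" using assms by (simp add: matrix_left_right_inverse)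
  then show inv: "invertible M" using assms unfolding invertible_def by blast
  have "matrix_inv M = (B ** M) ** matrix_inv M" by (simp add: B)
  also have "\<dots> = B" by (simp add: matrix_inv_inverse[OF inv] flip: matrix_mul_assoc)
  finally show "matrix_inv M = B" .
qed

lemma inner_complex_cnj: "x \<bullet> y = Re (cnj x * y)"
  by (simp add: inner_complex_def)

lemma norm_vec_le_sum: "norm (v :: complex^'m) \<le> (\<Sum>i\<in>UNIV. norm (v $ i))"
  unfolding norm_vec_def by (rule L2_set_le_sum) simp

lemma matrix_vector_axis_nth: "(M *v axis j 1) $ i = (M :: complex^'m^'k) $ i $ j"
  by (simp add: matrix_vector_mult_def axis_def if_distrib cong: if_cong)

section \<open>The accretive matrix and its inverse\<close>

definition dyson_matrix :: "real^'n^'N \<Rightarrow> complex \<Rightarrow> complex^'N \<Rightarrow> complex^'n \<Rightarrow> complex^'N^'N" where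
  "dyson_matrix A s d e =
     diag_matrix (\<lambda>i. s + d $ i) + cmat A ** diag_matrix (\<lambda>j. 1 / (s + e $ j)) ** transpose (cmat A)"

definition dyson_resolvent :: "real^'n^'N \<Rightarrow> complex \<Rightarrow> complex^'N \<Rightarrow> complex^'n \<Rightarrow> complex^'N^'N" where
  "dyson_resolvent A s d e = matrix_inv (dyson_matrix A s d e)"

definition nonneg_re :: "complex^'m \<Rightarrow> bool" where
  "nonneg_re d \<longleftrightarrow> (\<forall>i. 0 \<le> Re (d $ i))"

lemma matrix_mult_diag_transpose_nth:
  "(B ** diag_matrix h ** transpose B) $ i $ k = (\<Sum>j\<in>UNIV. B $ i $ j * h j * (B $ k $ j :: complex))"
proof -
  have "(B ** diag_matrix h) $ i $ j = B $ i $ j * h j" for j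
    by (simp add: matrix_matrix_mult_def diag_matrix_def if_distrib cong: if_cong)
  then show ?thesis
    by (simp add: matrix_matrix_mult_def[of "B ** diag_matrix h"] transpose_def)
qed

lemma dyson_matrix_nth:
  "dyson_matrix A s d e $ i $ k = (if i = k then s + d $ i else 0) +
     (\<Sum>j\<in>UNIV. of_real (A $ i $ j) * (1 / (s + e $ j)) * of_real (A $ k $ j))"
  unfolding dyson_matrix_def vector_add_component matrix_mult_diag_transpose_nth
  by (simp add: diag_matrix_def)

lemma dyson_matrix_mult_nth:
  "(dyson_matrix A s d e *v v) $ i = (s + d $ i) * v $ i +
     (\<Sum>j\<in>UNIV. of_real (A $ i $ j) * (1 / (s + e $ j)) * (\<Sum>k\<in>UNIV. of_real (A $ k $ j) * v $ k))"
proof -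
  have "(dyson_matrix A s d e *v v) $ i = (\<Sum>k\<in>UNIV. (if i = k then s + d $ i else 0) * v $ k) +
     (\<Sum>k\<in>UNIV. (\<Sum>j\<in>UNIV. of_real (A $ i $ j) * (1 / (s + e $ j)) * of_real (A $ k $ j)) * v $ k)"
    by (simp only: matrix_vector_mult_def dyson_matrix_nth vec_lambda_beta distrib_right sum.distrib)
  also have "(\<Sum>k\<in>UNIV. (if i = k then s + d $ i else 0) * v $ k) = (s + d $ i) * v $ i"
    by (simp add: if_distrib[of "\<lambda>x. x * _"] cong: if_cong)
  also have "(\<Sum>k\<in>UNIV. (\<Sum>j\<in>UNIV. of_real (A $ i $ j) * (1 / (s + e $ j)) * of_real (A $ k $ j)) * v $ k) =
     (\<Sum>j\<in>UNIV. of_real (A $ i $ j) * (1 / (s + e $ j)) * (\<Sum>k\<in>UNIV. of_real (A $ k $ j) * v $ k))"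
    unfolding sum_distrib_right sum_distrib_left by (subst sum.swap) (simp add: mult.assoc)
  finally show ?thesis .
qed

lemma Re_inverse_nonneg: "0 \<le> Re z \<Longrightarrow> 0 \<le> Re (1 / z)"
  by (simp add: Re_divide)

text \<open>Since \<open>A\<close> is real, its summand contributes the squared moduli of the
  coordinates of A^T v with the weights Re (1 / (s + e_j)), which are nonnegative. The diagonal
  contributes at least \<open>Re s\<close> in each coordinate.\<close>

lemma dyson_matrix_accretive:
  assumes s: "Re s > 0" and d: "nonneg_re d" and e: "nonneg_re e"
  shows "Re s * (norm v)\<^sup>2 \<le> v \<bullet> (dyson_matrix A s d e *v v)"
proof -
  define g where "g j = (\<Sum>k\<in>UNIV. of_real (A $ k $ j) * v $ k)" for j
  have cg: "cnj (g j) = (\<Sum>k\<in>UNIV. of_real (A $ k $ j) * cnj (v $ k))" for j by (simp add: g_def)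
  have "v \<bullet> (dyson_matrix A s d e *v v) =
      (\<Sum>i\<in>UNIV. Re (cnj (v $ i) * ((s + d $ i) * v $ i + (\<Sum>j\<in>UNIV. of_real (A $ i $ j) * (1 / (s + e $ j)) * g j))))"
    unfolding inner_vec_def inner_complex_cnj dyson_matrix_mult_nth g_def ..
  also have "\<dots> = (\<Sum>i\<in>UNIV. Re (cnj (v $ i) * ((s + d $ i) * v $ i))) +
      Re (\<Sum>i\<in>UNIV. \<Sum>j\<in>UNIV. cnj (v $ i) * (of_real (A $ i $ j) * (1 / (s + e $ j)) * g j))"
    by (simp only: distrib_left sum.distrib sum_distrib_left plus_complex.sel Re_sum)
  also have "(\<Sum>i\<in>UNIV. \<Sum>j\<in>UNIV. cnj (v $ i) * (of_real (A $ i $ j) * (1 / (s + e $ j)) * g j)) =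
      (\<Sum>j\<in>UNIV. (1 / (s + e $ j)) * (g j * cnj (g j)))"
    unfolding cg sum_distrib_left by (subst sum.swap) (simp add: mult_ac)
  finally have eq: "v \<bullet> (dyson_matrix A s d e *v v) = (\<Sum>i\<in>UNIV. Re (cnj (v $ i) * ((s + d $ i) * v $ i))) +
      (\<Sum>j\<in>UNIV. Re ((1 / (s + e $ j)) * (g j * cnj (g j))))" by (simp only: Re_sum)
  have 1: "Re s * (norm (v $ i))\<^sup>2 \<le> Re (cnj (v $ i) * ((s + d $ i) * v $ i))" for i
  proof -
    have "cnj (v $ i) * ((s + d $ i) * v $ i) = (s + d $ i) * of_real ((norm (v $ i))\<^sup>2)"
      unfolding complex_norm_square by (simp add: mult_ac)
    from arg_cong[OF this, of Re]
    have "Re (cnj (v $ i) * ((s + d $ i) * v $ i)) = (Re s + Re (d $ i)) * (norm (v $ i))\<^sup>2"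
      by (simp only: times_complex.sel plus_complex.sel Re_complex_of_real Im_complex_of_real mult_zero_right diff_zero)
    then show ?thesis using d by (simp add: nonneg_re_def mult_right_mono)
  qed
  have 2: "0 \<le> Re ((1 / (s + e $ j)) * (g j * cnj (g j)))" for j
  proof -
    have "Re ((1 / (s + e $ j)) * (g j * cnj (g j))) = Re (1 / (s + e $ j)) * (norm (g j))\<^sup>2"
      unfolding complex_norm_square[symmetric]
      by (simp only: times_complex.sel Re_complex_of_real Im_complex_of_real mult_zero_right diff_zero)
    moreover have "0 \<le> Re (1 / (s + e $ j))"
      using s e by (intro Re_inverse_nonneg) (simp add: nonneg_re_def)
    ultimately show ?thesis by simp
  qed
  have "Re s * (norm v)\<^sup>2 = (\<Sum>i\<in>UNIV. Re s * (norm (v $ i))\<^sup>2)"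
    by (simp add: norm_vec_def L2_set_def sum_nonneg sum_distrib_left)
  also have "\<dots> \<le> (\<Sum>i\<in>UNIV. Re (cnj (v $ i) * ((s + d $ i) * v $ i)))" by (intro sum_mono 1)
  finally show ?thesis
    unfolding eq using sum_nonneg[of UNIV "\<lambda>j. Re ((1 / (s + e $ j)) * (g j * cnj (g j)))", OF 2] by linarith
qed

lemma dyson_matrix_invertible:
  assumes "Re s > 0" "nonneg_re d" "nonneg_re e"
  shows "invertible (dyson_matrix A s d e)"
proof -
  have "v = 0" if "dyson_matrix A s d e *v v = 0" for v
    using dyson_matrix_accretive[OF assms, of v A] that assms(1) by (simp add: mult_le_0_iff)
  then show ?thesis
    unfolding invertible_left_inverse matrix_left_invertible_ker by blast
qed

lemma dyson_resolvent_inverse: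
  assumes "Re s > 0" "nonneg_re d" "nonneg_re e"
  shows "dyson_matrix A s d e *v (dyson_resolvent A s d e *v v) = v"
    "dyson_resolvent A s d e *v (dyson_matrix A s d e *v v) = v"
  unfolding matrix_vector_mul_assoc dyson_resolvent_def
  by (simp_all add: matrix_inv_inverse[OF dyson_matrix_invertible[OF assms]])

text \<open>With w = R v, accretivity and Cauchy-Schwarz give Re s |w|^2 \<le> |w| |v|.\<close>

lemma dyson_resolvent_norm:
  assumes "Re s > 0" "nonneg_re d" "nonneg_re e"
  shows "norm (dyson_resolvent A s d e *v v) \<le> norm v / Re s"
proof -
  define w where "w = dyson_resolvent A s d e *v v"
  have "Re s * (norm w)\<^sup>2 \<le> w \<bullet> v"
    using dyson_matrix_accretive[OF assms, of w A] dyson_resolvent_inverse(1)[OF assms, of A v] by (simp add: w_def)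
  also have "\<dots> \<le> norm w * norm v" by (rule norm_cauchy_schwarz)
  finally have "norm w * (Re s * norm w) \<le> norm w * norm v" by (simp add: power2_eq_square mult_ac)
  then have "Re s * norm w \<le> norm v"
    by (cases "norm w = 0") (simp_all add: mult_le_cancel_left)
  then show ?thesis using assms(1) by (simp add: w_def field_simps)
qed

lemma dyson_resolvent_entry_norm:
  assumes "Re s > 0" "nonneg_re d" "nonneg_re e"
  shows "norm (dyson_resolvent A s d e $ i $ j) \<le> 1 / Re s"
  using Finite_Cartesian_Product.norm_nth_le[of "dyson_resolvent A s d e *v axis j 1" i]
    dyson_resolvent_norm[OF assms, of A "axis j 1"]
  by (simp add: matrix_vector_axis_nth norm_axis_complex)

text \<open>The inverse of an accretive matrix is accretive: with w = R v, the form of the inverse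
  at v is the form of the original matrix at w. All positivity of real parts, for the fixed-point
  map and for the spectral measures, comes from here.\<close>

lemma dyson_resolvent_pos:
  assumes "Re s > 0" "nonneg_re d" "nonneg_re e" "v \<noteq> 0"
  shows "0 < v \<bullet> (dyson_resolvent A s d e *v v)"
proof -
  define w where "w = dyson_resolvent A s d e *v v"
  have v: "dyson_matrix A s d e *v w = v"
    using dyson_resolvent_inverse(1)[OF assms(1-3)] by (simp add: w_def)
  then have "w \<noteq> 0" using assms(4) by auto
  then have "0 < Re s * (norm w)\<^sup>2" using assms(1) by simp
  also have "\<dots> \<le> w \<bullet> v" using dyson_matrix_accretive[OF assms(1-3), of w A] v by simp
  finally show ?thesis by (simp add: w_def inner_commute)
qed

lemma dyson_resolvent_diag_pos:
  assumes "Re s > 0" "nonneg_re d" "nonneg_re e"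
  shows "0 < Re (dyson_resolvent A s d e $ i $ i)"
proof -
  have "axis i 1 \<bullet> (dyson_resolvent A s d e *v axis i 1) = Re (dyson_resolvent A s d e $ i $ i)"
    by (simp add: inner_axis' matrix_vector_axis_nth inner_complex_cnj)
  moreover have "axis i (1::complex) \<noteq> 0" by (simp add: axis_eq_0_iff)
  ultimately show ?thesis using dyson_resolvent_pos[OF assms, of "axis i 1" A] by simp
qed

text \<open>The matrix is symmetric, though in general not Hermitian, because \<open>A\<close> is
  real and only a diagonal matrix stands between \<open>A\<close> and its transpose; the inverse
  inherits this. Polarization with real vectors depends on it.\<close>

lemma dyson_resolvent_symmetric:
  assumes "Re s > 0" "nonneg_re d" "nonneg_re e"
  shows "dyson_resolvent A s d e $ i $ j = dyson_resolvent A s d e $ j $ i"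
proof -
  have sym: "transpose (dyson_matrix A s d e) = dyson_matrix A s d e"
    by (auto simp: vec_eq_iff transpose_def dyson_matrix_nth mult_ac)
  have "dyson_matrix A s d e ** transpose (dyson_resolvent A s d e) =
      transpose (dyson_resolvent A s d e ** dyson_matrix A s d e)"
    by (simp only: matrix_transpose_mul sym)
  also have "\<dots> = mat 1"
    by (simp only: dyson_resolvent_def matrix_inv_inverse[OF dyson_matrix_invertible[OF assms]] transpose_mat)
  finally have "dyson_resolvent A s d e = transpose (dyson_resolvent A s d e)"
    unfolding dyson_resolvent_def by (rule matrix_inv_eqI(1))
  then have "dyson_resolvent A s d e $ i $ j = transpose (dyson_resolvent A s d e) $ i $ j" by simp
  then show ?thesis unfolding transpose_def by simp
qed

text \<open>Entrywise conjugation respects products of matrices and so commutes with the inverse.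
  This supplies the reflection symmetry required by the representation theorem.\<close>

lemma dyson_resolvent_cnj:
  assumes "Re s > 0" "nonneg_re d" "nonneg_re e"
  shows "dyson_resolvent A (cnj s) (\<chi> i. cnj (d $ i)) (\<chi> i. cnj (e $ i)) $ i $ j = cnj (dyson_resolvent A s d e $ i $ j)"
proof -
  have m: "dyson_matrix A (cnj s) (\<chi> i. cnj (d $ i)) (\<chi> i. cnj (e $ i)) = map_matrix cnj (dyson_matrix A s d e)"
    by (auto simp: vec_eq_iff dyson_matrix_nth)
  have "map_matrix cnj (dyson_matrix A s d e) ** map_matrix cnj (dyson_resolvent A s d e) =
      map_matrix cnj (dyson_matrix A s d e ** dyson_resolvent A s d e)"
    by (simp add: vec_eq_iff matrix_matrix_mult_def)
  also have "\<dots> = mat 1"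
    by (simp add: dyson_resolvent_def matrix_inv_inverse[OF dyson_matrix_invertible[OF assms]])
      (simp add: vec_eq_iff mat_def)
  finally have "dyson_resolvent A (cnj s) (\<chi> i. cnj (d $ i)) (\<chi> i. cnj (e $ i)) = map_matrix cnj (dyson_resolvent A s d e)"
    unfolding dyson_resolvent_def[of A "cnj s"] m by (rule matrix_inv_eqI)
  then show ?thesis by simp
qed

lemma holomorphic_on_det:
  fixes M :: "complex \<Rightarrow> complex^'m^'m"
  assumes "\<And>i j. (\<lambda>z. M z $ i $ j) holomorphic_on S"
  shows "(\<lambda>z. det (M z)) holomorphic_on S"
  unfolding det_def by (intro holomorphic_intros assms)

text \<open>By Cramer's rule each entry is a quotient of determinants of matrices with holomorphic
  entries, and accretivity keeps the denominator from vanishing.\<close>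

lemma dyson_resolvent_holomorphic:
  assumes d: "\<And>i. (\<lambda>s. d s $ i) holomorphic_on {s. Re s > 0}" "\<And>s. Re s > 0 \<Longrightarrow> nonneg_re (d s)"
    and e: "\<And>i. (\<lambda>s. e s $ i) holomorphic_on {s. Re s > 0}" "\<And>s. Re s > 0 \<Longrightarrow> nonneg_re (e s)"
  shows "(\<lambda>s. dyson_resolvent A s (d s) (e s) $ i $ j) holomorphic_on {s. Re s > 0}"
proof -
  define M where "M s = dyson_matrix A s (d s) (e s)" for s
  have nz: "s + e s $ k \<noteq> 0" if "Re s > 0" for s k
    using e(2)[OF that] that unfolding nonneg_re_def
    by (metis add_pos_nonneg less_irrefl plus_complex.sel(1) zero_complex.sel(1))
  have M: "(\<lambda>s. M s $ a $ b) holomorphic_on {s. Re s > 0}" for a b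
  proof (cases "a = b")
    case True
    then show ?thesis unfolding M_def dyson_matrix_nth using nz by (auto intro!: holomorphic_intros d e)
  next
    case False
    then show ?thesis unfolding M_def dyson_matrix_nth using nz by (auto intro!: holomorphic_intros d e)
  qed
  have det0: "det (M s) \<noteq> 0" if "Re s > 0" for s
    using dyson_matrix_invertible[OF that d(2)[OF that] e(2)[OF that]] by (simp add: M_def invertible_det_nz)
  have "dyson_resolvent A s (d s) (e s) $ i $ j =
      det (\<chi> a b. if b = i then axis j 1 $ a else M s $ a $ b) / det (M s)" if "Re s > 0" for s
  proof -
    have "M s *v (dyson_resolvent A s (d s) (e s) *v axis j 1) = axis j 1"
      unfolding M_def by (rule dyson_resolvent_inverse(1)[OF that d(2)[OF that] e(2)[OF that]])
    then have "(dyson_resolvent A s (d s) (e s) *v axis j 1) $ i =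
      det (\<chi> a b. if b = i then axis j 1 $ a else M s $ a $ b) / det (M s)"
      unfolding cramer[OF det0[OF that]] by simp
    then show ?thesis by (simp add: matrix_vector_axis_nth)
  qed
  moreover have "(\<lambda>s. det (\<chi> a b. if b = i then axis j 1 $ a else M s $ a $ b) / det (M s)) holomorphic_on {s. Re s > 0}"
  proof (intro holomorphic_on_divide holomorphic_on_det M)
    show "(\<lambda>s. (\<chi> a b. if b = i then axis j 1 $ a else M s $ a $ b) $ a $ b) holomorphic_on {s. Re s > 0}" for a b
      using M by (cases "b = i") auto
  qed (use det0 in auto)
  ultimately show ?thesis
    by (subst holomorphic_cong[OF refl]) auto
qed

section \<open>Lipschitz and asymptotic estimates for the inverse\<close>

text \<open>A crude entrywise bound for the operators A diag(c) A^T with |c_j| \<le> 1. A finite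
  bound suffices, since contraction is only sought for large \<open>Re s\<close>.\<close>

definition gram_bound :: "real^'n^'N \<Rightarrow> real" where
  "gram_bound A = (\<Sum>i\<in>UNIV. \<Sum>j\<in>UNIV. \<Sum>k\<in>UNIV. \<bar>A $ i $ j\<bar> * \<bar>A $ k $ j\<bar>)"

lemma gram_bound_nonneg: "0 \<le> gram_bound A"
  unfolding gram_bound_def by (intro sum_nonneg) auto

lemma norm_gram_le:
  fixes v :: "complex^'N"
  assumes c: "\<And>j. norm (c j) \<le> b"
  shows "(\<Sum>i\<in>UNIV. norm (\<Sum>j\<in>UNIV. of_real (A $ i $ j) * c j * (\<Sum>k\<in>UNIV. of_real (A $ k $ j) * v $ k)))
     \<le> b * gram_bound A * norm v"
proof -
  have b: "b \<ge> 0" using c norm_ge_zero order_trans by blast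
  have "norm (\<Sum>j\<in>UNIV. of_real (A $ i $ j) * c j * (\<Sum>k\<in>UNIV. of_real (A $ k $ j) * v $ k))
      \<le> (\<Sum>j\<in>UNIV. \<Sum>k\<in>UNIV. b * norm v * (\<bar>A $ i $ j\<bar> * \<bar>A $ k $ j\<bar>))" for i
  proof (rule sum_norm_le)
    fix j
    have "norm (\<Sum>k\<in>UNIV. of_real (A $ k $ j) * v $ k) \<le> (\<Sum>k\<in>UNIV. norm v * \<bar>A $ k $ j\<bar>)"
      by (rule sum_norm_le)
        (simp add: norm_mult mult.commute mult_right_mono Finite_Cartesian_Product.norm_nth_le)
    then have "norm (of_real (A $ i $ j) * c j * (\<Sum>k\<in>UNIV. of_real (A $ k $ j) * v $ k))
        \<le> \<bar>A $ i $ j\<bar> * b * (\<Sum>k\<in>UNIV. norm v * \<bar>A $ k $ j\<bar>)"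
      unfolding norm_mult norm_of_real using c b by (intro mult_mono) auto
    also have "\<dots> = (\<Sum>k\<in>UNIV. b * norm v * (\<bar>A $ i $ j\<bar> * \<bar>A $ k $ j\<bar>))"
      by (simp add: sum_distrib_left mult_ac)
    finally show "norm (of_real (A $ i $ j) * c j * (\<Sum>k\<in>UNIV. of_real (A $ k $ j) * v $ k))
        \<le> (\<Sum>k\<in>UNIV. b * norm v * (\<bar>A $ i $ j\<bar> * \<bar>A $ k $ j\<bar>))" .
  qed
  then have "(\<Sum>i\<in>UNIV. norm (\<Sum>j\<in>UNIV. of_real (A $ i $ j) * c j * (\<Sum>k\<in>UNIV. of_real (A $ k $ j) * v $ k)))
     \<le> (\<Sum>i\<in>UNIV. \<Sum>j\<in>UNIV. \<Sum>k\<in>UNIV. b * norm v * (\<bar>A $ i $ j\<bar> * \<bar>A $ k $ j\<bar>))"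
    by (intro sum_mono)
  also have "\<dots> = b * gram_bound A * norm v"
    unfolding gram_bound_def by (simp add: sum_distrib_left sum_distrib_right mult_ac)
  finally show ?thesis .
qed

definition dist1 :: "complex^'m \<Rightarrow> complex^'m \<Rightarrow> real" where
  "dist1 d d' = (\<Sum>i\<in>UNIV. norm (d $ i - d' $ i))"

lemma dist1_ge: "norm (d $ i - d' $ i) \<le> dist1 d d'"
  unfolding dist1_def by (rule member_le_sum) auto

lemma dist1_nonneg: "0 \<le> dist1 d d'"
  unfolding dist1_def by (intro sum_nonneg) auto

lemma dist1_eq_0: "dist1 d d' = 0 \<longleftrightarrow> d = d'"
  unfolding dist1_def by (subst sum_nonneg_eq_0_iff) (auto simp: vec_eq_iff)

lemma norm_shift_ge:
  assumes "Re s > 0" "nonneg_re e"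
  shows "Re s \<le> norm (s + e $ j)"
proof -
  have "Re s \<le> Re (s + e $ j)" using assms by (simp add: nonneg_re_def)
  also have "\<dots> \<le> norm (s + e $ j)" by (rule complex_Re_le_cmod)
  finally show ?thesis .
qed

text \<open>Two reciprocals 1 / (s + e_j) differ by the difference of the e_j over a product of
  denominators that are each at least \<open>Re s\<close> in modulus. This produces
  \<open>gram_bound A / (Re s)\<^sup>2\<close>, whereas the diagonals differ by d - d'
  directly.\<close>

lemma dyson_matrix_diff:
  assumes s: "Re s > 0" and e: "nonneg_re e" "nonneg_re e'"
  shows "norm (dyson_matrix A s d e *v v - dyson_matrix A s d' e' *v v)
     \<le> (1 + gram_bound A / (Re s)\<^sup>2) * (dist1 d d' + dist1 e e') * norm v"
proof -
  define g where "g j = (\<Sum>k\<in>UNIV. of_real (A $ k $ j) * v $ k)" for j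
  define c where "c j = 1 / (s + e $ j) - 1 / (s + e' $ j)" for j
  have nz: "s + e $ j \<noteq> 0" "s + e' $ j \<noteq> 0" for j
    using norm_shift_ge[OF s e(1), of j] norm_shift_ge[OF s e(2), of j] s by auto
  have c: "norm (c j) \<le> dist1 e e' / (Re s)\<^sup>2" for j
  proof -
    have "c j = (e' $ j - e $ j) / ((s + e $ j) * (s + e' $ j))"
      using nz[of j] by (simp add: c_def field_simps)
    then have "norm (c j) = norm (e $ j - e' $ j) / (norm (s + e $ j) * norm (s + e' $ j))"
      by (simp add: norm_divide norm_mult norm_minus_commute)
    also have "\<dots> \<le> dist1 e e' / (Re s * Re s)"
      using norm_shift_ge[OF s e(1), of j] norm_shift_ge[OF s e(2), of j] s
      by (intro frac_le mult_mono dist1_ge dist1_nonneg) auto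
    finally show ?thesis by (simp add: power2_eq_square)
  qed
  have "(dyson_matrix A s d e *v v - dyson_matrix A s d' e' *v v) $ i =
      (d $ i - d' $ i) * v $ i + (\<Sum>j\<in>UNIV. of_real (A $ i $ j) * c j * g j)" for i
    unfolding vector_minus_component dyson_matrix_mult_nth g_def[symmetric] c_def
    by (simp add: algebra_simps sum_subtractf)
  then have "norm (dyson_matrix A s d e *v v - dyson_matrix A s d' e' *v v) \<le>
      (\<Sum>i\<in>UNIV. norm ((d $ i - d' $ i) * v $ i + (\<Sum>j\<in>UNIV. of_real (A $ i $ j) * c j * g j)))"
    using norm_vec_le_sum[of "dyson_matrix A s d e *v v - dyson_matrix A s d' e' *v v"] by simp
  also have "\<dots> \<le> (\<Sum>i\<in>UNIV. norm (d $ i - d' $ i) * norm v + norm (\<Sum>j\<in>UNIV. of_real (A $ i $ j) * c j * g j))"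
  proof (rule sum_mono)
    fix i
    show "norm ((d $ i - d' $ i) * v $ i + (\<Sum>j\<in>UNIV. of_real (A $ i $ j) * c j * g j))
        \<le> norm (d $ i - d' $ i) * norm v + norm (\<Sum>j\<in>UNIV. of_real (A $ i $ j) * c j * g j)"
      by (rule order_trans[OF norm_triangle_ineq])
        (simp add: norm_mult mult_left_mono Finite_Cartesian_Product.norm_nth_le)
  qed
  also have "\<dots> = dist1 d d' * norm v + (\<Sum>i\<in>UNIV. norm (\<Sum>j\<in>UNIV. of_real (A $ i $ j) * c j * g j))"
    by (simp add: sum.distrib dist1_def sum_distrib_right)
  also have "\<dots> \<le> dist1 d d' * norm v + dist1 e e' / (Re s)\<^sup>2 * gram_bound A * norm v"
    using norm_gram_le[of c, OF c, of A v] by (simp add: g_def)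
  also have "\<dots> \<le> (dist1 d d' + dist1 e e') * norm v + (dist1 d d' + dist1 e e') / (Re s)\<^sup>2 * gram_bound A * norm v"
    using dist1_nonneg[of d d'] dist1_nonneg[of e e'] s gram_bound_nonneg[of A]
    by (intro add_mono mult_right_mono divide_right_mono) auto
  also have "\<dots> = (1 + gram_bound A / (Re s)\<^sup>2) * (dist1 d d' + dist1 e e') * norm v"
    by (simp add: field_simps)
  finally show ?thesis .
qed

text \<open>The identity R - R' = R (M' - M) R' for two inverses: each outer factor contributes
  \<open>1 / Re s\<close>, and this square makes the map a contraction far to the right.\<close>

lemma dyson_resolvent_diff:
  assumes s: "Re s > 0" and d: "nonneg_re d" "nonneg_re d'" and e: "nonneg_re e" "nonneg_re e'"
  shows "norm (dyson_resolvent A s d e $ i $ j - dyson_resolvent A s d' e' $ i $ j)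
     \<le> (1 + gram_bound A / (Re s)\<^sup>2) * (dist1 d d' + dist1 e e') / (Re s)\<^sup>2"
proof -
  define C where "C = (1 + gram_bound A / (Re s)\<^sup>2) * (dist1 d d' + dist1 e e')"
  have C: "C \<ge> 0" unfolding C_def
    by (intro mult_nonneg_nonneg add_nonneg_nonneg divide_nonneg_nonneg gram_bound_nonneg dist1_nonneg) auto
  define w where "w = dyson_resolvent A s d' e' *v axis j 1"
  have w: "norm w \<le> 1 / Re s"
    using dyson_resolvent_norm[OF s d(2) e(2), of A "axis j 1"] by (simp add: w_def norm_axis_complex)
  have "dyson_resolvent A s d e *v axis j 1 - w =
      dyson_resolvent A s d e *v (dyson_matrix A s d' e' *v w - dyson_matrix A s d e *v w)"
    using dyson_resolvent_inverse(2)[OF s d(1) e(1), of A w] dyson_resolvent_inverse(1)[OF s d(2) e(2), of A "axis j 1"]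
    by (simp add: w_def matrix_vector_mult_diff_distrib)
  then have "norm (dyson_resolvent A s d e *v axis j 1 - w) \<le>
      norm (dyson_matrix A s d' e' *v w - dyson_matrix A s d e *v w) / Re s"
    using dyson_resolvent_norm[OF s d(1) e(1)] by metis
  also have "\<dots> \<le> C * norm w / Re s"
    using dyson_matrix_diff[OF s e, of A d w d'] s unfolding C_def
    by (intro divide_right_mono) (simp_all add: norm_minus_commute)
  also have "\<dots> \<le> C * (1 / Re s) / Re s"
    using w C s by (intro divide_right_mono mult_left_mono) auto
  finally have "norm (dyson_resolvent A s d e *v axis j 1 - w) \<le> C / (Re s)\<^sup>2"
    by (simp add: power2_eq_square)
  with Finite_Cartesian_Product.norm_nth_le[of "dyson_resolvent A s d e *v axis j 1 - w" i]
  show ?thesis by (simp add: w_def matrix_vector_axis_nth C_def)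
qed

text \<open>Here s R v - v = R (s - M) v, where M - s stays bounded. So s R tends to the identity
  along the reals as long as d remains bounded, and this later fixes the total mass of the spectral
  measures.\<close>

lemma dyson_resolvent_asymptotic:
  assumes s: "Re s > 0" and d: "nonneg_re d" "nonneg_re e"
  shows "norm (s *s (dyson_resolvent A s d e *v v) - v) \<le> ((dist1 d 0 + gram_bound A / Re s) * norm v) / Re s"
proof -
  define g where "g j = (\<Sum>k\<in>UNIV. of_real (A $ k $ j) * v $ k)" for j
  have R: "s *s (dyson_resolvent A s d e *v v) - v = dyson_resolvent A s d e *v (s *s v - dyson_matrix A s d e *v v)"
    using dyson_resolvent_inverse(2)[OF s d, of A v]
    by (simp add: matrix_vector_mult_diff_distrib vector_scalar_commute)
  have c: "norm (1 / (s + e $ j)) \<le> 1 / Re s" for j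
    using norm_shift_ge[OF s d(2), of j] s by (simp add: norm_divide frac_le)
  have "(dyson_matrix A s d e *v v - s *s v) $ i =
      d $ i * v $ i + (\<Sum>j\<in>UNIV. of_real (A $ i $ j) * (1 / (s + e $ j)) * g j)" for i
    unfolding vector_minus_component dyson_matrix_mult_nth g_def[symmetric] vector_smult_component
    by (simp add: algebra_simps)
  then have "norm (dyson_matrix A s d e *v v - s *s v) \<le>
      (\<Sum>i\<in>UNIV. norm (d $ i * v $ i + (\<Sum>j\<in>UNIV. of_real (A $ i $ j) * (1 / (s + e $ j)) * g j)))"
    using norm_vec_le_sum[of "dyson_matrix A s d e *v v - s *s v"] by simp
  also have "\<dots> \<le> (\<Sum>i\<in>UNIV. norm (d $ i) * norm v + norm (\<Sum>j\<in>UNIV. of_real (A $ i $ j) * (1 / (s + e $ j)) * g j))"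
  proof (rule sum_mono)
    fix i
    show "norm (d $ i * v $ i + (\<Sum>j\<in>UNIV. of_real (A $ i $ j) * (1 / (s + e $ j)) * g j))
        \<le> norm (d $ i) * norm v + norm (\<Sum>j\<in>UNIV. of_real (A $ i $ j) * (1 / (s + e $ j)) * g j)"
      by (rule order_trans[OF norm_triangle_ineq])
        (simp add: norm_mult mult_left_mono Finite_Cartesian_Product.norm_nth_le)
  qed
  also have "\<dots> = dist1 d 0 * norm v + (\<Sum>i\<in>UNIV. norm (\<Sum>j\<in>UNIV. of_real (A $ i $ j) * (1 / (s + e $ j)) * g j))"
    by (simp add: sum.distrib dist1_def sum_distrib_right)
  also have "\<dots> \<le> dist1 d 0 * norm v + 1 / Re s * gram_bound A * norm v"
    using norm_gram_le[of "\<lambda>j. 1 / (s + e $ j)", OF c, of A v] by (simp add: g_def)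
  finally have "norm (s *s v - dyson_matrix A s d e *v v) \<le> (dist1 d 0 + gram_bound A / Re s) * norm v"
    by (simp add: norm_minus_commute algebra_simps)
  then have "norm (s *s v - dyson_matrix A s d e *v v) / Re s \<le> ((dist1 d 0 + gram_bound A / Re s) * norm v) / Re s"
    using s by (intro divide_right_mono) auto
  with dyson_resolvent_norm[OF s d, of A "s *s v - dyson_matrix A s d e *v v"]
  show ?thesis unfolding R by linarith
qed

section \<open>The Dyson equation\<close>

lemma open_right_half_plane: "open {s. Re s > 0}"
  by (rule open_halfspace_Re_gt)

lemma connected_right_half_plane: "connected {s. Re s > 0}"
  by (intro convex_connected convex_halfspace_Re_gt)

text \<open>Subsequences are extracted one index at a time, each from the previous one; finiteness
  of the index set lets a single subsequence serve all coordinates.\<close>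

lemma montel_simultaneous:
  fixes F :: "'i \<Rightarrow> nat \<Rightarrow> complex \<Rightarrow> complex"
  assumes "finite I" and S: "open S"
    and F: "\<And>i n. i \<in> I \<Longrightarrow> F i n holomorphic_on S"
    and bnd: "\<And>i K. i \<in> I \<Longrightarrow> compact K \<Longrightarrow> K \<subseteq> S \<Longrightarrow> \<exists>B. \<forall>n. \<forall>z\<in>K. norm (F i n z) \<le> B"
  shows "\<exists>g r. strict_mono (r :: nat \<Rightarrow> nat) \<and>
     (\<forall>i\<in>I. g i holomorphic_on S \<and> (\<forall>z\<in>S. (\<lambda>n. F i (r n) z) \<longlonglongrightarrow> g i z))"
  using assms(1) F bnd
proof (induction I rule: finite_induct)
  case empty
  show ?case by (intro exI[of _ "\<lambda>_ _. 0"] exI[of _ id]) (auto simp: strict_mono_id)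
next
  case (insert k I)
  have "\<exists>g r. strict_mono (r :: nat \<Rightarrow> nat) \<and>
     (\<forall>i\<in>I. g i holomorphic_on S \<and> (\<forall>z\<in>S. (\<lambda>n. F i (r n) z) \<longlonglongrightarrow> g i z))"
    by (rule insert.IH) (simp_all add: insert.prems)
  then obtain g r where r: "strict_mono (r :: nat \<Rightarrow> nat)"
      "\<And>i. i \<in> I \<Longrightarrow> g i holomorphic_on S" "\<And>i z. i \<in> I \<Longrightarrow> z \<in> S \<Longrightarrow> (\<lambda>n. F i (r n) z) \<longlonglongrightarrow> g i z"
    by blast
  obtain h q where q: "h holomorphic_on S" "strict_mono (q :: nat \<Rightarrow> nat)"
      "\<And>z. z \<in> S \<Longrightarrow> (\<lambda>n. F k (r (q n)) z) \<longlonglongrightarrow> h z"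
  proof (rule Montel[OF S, of "range (\<lambda>n. F k (r n))" "\<lambda>n. F k (r n)"])
    show "f holomorphic_on S" if "f \<in> range (\<lambda>n. F k (r n))" for f
      using that insert.prems(1) by auto
    show "\<exists>B. \<forall>f\<in>range (\<lambda>n. F k (r n)). \<forall>z\<in>K. norm (f z) \<le> B" if K: "compact K" "K \<subseteq> S" for K
      using insert.prems(2)[of k K] K by auto
  qed auto
  define g' where "g' i = (if i = k then h else g i)" for i
  have "g' i holomorphic_on S" if "i \<in> insert k I" for i
    using that q r by (auto simp: g'_def)
  moreover have "(\<lambda>n. F i ((r \<circ> q) n) z) \<longlonglongrightarrow> g' i z" if i: "i \<in> insert k I" and z: "z \<in> S" for i z
  proof (cases "i = k")
    case True
    then show ?thesis using q(3)[OF z] by (simp add: g'_def)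
  next
    case False
    then show ?thesis
      using LIMSEQ_subseq_LIMSEQ[OF r(3)[of i, OF _ z] q(2)] i by (simp add: g'_def o_def)
  qed
  ultimately show ?case
    using strict_mono_o[OF r(1) q(2)] by (intro exI[of _ g'] exI[of _ "r \<circ> q"]) blast
qed

section \<open>The fixed-point map\<close>

text \<open>One half of the fixed-point map. The other half is the same function with
  \<open>A\<close> transposed, other weights and the arguments exchanged, so each estimate is proved
  once and used twice.\<close>

definition dyson_step :: "('n \<Rightarrow> 'N \<Rightarrow> real) \<Rightarrow> real^'n^'N \<Rightarrow> complex \<Rightarrow> complex^'N \<Rightarrow> complex^'n \<Rightarrow> complex^'n" where
  "dyson_step W A s d e = (\<chi> j. \<Sum>i\<in>UNIV. of_real (W j i) * dyson_resolvent A s d e $ i $ i)"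

definition total_weight :: "('n::finite \<Rightarrow> 'N::finite \<Rightarrow> real) \<Rightarrow> real" where
  "total_weight W = (\<Sum>j\<in>UNIV. \<Sum>i\<in>UNIV. W j i)"

definition dyson_solution ::
    "('N \<Rightarrow> 'n \<Rightarrow> real) \<Rightarrow> ('n \<Rightarrow> 'N \<Rightarrow> real) \<Rightarrow> real^'n^'N \<Rightarrow> complex \<Rightarrow> complex^'N \<Rightarrow> complex^'n \<Rightarrow> bool" where
  "dyson_solution V W A s d e \<longleftrightarrow> d = dyson_step V (transpose A) s e d \<and> e = dyson_step W A s d e"

context
  fixes W :: "'n::finite \<Rightarrow> 'N::finite \<Rightarrow> real"
  assumes W: "\<And>j i. 0 \<le> W j i"
begin

lemma total_weight_nonneg: "0 \<le> total_weight W"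
  unfolding total_weight_def by (intro sum_nonneg W)

lemma sum_weight_le: "(\<Sum>i\<in>UNIV. W j i) \<le> total_weight W"
  unfolding total_weight_def by (rule member_le_sum) (auto intro!: sum_nonneg W)

lemma dyson_step_nonneg:
  assumes "Re s > 0" "nonneg_re d" "nonneg_re e"
  shows "nonneg_re (dyson_step W A s d e)"
  unfolding nonneg_re_def dyson_step_def
  by (auto intro!: sum_nonneg mult_nonneg_nonneg W less_imp_le[OF dyson_resolvent_diag_pos[OF assms]])

text \<open>The bound does not depend on \<open>d\<close> and \<open>e\<close>: it controls all
  iterates at once, as Montel's theorem requires, and for a fixed point it gives decay like
  \<open>1 / Re s\<close>.\<close>

lemma dyson_step_norm:
  assumes "Re s > 0" "nonneg_re d" "nonneg_re e"
  shows "norm (dyson_step W A s d e $ j) \<le> total_weight W / Re s"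
proof -
  have "norm (dyson_step W A s d e $ j) \<le> (\<Sum>i\<in>UNIV. W j i * (1 / Re s))"
    unfolding dyson_step_def vec_lambda_beta
  proof (rule sum_norm_le)
    fix i
    show "norm (of_real (W j i) * dyson_resolvent A s d e $ i $ i) \<le> W j i * (1 / Re s)"
      unfolding norm_mult norm_of_real abs_of_nonneg[OF W]
      by (rule mult_left_mono[OF dyson_resolvent_entry_norm[OF assms] W])
  qed
  also have "\<dots> = (\<Sum>i\<in>UNIV. W j i) * (1 / Re s)" by (simp only: sum_distrib_right)
  also have "\<dots> \<le> total_weight W * (1 / Re s)"
    using assms(1) by (intro mult_right_mono sum_weight_le) auto
  finally show ?thesis by simp
qed

lemma dyson_step_diff:
  assumes "Re s > 0" "nonneg_re d" "nonneg_re d'" "nonneg_re e" "nonneg_re e'"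
  shows "dist1 (dyson_step W A s d e) (dyson_step W A s d' e')
     \<le> total_weight W * ((1 + gram_bound A / (Re s)\<^sup>2) * (dist1 d d' + dist1 e e') / (Re s)\<^sup>2)"
    (is "_ \<le> _ * ?C")
proof -
  have "norm (dyson_step W A s d e $ j - dyson_step W A s d' e' $ j) \<le> (\<Sum>i\<in>UNIV. W j i * ?C)" for j
    unfolding dyson_step_def vec_lambda_beta sum_subtractf[symmetric] right_diff_distrib[symmetric]
  proof (rule sum_norm_le)
    fix i
    show "norm (of_real (W j i) * (dyson_resolvent A s d e $ i $ i - dyson_resolvent A s d' e' $ i $ i)) \<le> W j i * ?C"
      unfolding norm_mult norm_of_real abs_of_nonneg[OF W]
      by (rule mult_left_mono[OF dyson_resolvent_diff[OF assms] W])
  qed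
  then have "dist1 (dyson_step W A s d e) (dyson_step W A s d' e') \<le> (\<Sum>j\<in>UNIV. \<Sum>i\<in>UNIV. W j i * ?C)"
    unfolding dist1_def by (intro sum_mono)
  also have "\<dots> = total_weight W * ?C"
    unfolding total_weight_def by (simp only: sum_distrib_right)
  finally show ?thesis .
qed

lemma dyson_step_cnj:
  assumes "Re s > 0" "nonneg_re d" "nonneg_re e"
  shows "dyson_step W A (cnj s) (\<chi> i. cnj (d $ i)) (\<chi> i. cnj (e $ i)) = (\<chi> j. cnj (dyson_step W A s d e $ j))"
  by (simp add: dyson_step_def vec_eq_iff dyson_resolvent_cnj[OF assms])

end

lemma dyson_step_holomorphic:
  assumes "\<And>i. (\<lambda>s. d s $ i) holomorphic_on {s. Re s > 0}" "\<And>s. Re s > 0 \<Longrightarrow> nonneg_re (d s)"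
    "\<And>i. (\<lambda>s. e s $ i) holomorphic_on {s. Re s > 0}" "\<And>s. Re s > 0 \<Longrightarrow> nonneg_re (e s)"
  shows "(\<lambda>s. dyson_step W A s (d s) (e s) $ j) holomorphic_on {s. Re s > 0}"
  unfolding dyson_step_def vec_lambda_beta
  by (intro holomorphic_intros dyson_resolvent_holomorphic assms)

section \<open>Contraction, iteration and a holomorphic fixed point\<close>

context
  fixes A :: "real^'n^'N" and V :: "'N \<Rightarrow> 'n \<Rightarrow> real" and W :: "'n \<Rightarrow> 'N \<Rightarrow> real"
  assumes V: "\<And>i j. 0 \<le> V i j" and W: "\<And>j i. 0 \<le> W j i"
begin

text \<open>For \<open>Re s \<ge> 1\<close> the two halves of the map together have Lipschitz
  constant \<open>dyson_constant / (Re s)\<^sup>2\<close> in the distance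
  \<open>dist1 d d' + dist1 e e'\<close>. The threshold \<open>1 + 2 * dyson_constant\<close> keeps
  \<open>Re s\<close> at least 1 and its square at least twice the constant, so distances are at
  least halved.\<close>

definition dyson_constant :: real where
  "dyson_constant = total_weight W * (1 + gram_bound A) + total_weight V * (1 + gram_bound (transpose A))"

lemma dyson_constant_nonneg: "0 \<le> dyson_constant"
  unfolding dyson_constant_def
  using total_weight_nonneg[of W] total_weight_nonneg[of V] V W
  by (auto intro!: add_nonneg_nonneg mult_nonneg_nonneg gram_bound_nonneg)

lemma dyson_contraction:
  assumes s: "Re s \<ge> 1 + 2 * dyson_constant"
    and d: "nonneg_re d" "nonneg_re d'" and e: "nonneg_re e" "nonneg_re e'"
  shows "dist1 (dyson_step V (transpose A) s e d) (dyson_step V (transpose A) s e' d') +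
      dist1 (dyson_step W A s d e) (dyson_step W A s d' e') \<le> (dist1 d d' + dist1 e e') / 2"
proof -
  define D where "D = dist1 d d' + dist1 e e'"
  have D: "D \<ge> 0" by (simp add: D_def dist1_nonneg)
  have s1: "Re s \<ge> 1" and s0: "Re s > 0" using s dyson_constant_nonneg by linarith+
  have sq: "1 + 2 * dyson_constant \<le> (Re s)\<^sup>2"
    using s s1 self_le_power[of "Re s" 2] by linarith
  have g: "1 + gram_bound B / (Re s)\<^sup>2 \<le> 1 + gram_bound B" for B :: "real^'k^'l"
  proof -
    have "gram_bound B / (Re s)\<^sup>2 \<le> gram_bound B / 1"
      using s1 gram_bound_nonneg[of B] by (intro divide_left_mono) auto
    then show ?thesis by simp
  qed
  have "dist1 (dyson_step W A s d e) (dyson_step W A s d' e')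
     \<le> total_weight W * ((1 + gram_bound A / (Re s)\<^sup>2) * D / (Re s)\<^sup>2)"
    unfolding D_def by (rule dyson_step_diff[OF W s0 d e])
  also have "\<dots> \<le> total_weight W * ((1 + gram_bound A) * D / (Re s)\<^sup>2)"
    using D g by (intro mult_left_mono divide_right_mono mult_right_mono total_weight_nonneg W) auto
  finally have 1: "dist1 (dyson_step W A s d e) (dyson_step W A s d' e')
     \<le> total_weight W * ((1 + gram_bound A) * D / (Re s)\<^sup>2)" .
  have "dist1 (dyson_step V (transpose A) s e d) (dyson_step V (transpose A) s e' d')
     \<le> total_weight V * ((1 + gram_bound (transpose A) / (Re s)\<^sup>2) * D / (Re s)\<^sup>2)"
    unfolding D_def add.commute[of "dist1 d d'"] by (rule dyson_step_diff[OF V s0 e d])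
  also have "\<dots> \<le> total_weight V * ((1 + gram_bound (transpose A)) * D / (Re s)\<^sup>2)"
    using D g by (intro mult_left_mono divide_right_mono mult_right_mono total_weight_nonneg V) auto
  finally have 2: "dist1 (dyson_step V (transpose A) s e d) (dyson_step V (transpose A) s e' d')
     \<le> total_weight V * ((1 + gram_bound (transpose A)) * D / (Re s)\<^sup>2)" .
  have "total_weight V * ((1 + gram_bound (transpose A)) * D / (Re s)\<^sup>2) +
      total_weight W * ((1 + gram_bound A) * D / (Re s)\<^sup>2) = dyson_constant * D / (Re s)\<^sup>2"
    by (simp add: dyson_constant_def algebra_simps add_divide_distrib)
  also have "\<dots> \<le> D / 2"
  proof -
    have "D * (2 * dyson_constant) \<le> D * (Re s)\<^sup>2" using D sq by (intro mult_left_mono) auto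
    then show ?thesis using s0 by (simp add: divide_simps mult_ac)
  qed
  finally show ?thesis using 1 2 unfolding D_def[symmetric] by linarith
qed

lemma dyson_solution_unique:
  assumes "Re s \<ge> 1 + 2 * dyson_constant"
    "nonneg_re d" "nonneg_re d'" "nonneg_re e" "nonneg_re e'"
    "dyson_solution V W A s d e" "dyson_solution V W A s d' e'"
  shows "d = d' \<and> e = e'"
proof -
  have "dist1 d d' + dist1 e e' \<le> (dist1 d d' + dist1 e e') / 2"
    using dyson_contraction[OF assms(1-5)] assms(6,7) unfolding dyson_solution_def by metis
  then have "dist1 d d' = 0 \<and> dist1 e e' = 0" using dist1_nonneg[of d d'] dist1_nonneg[of e e'] by auto
  then show ?thesis by (simp add: dist1_eq_0)
qed

text \<open>Both components are updated at once. The start 0 lies in the invariant region and is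
  fixed by conjugation, and every iterate inherits the corresponding properties.\<close>

primrec dyson_iterate :: "nat \<Rightarrow> complex \<Rightarrow> (complex^'N) \<times> (complex^'n)" where
  "dyson_iterate 0 s = (0, 0)"
| "dyson_iterate (Suc n) s =
     (dyson_step V (transpose A) s (snd (dyson_iterate n s)) (fst (dyson_iterate n s)),
      dyson_step W A s (fst (dyson_iterate n s)) (snd (dyson_iterate n s)))"

lemma dyson_iterate_nonneg:
  assumes "Re s > 0"
  shows "nonneg_re (fst (dyson_iterate n s)) \<and> nonneg_re (snd (dyson_iterate n s))"
proof (induction n)
  case 0
  then show ?case by (simp add: nonneg_re_def)
next
  case (Suc n)
  then show ?case using dyson_step_nonneg[OF W assms] dyson_step_nonneg[OF V assms] by auto
qed

lemma dyson_iterate_norm: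
  assumes "Re s > 0"
  shows "norm (fst (dyson_iterate n s) $ i) \<le> total_weight V / Re s \<and>
      norm (snd (dyson_iterate n s) $ j) \<le> total_weight W / Re s"
proof (cases n)
  case 0
  then show ?thesis using assms total_weight_nonneg[of V] total_weight_nonneg[of W] V W by auto
next
  case (Suc m)
  then show ?thesis
    using dyson_step_norm[OF W assms] dyson_step_norm[OF V assms] dyson_iterate_nonneg[OF assms, of m] by auto
qed

lemma dyson_iterate_cnj:
  assumes "Re s > 0"
  shows "dyson_iterate n (cnj s) =
    ((\<chi> i. cnj (fst (dyson_iterate n s) $ i)), (\<chi> j. cnj (snd (dyson_iterate n s) $ j)))"
proof (induction n)
  case 0
  then show ?case by (simp add: vec_eq_iff)
next
  case (Suc n)
  then show ?case
    using dyson_iterate_nonneg[OF assms, of n] by (simp add: dyson_step_cnj[OF W assms] dyson_step_cnj[OF V assms])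
qed

lemma dyson_iterate_holomorphic:
  "(\<lambda>s. fst (dyson_iterate n s) $ i) holomorphic_on {s. Re s > 0} \<and>
   (\<lambda>s. snd (dyson_iterate n s) $ j) holomorphic_on {s. Re s > 0}"
proof (induction n arbitrary: i j)
  case 0
  then show ?case by simp
next
  case (Suc n)
  then show ?case using dyson_iterate_nonneg by (auto intro!: dyson_step_holomorphic)
qed

lemma dyson_iterate_diff:
  assumes s: "Re s \<ge> 1 + 2 * dyson_constant"
  shows "dist1 (fst (dyson_iterate (Suc n) s)) (fst (dyson_iterate n s)) +
      dist1 (snd (dyson_iterate (Suc n) s)) (snd (dyson_iterate n s)) \<le>
      (dist1 (fst (dyson_iterate (Suc 0) s)) 0 + dist1 (snd (dyson_iterate (Suc 0) s)) 0) * (1 / 2) ^ n"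
proof (induction n)
  case 0
  then show ?case by simp
next
  case (Suc n)
  have s0: "Re s > 0" using s dyson_constant_nonneg by linarith
  have n: "nonneg_re (fst (dyson_iterate m s))" "nonneg_re (snd (dyson_iterate m s))" for m
    using dyson_iterate_nonneg[OF s0] by auto
  have "dist1 (fst (dyson_iterate (Suc (Suc n)) s)) (fst (dyson_iterate (Suc n) s)) +
      dist1 (snd (dyson_iterate (Suc (Suc n)) s)) (snd (dyson_iterate (Suc n) s)) \<le>
      (dist1 (fst (dyson_iterate (Suc n) s)) (fst (dyson_iterate n s)) +
      dist1 (snd (dyson_iterate (Suc n) s)) (snd (dyson_iterate n s))) / 2"
    using dyson_contraction[OF s n(1)[of "Suc n"] n(1)[of n] n(2)[of "Suc n"] n(2)[of n]]
    unfolding dyson_iterate.simps(2)[of "Suc n"] dyson_iterate.simps(2)[of n] fst_conv snd_conv .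
  with Suc.IH show ?case by (simp del: dyson_iterate.simps)
qed

text \<open>Convergence of a subsequence does not by itself make the limit a fixed point. The
  shifted iterates with index \<open>Suc (r n)\<close> converge everywhere to the image of the
  limit; far to the right the contraction brings shifted and unshifted iterates together, so limit
  and image agree there.\<close>

theorem dyson_solution_exists:
  "\<exists>d e. (\<forall>i. (\<lambda>s. d s $ i) holomorphic_on {s. Re s > 0}) \<and> (\<forall>j. (\<lambda>s. e s $ j) holomorphic_on {s. Re s > 0}) \<and>
    (\<forall>s. Re s > 0 \<longrightarrow> nonneg_re (d s) \<and> nonneg_re (e s) \<and>
      d (cnj s) = (\<chi> i. cnj (d s $ i)) \<and> e (cnj s) = (\<chi> j. cnj (e s $ j)) \<and>
      dyson_solution V W A s (d s) (e s))"
proof -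
  let ?H = "{s. Re s > 0}"
  define D E where "D n s = fst (dyson_iterate n s)" and "E n s = snd (dyson_iterate n s)" for n s
  have D: "nonneg_re (D n s)" and E: "nonneg_re (E n s)" if "Re s > 0" for n s
    using dyson_iterate_nonneg[OF that] by (auto simp: D_def E_def)
  have DS: "D (Suc n) s = dyson_step V (transpose A) s (E n s) (D n s)"
    and ES: "E (Suc n) s = dyson_step W A s (D n s) (E n s)" for n s
    by (simp_all add: D_def E_def)
  define b where "b = total_weight V + total_weight W"
  have Db: "norm (D n s $ i) \<le> b / Re s" and Eb: "norm (E n s $ j) \<le> b / Re s" if s: "Re s > 0" for n s i j
  proof -
    have "total_weight V / Re s \<le> b / Re s" "total_weight W / Re s \<le> b / Re s"
      using s total_weight_nonneg[OF V] total_weight_nonneg[OF W] by (auto simp: b_def intro!: divide_right_mono)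
    with dyson_iterate_norm[OF s, of n i j]
    show "norm (D n s $ i) \<le> b / Re s" "norm (E n s $ j) \<le> b / Re s" by (auto simp: D_def E_def)
  qed
  define F where "F k n s = (case k of Inl i \<Rightarrow> D n s $ i | Inr j \<Rightarrow> E n s $ j)" for k n s
  have "\<exists>g r. strict_mono (r :: nat \<Rightarrow> nat) \<and>
     (\<forall>k\<in>UNIV. g k holomorphic_on ?H \<and> (\<forall>s\<in>?H. (\<lambda>n. F k (r n) s) \<longlonglongrightarrow> g k s))"
  proof (rule montel_simultaneous)
    show "F k n holomorphic_on ?H" for k n
      using dyson_iterate_holomorphic by (cases k) (auto simp: F_def[abs_def] D_def E_def)
    fix k and K :: "complex set" assume K: "compact K" "K \<subseteq> ?H"
    show "\<exists>B. \<forall>n. \<forall>z\<in>K. norm (F k n z) \<le> B"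
    proof (cases "K = {}")
      case False
      \<comment> \<open>A nonempty compact set has a point of least real part, where the bound
        \<open>b / Re z\<close> is largest.\<close>
      have "continuous_on K Re" by (intro continuous_intros)
      from continuous_attains_inf[OF K(1) False this]
      obtain z0 where z0: "z0 \<in> K" "\<And>z. z \<in> K \<Longrightarrow> Re z0 \<le> Re z" by blast
      have b0: "b \<ge> 0" unfolding b_def by (intro add_nonneg_nonneg total_weight_nonneg V W)
      have "norm (F k n z) \<le> b / Re z0" if "z \<in> K" for n z
      proof -
        have "Re z > 0" "Re z0 > 0" using that K(2) z0(1) by auto
        have "norm (F k n z) \<le> b / Re z"
          using Db Eb \<open>Re z > 0\<close> by (cases k) (auto simp: F_def)
        also have "\<dots> \<le> b / Re z0"
          using b0 z0(2)[OF that] \<open>Re z0 > 0\<close> \<open>Re z > 0\<close> by (intro divide_left_mono) auto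
        finally show ?thesis .
      qed
      then show ?thesis by blast
    qed auto
  qed (auto intro: open_right_half_plane)
  then obtain g and r :: "nat \<Rightarrow> nat" where r: "strict_mono r" and g: "\<And>k. g k holomorphic_on ?H"
      "\<And>k s. Re s > 0 \<Longrightarrow> (\<lambda>n. F k (r n) s) \<longlonglongrightarrow> g k s"
    by auto
  define d where "d s = (\<chi> i. g (Inl i) s)" for s
  define e where "e s = (\<chi> j. g (Inr j) s)" for s
  have dlim: "(\<lambda>n. D (r n) s $ i) \<longlonglongrightarrow> d s $ i" and elim: "(\<lambda>n. E (r n) s $ j) \<longlonglongrightarrow> e s $ j" if "Re s > 0" for s i j
    using g(2)[OF that, of "Inl i"] g(2)[OF that, of "Inr j"] by (simp_all add: F_def d_def e_def)
  have dh: "(\<lambda>s. d s $ i) holomorphic_on ?H" and eh: "(\<lambda>s. e s $ j) holomorphic_on ?H" for i j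
    using g(1)[of "Inl i"] g(1)[of "Inr j"] by (simp_all add: d_def e_def)
  have dn: "nonneg_re (d s)" and en: "nonneg_re (e s)" if s: "Re s > 0" for s
  proof -
    have "0 \<le> Re (d s $ i)" for i
      by (rule LIMSEQ_le_const[OF tendsto_Re[OF dlim[OF s, of i]]]) (use D[OF s] in \<open>auto simp: nonneg_re_def\<close>)
    moreover have "0 \<le> Re (e s $ j)" for j
      by (rule LIMSEQ_le_const[OF tendsto_Re[OF elim[OF s, of j]]]) (use E[OF s] in \<open>auto simp: nonneg_re_def\<close>)
    ultimately show "nonneg_re (d s)" "nonneg_re (e s)" by (auto simp: nonneg_re_def)
  qed
  have dc: "d (cnj s) = (\<chi> i. cnj (d s $ i))" and ec: "e (cnj s) = (\<chi> j. cnj (e s $ j))" if s: "Re s > 0" for s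
  proof -
    have s': "Re (cnj s) > 0" using s by simp
    have "d (cnj s) $ i = cnj (d s $ i)" for i
    proof (rule LIMSEQ_unique)
      show "(\<lambda>n. D (r n) (cnj s) $ i) \<longlonglongrightarrow> d (cnj s) $ i" by (rule dlim[OF s'])
      show "(\<lambda>n. D (r n) (cnj s) $ i) \<longlonglongrightarrow> cnj (d s $ i)"
        using tendsto_cnj[OF dlim[OF s, of i]] by (simp add: D_def dyson_iterate_cnj[OF s])
    qed
    moreover have "e (cnj s) $ j = cnj (e s $ j)" for j
    proof (rule LIMSEQ_unique)
      show "(\<lambda>n. E (r n) (cnj s) $ j) \<longlonglongrightarrow> e (cnj s) $ j" by (rule elim[OF s'])
      show "(\<lambda>n. E (r n) (cnj s) $ j) \<longlonglongrightarrow> cnj (e s $ j)"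
        using tendsto_cnj[OF elim[OF s, of j]] by (simp add: E_def dyson_iterate_cnj[OF s])
    qed
    ultimately show "d (cnj s) = (\<chi> i. cnj (d s $ i))" "e (cnj s) = (\<chi> j. cnj (e s $ j))"
      by (simp_all add: vec_eq_iff)
  qed
  have dist_lim: "(\<lambda>n. dist1 (D (r n) s) (d s) + dist1 (E (r n) s) (e s)) \<longlonglongrightarrow> 0" if s: "Re s > 0" for s
  proof -
    have "(\<lambda>n. dist1 (D (r n) s) (d s) + dist1 (E (r n) s) (e s)) \<longlonglongrightarrow> dist1 (d s) (d s) + dist1 (e s) (e s)"
      unfolding dist1_def by (intro tendsto_intros dlim elim s)
    then show ?thesis by (simp add: dist1_def)
  qed
  \<comment> \<open>The Lipschitz bound holds at every \<open>s\<close> of the half-plane, so the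
    limit may be taken inside the map even where it is not known to contract.\<close>
  have Elim: "(\<lambda>n. E (Suc (r n)) s $ j) \<longlonglongrightarrow> dyson_step W A s (d s) (e s) $ j" if s: "Re s > 0" for s j
  proof -
    let ?c = "(1 + gram_bound A / (Re s)\<^sup>2)"
    have "(\<lambda>n. E (Suc (r n)) s $ j - dyson_step W A s (d s) (e s) $ j) \<longlonglongrightarrow> 0"
    proof (rule Lim_null_comparison)
      show "\<forall>\<^sub>F n in sequentially. norm (E (Suc (r n)) s $ j - dyson_step W A s (d s) (e s) $ j) \<le>
          total_weight W * (?c * (dist1 (D (r n) s) (d s) + dist1 (E (r n) s) (e s)) / (Re s)\<^sup>2)"
        unfolding ES
        by (intro always_eventually allI order_trans[OF dist1_ge dyson_step_diff[OF W s D[OF s] dn[OF s] E[OF s] en[OF s]]])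
      have "(\<lambda>n. total_weight W * (?c * (dist1 (D (r n) s) (d s) + dist1 (E (r n) s) (e s)) / (Re s)\<^sup>2)) \<longlonglongrightarrow>
          total_weight W * (?c * 0 / (Re s)\<^sup>2)"
        using s by (intro tendsto_intros dist_lim) auto
      then show "(\<lambda>n. total_weight W * (?c * (dist1 (D (r n) s) (d s) + dist1 (E (r n) s) (e s)) / (Re s)\<^sup>2)) \<longlonglongrightarrow> 0"
        by simp
    qed
    then show ?thesis by (rule LIM_zero_cancel)
  qed
  have Dlim: "(\<lambda>n. D (Suc (r n)) s $ i) \<longlonglongrightarrow> dyson_step V (transpose A) s (e s) (d s) $ i" if s: "Re s > 0" for s i
  proof -
    let ?c = "(1 + gram_bound (transpose A) / (Re s)\<^sup>2)"
    have "(\<lambda>n. D (Suc (r n)) s $ i - dyson_step V (transpose A) s (e s) (d s) $ i) \<longlonglongrightarrow> 0"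
    proof (rule Lim_null_comparison)
      show "\<forall>\<^sub>F n in sequentially. norm (D (Suc (r n)) s $ i - dyson_step V (transpose A) s (e s) (d s) $ i) \<le>
          total_weight V * (?c * (dist1 (E (r n) s) (e s) + dist1 (D (r n) s) (d s)) / (Re s)\<^sup>2)"
        unfolding DS
        by (intro always_eventually allI order_trans[OF dist1_ge dyson_step_diff[OF V s E[OF s] en[OF s] D[OF s] dn[OF s]]])
      have "(\<lambda>n. total_weight V * (?c * (dist1 (E (r n) s) (e s) + dist1 (D (r n) s) (d s)) / (Re s)\<^sup>2)) \<longlonglongrightarrow>
          total_weight V * (?c * 0 / (Re s)\<^sup>2)"
        using s dist_lim[OF s] by (intro tendsto_intros) (auto simp: add.commute)
      then show "(\<lambda>n. total_weight V * (?c * (dist1 (E (r n) s) (e s) + dist1 (D (r n) s) (d s)) / (Re s)\<^sup>2)) \<longlonglongrightarrow> 0"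
        by simp
    qed
    then show ?thesis by (rule LIM_zero_cancel)
  qed
  have far: "d s $ i = dyson_step V (transpose A) s (e s) (d s) $ i \<and> e s $ j = dyson_step W A s (d s) (e s) $ j"
    if s: "Re s > 1 + 2 * dyson_constant" for s i j
  proof -
    have s0: "Re s > 0" using s dyson_constant_nonneg by linarith
    define c where "c = dist1 (D (Suc 0) s) 0 + dist1 (E (Suc 0) s) 0"
    have pow: "(\<lambda>n. c * (1 / 2) ^ r n) \<longlonglongrightarrow> 0"
      using LIMSEQ_subseq_LIMSEQ[OF LIMSEQ_power_zero[of "1/2::real"] r]
      by (intro tendsto_mult_right_zero) (simp add: o_def)
    have bd: "dist1 (D (Suc n) s) (D n s) + dist1 (E (Suc n) s) (E n s) \<le> c * (1 / 2) ^ n" for n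
      using dyson_iterate_diff[of s n] s unfolding D_def E_def c_def by simp
    have "(\<lambda>n. D (Suc (r n)) s $ i - D (r n) s $ i) \<longlonglongrightarrow> 0"
    proof (rule Lim_null_comparison[OF _ pow], intro always_eventually allI)
      fix n show "norm (D (Suc (r n)) s $ i - D (r n) s $ i) \<le> c * (1 / 2) ^ r n"
        using bd[of "r n"] dist1_ge[of "D (Suc (r n)) s" i "D (r n) s"] dist1_nonneg[of "E (Suc (r n)) s" "E (r n) s"]
        by linarith
    qed
    moreover have "(\<lambda>n. D (Suc (r n)) s $ i - D (r n) s $ i) \<longlonglongrightarrow> dyson_step V (transpose A) s (e s) (d s) $ i - d s $ i"
      by (intro tendsto_diff Dlim dlim s0)
    ultimately have 1: "dyson_step V (transpose A) s (e s) (d s) $ i - d s $ i = 0" using LIMSEQ_unique by blast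
    have "(\<lambda>n. E (Suc (r n)) s $ j - E (r n) s $ j) \<longlonglongrightarrow> 0"
    proof (rule Lim_null_comparison[OF _ pow], intro always_eventually allI)
      fix n show "norm (E (Suc (r n)) s $ j - E (r n) s $ j) \<le> c * (1 / 2) ^ r n"
        using bd[of "r n"] dist1_ge[of "E (Suc (r n)) s" j "E (r n) s"] dist1_nonneg[of "D (Suc (r n)) s" "D (r n) s"]
        by linarith
    qed
    moreover have "(\<lambda>n. E (Suc (r n)) s $ j - E (r n) s $ j) \<longlonglongrightarrow> dyson_step W A s (d s) (e s) $ j - e s $ j"
      by (intro tendsto_diff Elim elim s0)
    ultimately have "dyson_step W A s (d s) (e s) $ j - e s $ j = 0" using LIMSEQ_unique by blast
    with 1 show ?thesis by simp
  qed
  have sol: "dyson_solution V W A s (d s) (e s)" if s: "Re s > 0" for s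
  proof -
    let ?U = "{s. Re s > 1 + 2 * dyson_constant}"
    have U: "open ?U" "?U \<noteq> {}" "?U \<subseteq> ?H"
    proof -
      show "open ?U" by (rule open_halfspace_Re_gt)
      have "of_real (2 + 2 * dyson_constant) \<in> ?U" by simp
      then show "?U \<noteq> {}" by blast
      show "?U \<subseteq> ?H" using dyson_constant_nonneg by auto
    qed
    have "d s $ i = dyson_step V (transpose A) s (e s) (d s) $ i" for i
      by (rule analytic_continuation_open[OF U(1) open_right_half_plane U(2) connected_right_half_plane U(3)])
        (use s far dh eh dn en in \<open>auto intro!: dyson_step_holomorphic\<close>)
    moreover have "e s $ j = dyson_step W A s (d s) (e s) $ j" for j
      by (rule analytic_continuation_open[OF U(1) open_right_half_plane U(2) connected_right_half_plane U(3)])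
        (use s far dh eh dn en in \<open>auto intro!: dyson_step_holomorphic\<close>)
    ultimately show ?thesis unfolding dyson_solution_def vec_eq_iff by blast
  qed
  show ?thesis
    using dh eh dn en dc ec sol by (intro exI[of _ d] exI[of _ e] conjI allI impI)
qed

end

section \<open>Transport between the half-plane and the cut plane\<close>

lemma minus_square_in_cut_plane:
  assumes "Re s > 0"
  shows "- s\<^sup>2 \<in> cut_plane"
proof
  assume "- s\<^sup>2 \<in> complex_of_real ` {0..}"
  then obtain t where t: "t \<ge> 0" "- s\<^sup>2 = of_real t" by auto
  have "Im (s\<^sup>2) = 0" "Re (s\<^sup>2) \<le> 0"
    using arg_cong[OF t(2), of Im] arg_cong[OF t(2), of Re] t(1) by simp_all
  then show False using mult_pos_pos[OF assms assms] assms by (auto simp: power2_eq_square)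
qed

text \<open>The principal square root of -z has nonnegative real part, and a purely imaginary root
  would put z on the closed half line.\<close>

lemma cut_plane_square:
  assumes "z \<in> cut_plane"
  obtains s where "Re s > 0" "z = - s\<^sup>2"
proof -
  have "Re (csqrt (- z)) \<noteq> 0"
  proof
    assume 0: "Re (csqrt (- z)) = 0"
    have "z = - (csqrt (- z))\<^sup>2" by simp
    also have "\<dots> = of_real ((Im (csqrt (- z)))\<^sup>2)"
      using 0 by (simp add: complex_eq_iff power2_eq_square)
    finally show False using assms by (metis Compl_iff atLeast_iff imageI zero_le_power2)
  qed
  then have "Re (csqrt (- z)) > 0" using csqrt_principal[of "- z"] by auto
  moreover have "z = - (csqrt (- z))\<^sup>2" by simp
  ultimately show thesis using that by blast
qed

lemma stieltjes_classI:
  assumes "finite_measure \<nu>" "sets \<nu> = sets borel_nonneg" "measure \<nu> {0..} = 1"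
    and "\<And>s. Re s > 0 \<Longrightarrow> stieltjes \<nu> (- s\<^sup>2) = f (- s\<^sup>2)"
  shows "restrict f cut_plane \<in> stieltjes_class"
proof -
  interpret finite_measure \<nu> by fact
  have "emeasure \<nu> (space \<nu>) = 1"
    using assms(3) space_borel_nonneg[OF assms(2)] by (simp add: emeasure_eq_measure)
  then have "prob_space \<nu>" by (rule prob_spaceI)
  moreover have "restrict f cut_plane = restrict (stieltjes \<nu>) cut_plane"
  proof (rule restrict_ext)
    fix z assume "z \<in> cut_plane"
    then obtain s where "Re s > 0" "z = - s\<^sup>2" by (rule cut_plane_square)
    then show "f z = stieltjes \<nu> z" using assms(4) by simp
  qed
  ultimately show ?thesis unfolding stieltjes_class_def using assms(2) by blast
qed

lemma stieltjes_class_holomorphic: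
  assumes "f \<in> stieltjes_class"
  shows "(\<lambda>s. f (- s\<^sup>2)) holomorphic_on {s. Re s > 0}"
proof -
  obtain \<nu> where \<nu>: "prob_space \<nu>" "sets \<nu> = sets borel_nonneg" "f = restrict (stieltjes \<nu>) cut_plane"
    using assms by (auto simp: stieltjes_class_def)
  interpret prob_space \<nu> by fact
  have im: "(\<lambda>s. - s\<^sup>2) ` {s. Re s > 0} \<subseteq> cut_plane"
    by (rule image_subsetI, rule minus_square_in_cut_plane) simp
  have "(\<lambda>s::complex. - s\<^sup>2) holomorphic_on {s. Re s > 0}" by (intro holomorphic_intros)
  from holomorphic_on_compose_gen[OF this stieltjes_holomorphic[OF finite_measure_axioms \<nu>(2)] im]
  have "(\<lambda>s. stieltjes \<nu> (- s\<^sup>2)) holomorphic_on {s. Re s > 0}" by (simp add: o_def)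
  then show ?thesis
    by (rule holomorphic_transform) (use minus_square_in_cut_plane in \<open>auto simp: \<nu>(3)\<close>)
qed

text \<open>At \<open>- x\<^sup>2\<close> the integrand is 1 / (t + x^2), positive and at most 1 /
  x^2. The two bounds turn a value of the transform into an admissible shift \<open>d\<close> with
  nonnegative real part.\<close>

lemma stieltjes_class_negative_real:
  assumes "f \<in> stieltjes_class" "x > 0"
  obtains y where "f (- (of_real x)\<^sup>2) = of_real y" "0 < y" "y \<le> 1 / x\<^sup>2"
proof -
  obtain \<nu> where \<nu>: "prob_space \<nu>" "sets \<nu> = sets borel_nonneg" "f = restrict (stieltjes \<nu>) cut_plane"
    using assms by (auto simp: stieltjes_class_def)
  interpret prob_space \<nu> by fact
  note sp = space_borel_nonneg[OF \<nu>(2)]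
  define g where "g t = 1 / (t + x\<^sup>2)" for t :: real
  have gb: "0 < g t" "g t \<le> 1 / x\<^sup>2" if "t \<ge> 0" for t
    using that assms(2) by (auto simp: g_def add_nonneg_pos frac_le)
  have gm: "g \<in> borel_measurable \<nu>"
    by (rule borel_measurable_borel_nonneg[OF \<nu>(2)]) (simp add: g_def[abs_def])
  have gi: "integrable \<nu> g"
  proof (rule integrable_const_bound[OF _ gm])
    show "AE t in \<nu>. norm (g t) \<le> 1 / x\<^sup>2"
    proof (rule AE_I2)
      fix t assume "t \<in> space \<nu>"
      then show "norm (g t) \<le> 1 / x\<^sup>2" using gb[of t] sp by simp
    qed
  qed
  have xc: "- (complex_of_real x)\<^sup>2 \<in> cut_plane"
    by (rule minus_square_in_cut_plane) (simp add: assms)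
  have "f (- (of_real x)\<^sup>2) = stieltjes \<nu> (- (of_real x)\<^sup>2)"
    using xc unfolding \<nu>(3) by (rule restrict_apply')
  also have "\<dots> = (LINT t|\<nu>. complex_of_real (g t))"
    unfolding stieltjes_def by (rule Bochner_Integration.integral_cong) (auto simp: g_def)
  also have "\<dots> = of_real (LINT t|\<nu>. g t)" by (rule integral_complex_of_real)
  finally have 1: "f (- (of_real x)\<^sup>2) = of_real (LINT t|\<nu>. g t)" .
  have 2: "0 < (LINT t|\<nu>. g t)"
  proof -
    have "0 \<le> (LINT t|\<nu>. g t)"
      using gb sp by (intro integral_nonneg_AE AE_I2) (auto intro: less_imp_le)
    moreover have "(LINT t|\<nu>. g t) \<noteq> 0"
    proof
      assume "(LINT t|\<nu>. g t) = 0"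
      moreover have "AE t in \<nu>. 0 \<le> g t" using gb sp by (intro AE_I2) (auto intro: less_imp_le)
      ultimately have "AE t in \<nu>. g t = 0" using integral_nonneg_eq_0_iff_AE[OF gi] by blast
      moreover have "AE t in \<nu>. g t \<noteq> 0" using gb sp by (intro AE_I2) (auto simp: less_le)
      ultimately have "AE t in \<nu>. False" by eventually_elim simp
      then show False using AE_const by simp
    qed
    ultimately show ?thesis by simp
  qed
  have "(LINT t|\<nu>. g t) \<le> (LINT t|\<nu>. 1 / x\<^sup>2)"
    using gb sp by (intro integral_mono gi) auto
  then have 3: "(LINT t|\<nu>. g t) \<le> 1 / x\<^sup>2" by (simp add: prob_space)
  show thesis by (rule that[OF 1 2 3])
qed

section \<open>Matrix-valued spectral measures\<close>

text \<open>Scaled by 1/2 so that the quadratic forms of a symmetric matrix at this vector and at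
  \<open>polar_minus i j\<close> differ by exactly its (i, j) entry. For \<open>i = j\<close> the
  vectors are the unit vector and 0.\<close>

definition polar_plus :: "'m \<Rightarrow> 'm \<Rightarrow> real^'m" where
  "polar_plus i j = (1/2) *\<^sub>R (axis i 1 + axis j 1)"

definition polar_minus :: "'m \<Rightarrow> 'm \<Rightarrow> real^'m" where
  "polar_minus i j = (1/2) *\<^sub>R (axis i 1 - axis j 1)"

definition quadratic_form :: "complex^'m^'m \<Rightarrow> real^'m \<Rightarrow> complex" where
  "quadratic_form R y = (\<Sum>i\<in>UNIV. \<Sum>j\<in>UNIV. of_real (y $ i * y $ j) * R $ i $ j)"

lemma bilinear_form_axis:
  "(\<Sum>a\<in>UNIV. \<Sum>b\<in>UNIV. of_real ((axis i 1 :: real^'m) $ a * (axis j 1 :: real^'m) $ b) * R $ a $ b) = (R :: complex^'m^'m) $ i $ j"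
proof -
  have "(\<Sum>a\<in>UNIV. \<Sum>b\<in>UNIV. of_real ((axis i 1 :: real^'m) $ a * (axis j 1 :: real^'m) $ b) * R $ a $ b) =
      (\<Sum>a\<in>UNIV. \<Sum>b\<in>UNIV. if a = i then if b = j then R $ a $ b else 0 else 0)"
    by (intro sum.cong refl) (auto simp: axis_def)
  also have "\<dots> = (\<Sum>a\<in>UNIV. if a = i then (\<Sum>b\<in>UNIV. if b = j then R $ a $ b else 0) else 0)"
    by (intro sum.cong refl) auto
  also have "\<dots> = R $ i $ j" by simp
  finally show ?thesis .
qed

lemma quadratic_form_polarization:
  fixes R :: "complex^'m^'m"
  assumes "R $ i $ j = R $ j $ i"
  shows "quadratic_form R (polar_plus i j) - quadratic_form R (polar_minus i j) = R $ i $ j"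
proof -
  let ?B = "\<lambda>i j. \<Sum>a\<in>UNIV. \<Sum>b\<in>UNIV. of_real ((axis i 1 :: real^'m) $ a * (axis j 1 :: real^'m) $ b) * R $ a $ b"
  have "quadratic_form R (polar_plus i j) - quadratic_form R (polar_minus i j) = 1/2 * (?B i j + ?B j i)"
    unfolding quadratic_form_def sum_subtractf[symmetric] sum.distrib[symmetric] sum_distrib_left
    by (intro sum.cong refl) (simp add: polar_plus_def polar_minus_def algebra_simps)
  also have "\<dots> = R $ i $ j" unfolding bilinear_form_axis using assms by simp
  finally show ?thesis .
qed

lemma polar_norm:
  "(norm (polar_plus i j))\<^sup>2 - (norm (polar_minus i j))\<^sup>2 = (if i = j then 1 else 0)"
  unfolding polar_plus_def polar_minus_def power2_norm_eq_inner
  by (simp add: inner_add_left inner_add_right inner_diff_left inner_diff_right inner_axis_axis)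

text \<open>Polarization defines the entries of the measure. That the quadratic form of the
  resulting matrix at a real \<open>y\<close> is again \<open>\<nu> y\<close> holds for the
  Stieltjes transforms by polarization, and injectivity on signed combinations carries it over to
  the measures. Positivity follows because every \<open>\<nu> y\<close> is positive.\<close>

lemma matrix_measure_of_quadratic_forms:
  fixes R :: "complex \<Rightarrow> complex^'m^'m" and \<nu> :: "real^'m \<Rightarrow> real measure"
  assumes sym: "\<And>s i j. Re s > 0 \<Longrightarrow> R s $ i $ j = R s $ j $ i"
    and \<nu>: "\<And>y. finite_measure (\<nu> y)" "\<And>y. sets (\<nu> y) = sets borel_nonneg"
      "\<And>y. measure (\<nu> y) {0..} = (norm y)\<^sup>2"
      "\<And>y s. Re s > 0 \<Longrightarrow> stieltjes (\<nu> y) (- s\<^sup>2) = quadratic_form (R s) y / s"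
  obtains \<mu> :: "real set \<Rightarrow> complex^'m^'m"
  where "positive_matrix_measure borel_nonneg \<mu>" "\<mu> {0..} = mat 1"
    "\<And>s i j. Re s > 0 \<Longrightarrow>
      has_cm_integral borel_nonneg (\<lambda>B. \<mu> B $ i $ j) (\<lambda>t. 1 / (complex_of_real t - (- s\<^sup>2))) (R s $ i $ j / s)"
proof -
  define m where "m i j B = measure (\<nu> (polar_plus i j)) B - measure (\<nu> (polar_minus i j)) B" for i j B
  define \<mu> :: "real set \<Rightarrow> complex^'m^'m" where "\<mu> B = (\<chi> i j. of_real (m i j B))" for B
  have quad_m: "(\<Sum>i\<in>UNIV. \<Sum>j\<in>UNIV. (y $ i * y $ j) * m i j B) = measure (\<nu> y) B"
    if B: "B \<in> sets borel_nonneg" for y B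
  proof -
    \<comment> \<open>The relation is encoded as one signed family: \<open>None\<close> carries
      \<open>\<nu> y\<close> with coefficient -1, and \<open>Some (i, j, p)\<close> one of the two
      polarization measures, \<open>p\<close> telling which.\<close>
    define c :: "('m \<times> 'm \<times> bool) option \<Rightarrow> real" where
      "c k = (case k of None \<Rightarrow> - 1 | Some (i, j, p) \<Rightarrow> if p then y $ i * y $ j else - (y $ i * y $ j))" for k
    define \<rho> where
      "\<rho> k = (case k of None \<Rightarrow> \<nu> y | Some (i, j, p) \<Rightarrow> if p then \<nu> (polar_plus i j) else \<nu> (polar_minus i j))" for k
    have split_sum: "(\<Sum>k\<in>UNIV. f k) = f None + (\<Sum>i\<in>UNIV. \<Sum>j\<in>UNIV. f (Some (i, j, True)) + f (Some (i, j, False)))"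
      for f :: "('m \<times> 'm \<times> bool) option \<Rightarrow> 'c::comm_monoid_add"
    proof -
      have "(\<Sum>k\<in>UNIV. f k) = f None + (\<Sum>x\<in>UNIV. f (Some x))"
        by (simp add: UNIV_option_conv sum.reindex)
      also have "(\<Sum>x\<in>UNIV. f (Some x)) = (\<Sum>i\<in>UNIV. \<Sum>j\<in>UNIV. \<Sum>p\<in>UNIV. f (Some (i, j, p)))"
        by (simp add: sum.cartesian_product flip: UNIV_Times_UNIV)
      finally show ?thesis by (simp add: UNIV_bool add.commute)
    qed
    have "(\<Sum>k\<in>UNIV. c k * measure (\<rho> k) B) = 0"
    proof (rule stieltjes_combination_eq_0[OF _ _ _ _ B])
      show "finite_measure (\<rho> k)" "sets (\<rho> k) = sets borel_nonneg" for k
        using \<nu> by (auto simp: \<rho>_def split: option.split)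
      fix z :: complex assume "z \<in> cut_plane"
      then obtain s where s: "Re s > 0" "z = - s\<^sup>2" by (rule cut_plane_square)
      have "(\<Sum>k\<in>UNIV. complex_of_real (c k) * stieltjes (\<rho> k) z) =
          - stieltjes (\<nu> y) z + (\<Sum>i\<in>UNIV. \<Sum>j\<in>UNIV. of_real (y $ i * y $ j) *
            (stieltjes (\<nu> (polar_plus i j)) z - stieltjes (\<nu> (polar_minus i j)) z))"
        unfolding split_sum by (simp add: c_def \<rho>_def algebra_simps)
      also have "\<dots> = - (quadratic_form (R s) y / s) + (\<Sum>i\<in>UNIV. \<Sum>j\<in>UNIV. of_real (y $ i * y $ j) * (R s $ i $ j / s))"
        unfolding s(2) \<nu>(4)[OF s(1)] diff_divide_distrib[symmetric] quadratic_form_polarization[OF sym[OF s(1)]] ..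
      also have "\<dots> = 0" unfolding quadratic_form_def by (simp add: sum_divide_distrib)
      finally show "(\<Sum>k\<in>UNIV. complex_of_real (c k) * stieltjes (\<rho> k) z) = 0" .
    qed simp
    then have "- measure (\<nu> y) B + (\<Sum>i\<in>UNIV. \<Sum>j\<in>UNIV. (y $ i * y $ j) * m i j B) = 0"
      unfolding split_sum by (simp add: c_def \<rho>_def m_def algebra_simps)
    then show ?thesis by simp
  qed
  have m_sym: "m i j B = m j i B" if B: "B \<in> sets borel_nonneg" for i j B
  proof -
    \<comment> \<open>The left-hand side of \<open>quad_m\<close> is even in \<open>y\<close>, and
      \<open>polar_minus j i\<close> is the negative of \<open>polar_minus i j\<close>.\<close>
    have "measure (\<nu> (- y)) B = measure (\<nu> y) B" for y
      using quad_m[OF B, of "- y"] quad_m[OF B, of y] by simp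
    from this[of "polar_minus i j"] have "measure (\<nu> (polar_minus j i)) B = measure (\<nu> (polar_minus i j)) B"
      by (simp add: polar_minus_def flip: scaleR_minus_right)
    then show ?thesis by (simp add: m_def polar_plus_def add.commute)
  qed
  have "complex_measure borel_nonneg (\<lambda>B. \<mu> B $ i $ j)" for i j
    unfolding complex_measure_def
  proof (intro allI impI)
    fix F :: "nat \<Rightarrow> real set" assume F: "range F \<subseteq> sets borel_nonneg" "disjoint_family F"
    have "(\<lambda>k. measure (\<nu> y) (F k)) sums measure (\<nu> y) (\<Union>k. F k)" for y
      using F \<nu>(1,2) by (intro finite_measure.finite_measure_UNION) auto
    then have "(\<lambda>k. m i j (F k)) sums m i j (\<Union>k. F k)" unfolding m_def by (intro sums_diff)
    then show "(\<lambda>k. \<mu> (F k) $ i $ j) sums (\<mu> (\<Union>k. F k) $ i $ j)"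
      by (simp add: \<mu>_def sums_of_real_iff)
  qed
  moreover have "hermitian_psd (\<mu> B)" if B: "B \<in> sets borel_nonneg" for B
    unfolding hermitian_psd_def
  proof (intro conjI allI)
    show "\<mu> B $ i $ j = cnj (\<mu> B $ j $ i)" for i j
      using m_sym[OF B, of i j] by (simp add: \<mu>_def)
    fix x :: "complex^'m"
    \<comment> \<open>The entries of \<open>\<mu> B\<close> are real, so in each term the products
      of a real with an imaginary part are purely imaginary and drop out.\<close>
    have "Re (\<Sum>i\<in>UNIV. \<Sum>j\<in>UNIV. cnj (x $ i) * \<mu> B $ i $ j * x $ j) =
        (\<Sum>i\<in>UNIV. \<Sum>j\<in>UNIV. ((\<chi> i. Re (x $ i)) $ i * (\<chi> i. Re (x $ i)) $ j) * m i j B) +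
        (\<Sum>i\<in>UNIV. \<Sum>j\<in>UNIV. ((\<chi> i. Im (x $ i)) $ i * (\<chi> i. Im (x $ i)) $ j) * m i j B)"
      unfolding Re_sum sum.distrib[symmetric] by (intro sum.cong refl) (simp add: \<mu>_def algebra_simps)
    also have "\<dots> = measure (\<nu> (\<chi> i. Re (x $ i))) B + measure (\<nu> (\<chi> i. Im (x $ i))) B"
      by (simp only: quad_m[OF B])
    finally show "0 \<le> Re (\<Sum>i\<in>UNIV. \<Sum>j\<in>UNIV. cnj (x $ i) * \<mu> B $ i $ j * x $ j)" by simp
  qed
  ultimately have 1: "positive_matrix_measure borel_nonneg \<mu>"
    unfolding positive_matrix_measure_def by blast
  have 2: "\<mu> {0..} = mat 1"
    by (simp add: \<mu>_def m_def \<nu>(3) polar_norm mat_def vec_eq_iff)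
  have 3: "has_cm_integral borel_nonneg (\<lambda>B. \<mu> B $ i $ j) (\<lambda>t. 1 / (complex_of_real t - (- s\<^sup>2))) (R s $ i $ j / s)"
    if s: "Re s > 0" for s i j
    unfolding has_cm_integral_def
  proof (intro exI conjI ballI)
    \<comment> \<open>The imaginary part vanishes; it is represented as \<open>?p - ?p\<close>.\<close>
    let ?p = "\<nu> (polar_plus i j)" and ?q = "\<nu> (polar_minus i j)"
    show "finite_measure \<rho>" "sets \<rho> = sets borel_nonneg" "integrable \<rho> (\<lambda>t. 1 / (complex_of_real t - (- s\<^sup>2)))"
      if "\<rho> \<in> {?p, ?q, ?p, ?p}" for \<rho>
      using that \<nu> integrable_cauchy_power[OF \<nu>(1,2) minus_square_in_cut_plane[OF s], of _ 1] by auto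
    show "\<mu> B $ i $ j = Complex (measure ?p B - measure ?q B) (measure ?p B - measure ?p B)" for B
      by (simp add: \<mu>_def m_def complex_eq_iff)
    show "R s $ i $ j / s = ((\<integral>t. 1 / (complex_of_real t - (- s\<^sup>2)) \<partial>?p) - (\<integral>t. 1 / (complex_of_real t - (- s\<^sup>2)) \<partial>?q)) +
        \<i> * ((\<integral>t. 1 / (complex_of_real t - (- s\<^sup>2)) \<partial>?p) - (\<integral>t. 1 / (complex_of_real t - (- s\<^sup>2)) \<partial>?p))"
      using \<nu>(4)[OF s, of "polar_plus i j"] \<nu>(4)[OF s, of "polar_minus i j"] quadratic_form_polarization[OF sym[OF s], of i j]
      unfolding stieltjes_def by (simp add: diff_divide_distrib[symmetric])
  qed
  show thesis by (rule that[OF 1 2 3])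
qed

section \<open>Spectral measures of the accretive inverse\<close>

text \<open>Along the reals each coordinate of \<open>d\<close> is at most b / x in modulus, so the
  asymptotic estimate leaves an error of order 1 / x^2.\<close>

lemma dyson_resolvent_limit:
  fixes A :: "real^'n^'N"
  assumes nn: "\<And>s. Re s > 0 \<Longrightarrow> nonneg_re (d s)" "\<And>s. Re s > 0 \<Longrightarrow> nonneg_re (e s)"
    and bnd: "\<And>s i. Re s > 0 \<Longrightarrow> norm (d s $ i) \<le> b / Re s"
  shows "((\<lambda>x::real. of_real x * dyson_resolvent A (of_real x) (d (of_real x)) (e (of_real x)) $ i $ j) \<longlongrightarrow>
     (if i = j then 1 else 0)) at_top" (is "(?f \<longlongrightarrow> ?l) _")
proof (rule LIM_zero_cancel, rule Lim_null_comparison)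
  define g where "g x = (real CARD('N) * (b / x) + gram_bound A / x) / x" for x :: real
  show "(g \<longlongrightarrow> 0) at_top" unfolding g_def by real_asymp
  show "\<forall>\<^sub>F x in at_top. norm (?f x - ?l) \<le> g x"
  proof (rule eventually_at_top_linorderI[of 1])
    fix x :: real assume x: "x \<ge> 1"
    then have x0: "Re (of_real x) > 0" by simp
    let ?R = "dyson_resolvent A (of_real x) (d (of_real x)) (e (of_real x))"
    have "norm (?f x - ?l) = norm ((of_real x *s (?R *v axis j 1) - axis j 1) $ i)"
      by (simp only: vector_minus_component vector_smult_component matrix_vector_axis_nth) (simp add: axis_def)
    also have "\<dots> \<le> norm (of_real x *s (?R *v axis j 1) - axis j 1)"
      by (rule Finite_Cartesian_Product.norm_nth_le)
    also have "\<dots> \<le> (dist1 (d (of_real x)) 0 + gram_bound A / x) / x"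
      using dyson_resolvent_asymptotic[OF x0 nn(1)[OF x0] nn(2)[OF x0], of A "axis j 1"] by simp
    also have "dist1 (d (of_real x)) 0 \<le> real CARD('N) * (b / x)"
      using sum_bounded_above[of UNIV "\<lambda>i. norm (d (of_real x) $ i)" "b / x"] bnd[OF x0]
      by (simp add: dist1_def)
    then have "(dist1 (d (of_real x)) 0 + gram_bound A / x) / x \<le> g x"
      unfolding g_def using x by (intro divide_right_mono add_right_mono) auto
    finally show "norm (?f x - ?l) \<le> g x" .
  qed
qed

text \<open>The second claim applies the representation theorem anew, to the normalised trace: its
  real part is positive because the diagonal entries have positive real part, and \<open>x\<close>
  times it tends to 1.\<close>

lemma dyson_resolvent_stieltjes:
  fixes A :: "real^'n^'N"
  assumes hol: "\<And>i. (\<lambda>s. d s $ i) holomorphic_on {s. Re s > 0}" "\<And>j. (\<lambda>s. e s $ j) holomorphic_on {s. Re s > 0}"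
    and nn: "\<And>s. Re s > 0 \<Longrightarrow> nonneg_re (d s)" "\<And>s. Re s > 0 \<Longrightarrow> nonneg_re (e s)"
    and cnj: "\<And>s. Re s > 0 \<Longrightarrow> d (cnj s) = (\<chi> i. cnj (d s $ i))" "\<And>s. Re s > 0 \<Longrightarrow> e (cnj s) = (\<chi> j. cnj (e s $ j))"
    and bnd: "\<And>s i. Re s > 0 \<Longrightarrow> norm (d s $ i) \<le> b / Re s"
  defines "R \<equiv> \<lambda>s. dyson_resolvent A s (d s) (e s)"
  shows "\<exists>\<mu> :: real set \<Rightarrow> complex^'N^'N. positive_matrix_measure borel_nonneg \<mu> \<and> \<mu> {0..} = mat 1 \<and>
     (\<forall>s i j. Re s > 0 \<longrightarrow> has_cm_integral borel_nonneg (\<lambda>B. \<mu> B $ i $ j)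
        (\<lambda>t. 1 / (complex_of_real t - (- s\<^sup>2))) (R s $ i $ j / s))"
    and "\<exists>\<nu>. finite_measure \<nu> \<and> sets \<nu> = sets borel_nonneg \<and> measure \<nu> {0..} = 1 \<and>
     (\<forall>s. Re s > 0 \<longrightarrow> stieltjes \<nu> (- s\<^sup>2) = (1 / of_nat CARD('N) * (\<Sum>i\<in>UNIV. R s $ i $ i)) / s)"
proof -
  let ?H = "{s. Re s > 0}"
  have Rh: "(\<lambda>s. R s $ i $ j) holomorphic_on ?H" for i j
    unfolding R_def by (rule dyson_resolvent_holomorphic[OF hol(1) nn(1) hol(2) nn(2)])
  have Rc: "R (cnj s) $ i $ j = cnj (R s $ i $ j)" if "Re s > 0" for s i j
    unfolding R_def cnj[OF that] by (rule dyson_resolvent_cnj[OF that nn(1)[OF that] nn(2)[OF that]])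
  have Rl: "((\<lambda>x::real. of_real x * R (of_real x) $ i $ j) \<longlongrightarrow> (if i = j then 1 else 0)) at_top" for i j
    unfolding R_def by (rule dyson_resolvent_limit[OF nn bnd])
  have Rs: "R s $ i $ j = R s $ j $ i" if "Re s > 0" for s i j
    unfolding R_def by (rule dyson_resolvent_symmetric[OF that nn(1)[OF that] nn(2)[OF that]])
  have "\<exists>\<nu>. finite_measure \<nu> \<and> sets \<nu> = sets borel_nonneg \<and> measure \<nu> {0..} = (norm y)\<^sup>2 \<and>
      (\<forall>s. Re s > 0 \<longrightarrow> stieltjes \<nu> (- s\<^sup>2) = quadratic_form (R s) y / s)" for y :: "real^'N"
  \<comment> \<open>The representation theorem asks for a strictly positive real part, which fails
    at \<open>y = 0\<close>; this vector does occur, as \<open>polar_minus i i\<close>.\<close>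
  proof (cases "y = 0")
    case True
    have "finite_measure (null_measure borel_nonneg)" by (rule finite_measureI) simp
    then show ?thesis
      using True by (intro exI[of _ "null_measure borel_nonneg"]) (auto simp: quadratic_form_def stieltjes_def measure_def)
  next
    case False
    obtain \<nu> where "finite_measure \<nu>" "sets \<nu> = sets borel_nonneg" "measure \<nu> {0..} = (norm y)\<^sup>2"
      "\<And>s. Re s > 0 \<Longrightarrow> stieltjes \<nu> (- s\<^sup>2) = quadratic_form (R s) y / s"
    proof (rule half_plane_stieltjes_representation[of "\<lambda>s. quadratic_form (R s) y" "(norm y)\<^sup>2"])
      show "(\<lambda>s. quadratic_form (R s) y) holomorphic_on ?H"
        unfolding quadratic_form_def by (intro holomorphic_intros Rh)
      show "quadratic_form (R (cnj s)) y = cnj (quadratic_form (R s) y)" if "Re s > 0" for s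
        by (simp add: quadratic_form_def Rc[OF that])
      show "0 < Re (quadratic_form (R s) y)" if "Re s > 0" for s
      proof -
        define v :: "complex^'N" where "v = (\<chi> i. of_real (y $ i))"
        have "v \<noteq> 0" using False by (auto simp: v_def vec_eq_iff)
        from dyson_resolvent_pos[OF that nn(1)[OF that] nn(2)[OF that] this, of A]
        have "0 < v \<bullet> (R s *v v)" by (simp add: R_def)
        also have "v \<bullet> (R s *v v) = Re (quadratic_form (R s) y)"
          unfolding quadratic_form_def Re_sum inner_vec_def inner_complex_cnj
          by (intro sum.cong refl)
            (simp add: v_def matrix_vector_mult_def sum_distrib_left mult_ac del: times_complex.sel Re_sum flip: Re_sum)
        finally show ?thesis .
      qed
      have "((\<lambda>x::real. \<Sum>i\<in>UNIV. \<Sum>j\<in>UNIV. of_real (y $ i * y $ j) * (of_real x * R (of_real x) $ i $ j)) \<longlongrightarrow>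
          (\<Sum>i\<in>UNIV. \<Sum>j\<in>UNIV. of_real (y $ i * y $ j) * (if i = j then 1 else 0))) at_top"
        by (intro tendsto_sum tendsto_mult tendsto_const Rl)
      moreover have "(\<Sum>i\<in>UNIV. \<Sum>j\<in>UNIV. complex_of_real (y $ i * y $ j) * (if i = j then 1 else 0)) = of_real ((norm y)\<^sup>2)"
      proof -
        have "(\<Sum>i\<in>UNIV. \<Sum>j\<in>UNIV. complex_of_real (y $ i * y $ j) * (if i = j then 1 else 0)) =
            (\<Sum>i\<in>UNIV. of_real (y $ i * y $ i))"
          by (simp add: if_distrib cong: if_cong)
        then show ?thesis by (simp add: power2_norm_eq_inner inner_vec_def)
      qed
      ultimately show "((\<lambda>x::real. of_real x * quadratic_form (R (of_real x)) y) \<longlongrightarrow> of_real ((norm y)\<^sup>2)) at_top"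
        unfolding quadratic_form_def by (simp add: sum_distrib_left mult_ac)
    qed blast
    then show ?thesis by blast
  qed
  then obtain \<nu> :: "real^'N \<Rightarrow> real measure" where \<nu>: "\<And>y. finite_measure (\<nu> y)" "\<And>y. sets (\<nu> y) = sets borel_nonneg"
      "\<And>y. measure (\<nu> y) {0..} = (norm y)\<^sup>2"
      "\<And>y s. Re s > 0 \<Longrightarrow> stieltjes (\<nu> y) (- s\<^sup>2) = quadratic_form (R s) y / s"
    by metis
  show "\<exists>\<mu> :: real set \<Rightarrow> complex^'N^'N. positive_matrix_measure borel_nonneg \<mu> \<and> \<mu> {0..} = mat 1 \<and>
     (\<forall>s i j. Re s > 0 \<longrightarrow> has_cm_integral borel_nonneg (\<lambda>B. \<mu> B $ i $ j)
        (\<lambda>t. 1 / (complex_of_real t - (- s\<^sup>2))) (R s $ i $ j / s))"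
  proof (rule matrix_measure_of_quadratic_forms[OF Rs \<nu>])
    fix \<mu> :: "real set \<Rightarrow> complex^'N^'N"
    assume "positive_matrix_measure borel_nonneg \<mu>" "\<mu> {0..} = mat 1"
      and "\<And>s i j. Re s > 0 \<Longrightarrow> has_cm_integral borel_nonneg (\<lambda>B. \<mu> B $ i $ j)
        (\<lambda>t. 1 / (complex_of_real t - (- s\<^sup>2))) (R s $ i $ j / s)"
    then show ?thesis by (intro exI[of _ \<mu>] conjI allI impI)
  qed
  show "\<exists>\<nu>. finite_measure \<nu> \<and> sets \<nu> = sets borel_nonneg \<and> measure \<nu> {0..} = 1 \<and>
     (\<forall>s. Re s > 0 \<longrightarrow> stieltjes \<nu> (- s\<^sup>2) = (1 / of_nat CARD('N) * (\<Sum>i\<in>UNIV. R s $ i $ i)) / s)"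
  proof (rule half_plane_stieltjes_representation[of "\<lambda>s. 1 / of_nat CARD('N) * (\<Sum>i\<in>UNIV. R s $ i $ i)" 1])
    show "(\<lambda>s. 1 / of_nat CARD('N) * (\<Sum>i\<in>UNIV. R s $ i $ i)) holomorphic_on ?H"
      by (intro holomorphic_intros Rh)
    show "0 < Re (1 / of_nat CARD('N) * (\<Sum>i\<in>UNIV. R s $ i $ i))" if "Re s > 0" for s
    proof -
      have "0 < (\<Sum>i\<in>UNIV. Re (R s $ i $ i))"
        unfolding R_def by (intro sum_pos dyson_resolvent_diag_pos nn that) auto
      then show ?thesis by (simp add: Re_divide_of_nat)
    qed
    show "1 / of_nat CARD('N) * (\<Sum>i\<in>UNIV. R (cnj s) $ i $ i) = cnj (1 / of_nat CARD('N) * (\<Sum>i\<in>UNIV. R s $ i $ i))"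
      if "Re s > 0" for s by (simp add: Rc[OF that])
    have "((\<lambda>x::real. 1 / of_nat CARD('N) * (\<Sum>i\<in>UNIV. of_real x * R (of_real x) $ i $ i)) \<longlongrightarrow>
        1 / of_nat CARD('N) * (\<Sum>i\<in>(UNIV::'N set). (1::complex))) at_top"
      using Rl[of i i for i] by (intro tendsto_mult tendsto_sum tendsto_const) simp
    then show "((\<lambda>x::real. of_real x * (1 / of_nat CARD('N) * (\<Sum>i\<in>UNIV. R (of_real x) $ i $ i))) \<longlongrightarrow> of_real 1) at_top"
      by (simp add: sum_distrib_left mult.left_commute)
  qed blast
qed

section \<open>The system of equations\<close>

lemma diag_matrix_mult_nth: "(diag_matrix h ** X) $ i $ k = h i * (X $ i $ k :: complex)"
  by (simp add: matrix_matrix_mult_def diag_matrix_def if_distrib[of "\<lambda>x. x * _"] cong: if_cong)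

lemma diag_matrix_inverse:
  fixes h :: "'m::finite \<Rightarrow> complex"
  assumes "\<And>i. h i \<noteq> 0"
  shows "matrix_inv (diag_matrix h) = diag_matrix (\<lambda>i. 1 / h i)" "invertible (diag_matrix h)"
proof -
  have "diag_matrix h ** diag_matrix (\<lambda>i. 1 / h i) = mat 1"
    by (simp add: vec_eq_iff diag_matrix_mult_nth) (simp add: diag_matrix_def mat_def assms)
  then show "matrix_inv (diag_matrix h) = diag_matrix (\<lambda>i. 1 / h i)" "invertible (diag_matrix h)"
    by (rule matrix_inv_eqI)+
qed

lemma trace_diag_matrix_mult: "trace (diag_matrix h ** X) = (\<Sum>i\<in>UNIV. h i * (X $ i $ i :: complex))"
  by (simp add: trace_def diag_matrix_mult_nth)

lemma transpose_cmat: "transpose (cmat A) = cmat (transpose A)"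
  by (simp add: vec_eq_iff transpose_def)

lemma T_tilde_inverse_eq: "T_tilde_inverse A \<psi> \<psi>' z = T_inverse (transpose A) \<psi>' \<psi> z"
  unfolding T_tilde_inverse_def T_inverse_def transpose_cmat[symmetric] transpose_transpose ..

lemma T_tilde_mat_eq: "T_tilde_mat A \<psi> \<psi>' z = T_mat (transpose A) \<psi>' \<psi> z"
  by (simp add: T_tilde_mat_def T_mat_def T_tilde_inverse_eq)

lemma shift_nonzero:
  assumes "Re s > 0" "nonneg_re d"
  shows "s + d $ i \<noteq> 0"
  using norm_shift_ge[OF assms, of i] assms(1) by auto

text \<open>With z = -s^2 the inverse of \<open>Psi \<psi> z\<close> has the diagonal entries s (s +
  d_i), and -z times the j-th entry of \<open>\<psi>'\<close> is s / (s + e_j). Hence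
  \<open>T_inverse\<close> is \<open>s\<close> times the accretive matrix.\<close>

lemma T_mat_eq_dyson_resolvent:
  fixes A :: "real^'n^'N"
  assumes s: "Re s > 0" and d: "nonneg_re d" and e: "nonneg_re e"
    and \<psi>: "\<And>i. \<psi> i (- s\<^sup>2) = 1 / (s * (s + d $ i))"
    and \<psi>': "\<And>j. \<psi>' j (- s\<^sup>2) = 1 / (s * (s + e $ j))"
  shows "invertible (Psi \<psi> (- s\<^sup>2))" "invertible (T_inverse A \<psi> \<psi>' (- s\<^sup>2))"
    "T_mat A \<psi> \<psi>' (- s\<^sup>2) = map_matrix (\<lambda>x. x / s) (dyson_resolvent A s d e)"
proof -
  have s0: "s \<noteq> 0" using s by auto
  have nz: "\<psi> i (- s\<^sup>2) \<noteq> 0" for i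
    using shift_nonzero[OF s d] s0 by (simp add: \<psi>)
  show "invertible (Psi \<psi> (- s\<^sup>2))" unfolding Psi_def by (rule diag_matrix_inverse(2)[OF nz])
  have T: "T_inverse A \<psi> \<psi>' (- s\<^sup>2) = map_matrix ((*) s) (dyson_matrix A s d e)"
  proof -
    have "T_inverse A \<psi> \<psi>' (- s\<^sup>2) $ i $ k = s * dyson_matrix A s d e $ i $ k" for i k
    proof -
      have "T_inverse A \<psi> \<psi>' (- s\<^sup>2) $ i $ k =
          (if i = k then 1 / \<psi> i (- s\<^sup>2) else 0) +
          s\<^sup>2 * (\<Sum>j\<in>UNIV. of_real (A $ i $ j) * \<psi>' j (- s\<^sup>2) * of_real (A $ k $ j))"
        unfolding T_inverse_def Psi_def diag_matrix_inverse(1)[of "\<lambda>i. \<psi> i (- s\<^sup>2)", OF nz]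
          vector_minus_component nth_map_matrix matrix_mult_diag_transpose_nth
        by (simp add: diag_matrix_def)
      also have "\<dots> = s * dyson_matrix A s d e $ i $ k"
      proof -
        have "(\<Sum>j\<in>UNIV. of_real (A $ i $ j) * \<psi>' j (- s\<^sup>2) * of_real (A $ k $ j)) =
            (\<Sum>j\<in>UNIV. of_real (A $ i $ j) * (1 / (s + e $ j)) * of_real (A $ k $ j)) / s"
          unfolding \<psi>' sum_divide_distrib by (intro sum.cong refl) simp
        then show ?thesis
          unfolding dyson_matrix_nth \<psi> using s0 by (simp add: power2_eq_square distrib_left)
      qed
      finally show ?thesis .
    qed
    then show ?thesis by (simp add: vec_eq_iff)
  qed
  have "T_inverse A \<psi> \<psi>' (- s\<^sup>2) ** map_matrix (\<lambda>x. x / s) (dyson_resolvent A s d e) =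
      dyson_matrix A s d e ** dyson_resolvent A s d e"
    unfolding T using s0 by (simp add: vec_eq_iff matrix_matrix_mult_def)
  also have "\<dots> = mat 1"
    unfolding dyson_resolvent_def by (rule matrix_inv_inverse(1)[OF dyson_matrix_invertible[OF s d e]])
  finally have *: "T_inverse A \<psi> \<psi>' (- s\<^sup>2) ** map_matrix (\<lambda>x. x / s) (dyson_resolvent A s d e) = mat 1" .
  show "invertible (T_inverse A \<psi> \<psi>' (- s\<^sup>2))" using * by (rule matrix_inv_eqI(2))
  show "T_mat A \<psi> \<psi>' (- s\<^sup>2) = map_matrix (\<lambda>x. x / s) (dyson_resolvent A s d e)"
    unfolding T_mat_def using * by (rule matrix_inv_eqI(1))
qed

lemma reciprocal_equation_iff:
  fixes s d t :: complex
  assumes "s \<noteq> 0" "s + d \<noteq> 0" "s + t \<noteq> 0"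
  shows "1 / (s * (s + d)) = - 1 / (- s\<^sup>2 * (1 + t / s)) \<longleftrightarrow> d = t"
proof -
  have "- s\<^sup>2 * (1 + t / s) = - (s * (s + t))"
    using assms(1) by (simp add: field_simps power2_eq_square)
  then have "- 1 / (- s\<^sup>2 * (1 + t / s)) = 1 / (s * (s + t))" by simp
  then show ?thesis using assms(1) by (simp add: divide_inverse)
qed

text \<open>This weight and \<open>col_weight\<close> carry the same factor 1 / n, n being the
  number of columns: both equations are normalised by n, although one of the traces has N
  terms.\<close>

definition row_weight :: "('N \<Rightarrow> 'n \<Rightarrow> real) \<Rightarrow> 'N \<Rightarrow> 'n::finite \<Rightarrow> real" where
  "row_weight \<sigma> i j = (\<sigma> i j)\<^sup>2 / real CARD('n)"

definition col_weight :: "('N \<Rightarrow> 'n \<Rightarrow> real) \<Rightarrow> 'n::finite \<Rightarrow> 'N \<Rightarrow> real" where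
  "col_weight \<sigma> j i = (\<sigma> i j)\<^sup>2 / real CARD('n)"

lemma weights_nonneg: "0 \<le> row_weight \<sigma> i j" "0 \<le> col_weight \<sigma> j i"
  by (simp_all add: row_weight_def col_weight_def)

text \<open>Each equation takes the form 1 / (s (s + d)) = 1 / (s (s + p)), where p is the image of
  the current pair under the fixed-point map. Since p again has nonnegative real part, no
  denominator vanishes and the equation says d = p.\<close>

lemma equations_iff_dyson_solution:
  fixes A :: "real^'n^'N"
  assumes s: "Re s > 0" and d: "nonneg_re d" and e: "nonneg_re e"
    and \<psi>: "\<And>i. \<psi> i (- s\<^sup>2) = 1 / (s * (s + d $ i))"
    and \<psi>': "\<And>j. \<psi>' j (- s\<^sup>2) = 1 / (s * (s + e $ j))"
  shows "(\<forall>i. \<psi> i (- s\<^sup>2) = -1 / (- s\<^sup>2 * (1 + 1 / of_nat CARD('n) * trace (D_tilde_mat \<sigma> i ** T_tilde_mat A \<psi> \<psi>' (- s\<^sup>2))))) \<and>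
      (\<forall>j. \<psi>' j (- s\<^sup>2) = -1 / (- s\<^sup>2 * (1 + 1 / of_nat CARD('n) * trace (D_mat \<sigma> j ** T_mat A \<psi> \<psi>' (- s\<^sup>2))))) \<longleftrightarrow>
    dyson_solution (row_weight \<sigma>) (col_weight \<sigma>) A s d e"
proof -
  have s0: "s \<noteq> 0" using s by auto
  define p where "p = dyson_step (row_weight \<sigma>) (transpose A) s e d"
  define q where "q = dyson_step (col_weight \<sigma>) A s d e"
  have p: "nonneg_re p" unfolding p_def by (rule dyson_step_nonneg[where W="row_weight \<sigma>", OF weights_nonneg(1) s e d])
  have q: "nonneg_re q" unfolding q_def by (rule dyson_step_nonneg[where W="col_weight \<sigma>", OF weights_nonneg(2) s d e])
  have "1 / of_nat CARD('n) * trace (D_tilde_mat \<sigma> i ** T_tilde_mat A \<psi> \<psi>' (- s\<^sup>2)) = p $ i / s" for i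
    unfolding D_tilde_mat_def T_tilde_mat_eq T_mat_eq_dyson_resolvent(3)[where \<psi>=\<psi>' and \<psi>'=\<psi>, OF s e d \<psi>' \<psi>] trace_diag_matrix_mult
    by (simp add: p_def dyson_step_def row_weight_def sum_distrib_left sum_divide_distrib)
  moreover have "1 / of_nat CARD('n) * trace (D_mat \<sigma> j ** T_mat A \<psi> \<psi>' (- s\<^sup>2)) = q $ j / s" for j
    unfolding D_mat_def T_mat_eq_dyson_resolvent(3)[where \<psi>=\<psi> and \<psi>'=\<psi>', OF s d e \<psi> \<psi>'] trace_diag_matrix_mult
    by (simp add: q_def dyson_step_def col_weight_def sum_distrib_left sum_divide_distrib)
  moreover have "1 / (s * (s + d $ i)) = - 1 / (- s\<^sup>2 * (1 + p $ i / s)) \<longleftrightarrow> d $ i = p $ i" for i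
    by (rule reciprocal_equation_iff[OF s0 shift_nonzero[OF s d] shift_nonzero[OF s p]])
  moreover have "1 / (s * (s + e $ j)) = - 1 / (- s\<^sup>2 * (1 + q $ j / s)) \<longleftrightarrow> e $ j = q $ j" for j
    by (rule reciprocal_equation_iff[OF s0 shift_nonzero[OF s e] shift_nonzero[OF s q]])
  ultimately show ?thesis
    unfolding dyson_solution_def p_def[symmetric] q_def[symmetric] \<psi> \<psi>' by (simp only: vec_eq_iff)
qed

section \<open>Uniqueness of the solution\<close>

text \<open>The inequality y \<le> 1 / x^2 says precisely that the shift 1 / (x y) - x is
  nonnegative. Real points are enough here, because two solutions only have to be compared on a
  ray.\<close>

lemma stieltjes_vector_shift:
  fixes \<psi> :: "'m::finite \<Rightarrow> complex \<Rightarrow> complex"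
  assumes "\<And>i. \<psi> i \<in> stieltjes_class" "x > 0"
  shows "\<exists>d :: complex^'m. nonneg_re d \<and>
    (\<forall>i. \<psi> i (- (of_real x)\<^sup>2) = 1 / (of_real x * (of_real x + d $ i)))"
proof -
  have "\<exists>y. \<psi> i (- (of_real x)\<^sup>2) = of_real y \<and> 0 < y \<and> y \<le> 1 / x\<^sup>2" for i
    using stieltjes_class_negative_real[OF assms(1)[of i] assms(2)] by metis
  then obtain y where y: "\<And>i. \<psi> i (- (of_real x)\<^sup>2) = of_real (y i)" "\<And>i. 0 < y i" "\<And>i. y i \<le> 1 / x\<^sup>2"
    by metis
  define d :: "complex^'m" where "d = (\<chi> i. of_real (1 / (x * y i) - x))"
  have "x \<le> 1 / (x * y i)" for i
    using y(2,3)[of i] assms(2) by (simp add: field_simps power2_eq_square)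
  then have "nonneg_re d" by (simp add: nonneg_re_def d_def)
  moreover have "\<psi> i (- (of_real x)\<^sup>2) = 1 / (of_real x * (of_real x + d $ i))" for i
    using y(2)[of i] assms(2) by (simp add: d_def y(1))
  ultimately show ?thesis by blast
qed

lemma is_solution_eq_at:
  fixes A :: "real^'n^'N"
  assumes "is_solution A \<sigma> \<psi>1 \<psi>1'" "is_solution A \<sigma> \<psi>2 \<psi>2'"
    and x: "x \<ge> 1 + 2 * dyson_constant A (row_weight \<sigma>) (col_weight \<sigma>)"
  shows "\<psi>1 i (- (of_real x)\<^sup>2) = \<psi>2 i (- (of_real x)\<^sup>2) \<and> \<psi>1' j (- (of_real x)\<^sup>2) = \<psi>2' j (- (of_real x)\<^sup>2)"
proof -
  note w = weights_nonneg[of \<sigma>]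
  have x0: "x > 0" using x dyson_constant_nonneg[of "row_weight \<sigma>" "col_weight \<sigma>" A] w by auto
  then have s: "Re (complex_of_real x) > 0" by simp
  have *: "\<exists>d e. nonneg_re d \<and> nonneg_re e \<and> (\<forall>i. \<psi> i (- (of_real x)\<^sup>2) = 1 / (of_real x * (of_real x + d $ i))) \<and>
      (\<forall>j. \<psi>' j (- (of_real x)\<^sup>2) = 1 / (of_real x * (of_real x + e $ j))) \<and>
      dyson_solution (row_weight \<sigma>) (col_weight \<sigma>) A (of_real x) d e"
    if sol: "is_solution A \<sigma> \<psi> \<psi>'" for \<psi> \<psi>'
  proof -
    have cl: "\<And>i. \<psi> i \<in> stieltjes_class" "\<And>j. \<psi>' j \<in> stieltjes_class"
      using sol by (auto simp: is_solution_def)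
    obtain d :: "complex^'N" where d: "nonneg_re d" "\<And>i. \<psi> i (- (of_real x)\<^sup>2) = 1 / (of_real x * (of_real x + d $ i))"
      using stieltjes_vector_shift[where \<psi>=\<psi>, OF cl(1) x0] by blast
    obtain e :: "complex^'n" where e: "nonneg_re e" "\<And>j. \<psi>' j (- (of_real x)\<^sup>2) = 1 / (of_real x * (of_real x + e $ j))"
      using stieltjes_vector_shift[where \<psi>=\<psi>', OF cl(2) x0] by blast
    have "dyson_solution (row_weight \<sigma>) (col_weight \<sigma>) A (of_real x) d e"
      unfolding equations_iff_dyson_solution[where \<psi>=\<psi> and \<psi>'=\<psi>', OF s d(1) e(1) d(2) e(2), symmetric]
      using sol[unfolded is_solution_def] minus_square_in_cut_plane[OF s] by (simp only: simp_thms Ball_def)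
    then show ?thesis using d e by (intro exI[of _ d] exI[of _ e] conjI allI)
  qed
  obtain d1 e1 where 1: "nonneg_re d1" "nonneg_re e1" "\<And>i. \<psi>1 i (- (of_real x)\<^sup>2) = 1 / (of_real x * (of_real x + d1 $ i))"
      "\<And>j. \<psi>1' j (- (of_real x)\<^sup>2) = 1 / (of_real x * (of_real x + e1 $ j))"
      "dyson_solution (row_weight \<sigma>) (col_weight \<sigma>) A (of_real x) d1 e1"
    using *[OF assms(1)] by blast
  obtain d2 e2 where 2: "nonneg_re d2" "nonneg_re e2" "\<And>i. \<psi>2 i (- (of_real x)\<^sup>2) = 1 / (of_real x * (of_real x + d2 $ i))"
      "\<And>j. \<psi>2' j (- (of_real x)\<^sup>2) = 1 / (of_real x * (of_real x + e2 $ j))"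
      "dyson_solution (row_weight \<sigma>) (col_weight \<sigma>) A (of_real x) d2 e2"
    using *[OF assms(2)] by blast
  have "d1 = d2 \<and> e1 = e2"
    by (rule dyson_solution_unique[where V="row_weight \<sigma>" and W="col_weight \<sigma>" and A=A and s="of_real x", OF w]) (use x 1 2 in auto)
  then show ?thesis using 1 2 by simp
qed

text \<open>A ray of large real numbers has limit points inside the half-plane, so the identity
  theorem applies in the variable s. Off the cut plane both functions take the same default
  value.\<close>

lemma stieltjes_class_eqI:
  assumes fg: "f \<in> stieltjes_class" "g \<in> stieltjes_class"
    and eq: "\<And>x. x \<ge> r \<Longrightarrow> f (- (complex_of_real x)\<^sup>2) = g (- (complex_of_real x)\<^sup>2)"
  shows "f = g"
proof
  fix z
  have ext: "f \<in> extensional cut_plane" "g \<in> extensional cut_plane"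
    using fg by (auto simp: stieltjes_class_def)
  show "f z = g z"
  proof (cases "z \<in> cut_plane")
    case True
    then obtain s where s: "Re s > 0" "z = - s\<^sup>2" by (rule cut_plane_square)
    \<comment> \<open>Beyond \<open>r\<close> and beyond 0, so that the ray lies where the
      hypothesis holds and inside the half-plane.\<close>
    define c where "c = max r 1 + 1"
    have "f (- s\<^sup>2) - g (- s\<^sup>2) = 0"
    proof (rule analytic_continuation[of "\<lambda>s. f (- s\<^sup>2) - g (- s\<^sup>2)" "{s. Re s > 0}" "complex_of_real ` {c..}" "of_real c" s])
      show "(\<lambda>s. f (- s\<^sup>2) - g (- s\<^sup>2)) holomorphic_on {s. Re s > 0}"
        by (intro holomorphic_on_diff stieltjes_class_holomorphic fg)
      show "complex_of_real ` {c..} \<subseteq> {s. Re s > 0}" by (auto simp: c_def)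
      show "complex_of_real c islimpt complex_of_real ` {c..}"
        unfolding islimpt_approachable
      proof (intro allI impI)
        fix h :: real assume h: "h > 0"
        then have "complex_of_real (c + h / 2) \<in> complex_of_real ` {c..}" by (intro imageI) simp
        moreover have "complex_of_real (c + h / 2) \<noteq> complex_of_real c"
          "dist (complex_of_real (c + h / 2)) (complex_of_real c) < h"
          using h unfolding of_real_eq_iff dist_of_real dist_real_def by auto
        ultimately show "\<exists>x'\<in>complex_of_real ` {c..}. x' \<noteq> complex_of_real c \<and> dist x' (complex_of_real c) < h"
          by blast
      qed
    qed (use s eq in \<open>auto simp: c_def open_right_half_plane connected_right_half_plane\<close>)
    then show ?thesis using s by simp
  next
    case False
    then show ?thesis using ext extensional_arb by metis
  qed
qed

lemma is_solution_unique:
  assumes "is_solution A \<sigma> \<psi>1 \<psi>1'" "is_solution A \<sigma> \<psi>2 \<psi>2'"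
  shows "\<psi>1 = \<psi>2 \<and> \<psi>1' = \<psi>2'"
proof -
  have cl: "\<psi>1 i \<in> stieltjes_class" "\<psi>2 i \<in> stieltjes_class" "\<psi>1' j \<in> stieltjes_class" "\<psi>2' j \<in> stieltjes_class" for i j
    using assms by (auto simp: is_solution_def)
  have "\<psi>1 i = \<psi>2 i" for i
    by (rule stieltjes_class_eqI[OF cl(1,2)]) (use is_solution_eq_at[OF assms] in blast)
  moreover have "\<psi>1' j = \<psi>2' j" for j
    by (rule stieltjes_class_eqI[OF cl(3,4)]) (use is_solution_eq_at[OF assms] in blast)
  ultimately show ?thesis by blast
qed

section \<open>Existence of the solution and of the matrix measures\<close>

text \<open>The reciprocal of \<open>s + f s\<close> has positive real part, and x / (x + f(x))
  tends to 1 because f(x) is at most b / x in modulus; so the representing measure has mass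
  1.\<close>

lemma reciprocal_shift_stieltjes:
  assumes hol: "f holomorphic_on {s. Re s > 0}" and nn: "\<And>s. Re s > 0 \<Longrightarrow> 0 \<le> Re (f s)"
    and cnj: "\<And>s. Re s > 0 \<Longrightarrow> f (cnj s) = cnj (f s)"
    and bnd: "\<And>s. Re s > 0 \<Longrightarrow> norm (f s) \<le> b / Re s"
  shows "\<exists>\<psi>\<in>stieltjes_class. \<forall>s. Re s > 0 \<longrightarrow> \<psi> (- s\<^sup>2) = 1 / (s * (s + f s))"
proof -
  have re: "Re s \<le> Re (s + f s)" "s + f s \<noteq> 0" if "Re s > 0" for s
  proof -
    show *: "Re s \<le> Re (s + f s)" using nn[OF that] by simp
    show "s + f s \<noteq> 0"
    proof
      assume "s + f s = 0"
      then have "Re (s + f s) = 0" by simp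
      with * that show False by linarith
    qed
  qed
  obtain \<nu> where \<nu>: "finite_measure \<nu>" "sets \<nu> = sets borel_nonneg" "measure \<nu> {0..} = 1"
    "\<And>s. Re s > 0 \<Longrightarrow> stieltjes \<nu> (- s\<^sup>2) = (1 / (s + f s)) / s"
  proof (rule half_plane_stieltjes_representation[of "\<lambda>s. 1 / (s + f s)" 1])
    show "(\<lambda>s. 1 / (s + f s)) holomorphic_on {s. Re s > 0}"
      using re by (intro holomorphic_intros hol) auto
    show "0 < Re (1 / (s + f s))" if "Re s > 0" for s
    proof -
      have "0 < Re (s + f s)" using re(1)[OF that] that by linarith
      moreover have "0 < norm (s + f s)" using re(2)[OF that] by simp
      ultimately show ?thesis by (simp add: Re_divide_Reals Re_complex_div_gt_0 complex_is_Real_iff Re_divide' flip: cmod_power2)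
    qed
    show "1 / (cnj s + f (cnj s)) = cnj (1 / (s + f s))" if "Re s > 0" for s
      by (simp add: cnj[OF that])
    show "((\<lambda>x::real. of_real x * (1 / (of_real x + f (of_real x)))) \<longlongrightarrow> of_real 1) at_top"
    proof (rule LIM_zero_cancel, rule Lim_null_comparison)
      show "((\<lambda>x::real. (b / x) / x) \<longlongrightarrow> 0) at_top" by real_asymp
      show "\<forall>\<^sub>F x in at_top. norm (of_real x * (1 / (of_real x + f (of_real x))) - of_real 1) \<le> (b / x) / x"
      proof (rule eventually_at_top_linorderI[of 1])
        fix x :: real assume "x \<ge> 1"
        then have x: "Re (complex_of_real x) > 0" by simp
        have "of_real x * (1 / (of_real x + f (of_real x))) - of_real 1 = - f (of_real x) / (of_real x + f (of_real x))"
          using re(2)[OF x] by (simp add: field_simps)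
        then have "norm (of_real x * (1 / (of_real x + f (of_real x))) - of_real 1) =
            norm (f (of_real x)) / norm (of_real x + f (of_real x))"
          by (simp add: norm_divide)
        also have "\<dots> \<le> (b / x) / x"
        proof (rule frac_le)
          show "norm (f (of_real x)) \<le> b / x" using bnd[OF x] by simp
          then show "0 \<le> b / x" using norm_ge_zero order_trans by blast
          have "x \<le> Re (of_real x + f (of_real x))" using re(1)[OF x] by simp
          also have "\<dots> \<le> norm (of_real x + f (of_real x))" by (rule complex_Re_le_cmod)
          finally show "x \<le> norm (of_real x + f (of_real x))" .
        qed (use \<open>x \<ge> 1\<close> in simp)
        finally show "norm (of_real x * (1 / (of_real x + f (of_real x))) - of_real 1) \<le> (b / x) / x" .
      qed
    qed
  qed blast
  have "restrict (stieltjes \<nu>) cut_plane \<in> stieltjes_class"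
    by (rule stieltjes_classI[OF \<nu>(1-3)]) simp
  moreover have "restrict (stieltjes \<nu>) cut_plane (- s\<^sup>2) = 1 / (s * (s + f s))" if "Re s > 0" for s
    using restrict_apply'[OF minus_square_in_cut_plane[OF that], of "stieltjes \<nu>"] \<nu>(4)[OF that]
    by (simp add: mult.commute)
  ultimately show ?thesis by blast
qed

lemma T_mat_stieltjes:
  fixes A :: "real^'n^'N"
  assumes hol: "\<And>i. (\<lambda>s. d s $ i) holomorphic_on {s. Re s > 0}" "\<And>j. (\<lambda>s. e s $ j) holomorphic_on {s. Re s > 0}"
    and nn: "\<And>s. Re s > 0 \<Longrightarrow> nonneg_re (d s)" "\<And>s. Re s > 0 \<Longrightarrow> nonneg_re (e s)"
    and cnj: "\<And>s. Re s > 0 \<Longrightarrow> d (cnj s) = (\<chi> i. cnj (d s $ i))" "\<And>s. Re s > 0 \<Longrightarrow> e (cnj s) = (\<chi> j. cnj (e s $ j))"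
    and bnd: "\<And>s i. Re s > 0 \<Longrightarrow> norm (d s $ i) \<le> b / Re s"
    and \<psi>: "\<And>s i. Re s > 0 \<Longrightarrow> \<psi> i (- s\<^sup>2) = 1 / (s * (s + d s $ i))"
    and \<psi>': "\<And>s j. Re s > 0 \<Longrightarrow> \<psi>' j (- s\<^sup>2) = 1 / (s * (s + e s $ j))"
  shows "\<exists>\<mu> :: real set \<Rightarrow> complex^'N^'N. positive_matrix_measure borel_nonneg \<mu> \<and> \<mu> {0..} = mat 1 \<and>
      is_matrix_stieltjes \<mu> (T_mat A \<psi> \<psi>')"
    and "(\<lambda>z\<in>cut_plane. 1 / of_nat CARD('N) * trace (T_mat A \<psi> \<psi>' z)) \<in> stieltjes_class"
proof -
  have T: "T_mat A \<psi> \<psi>' (- s\<^sup>2) = map_matrix (\<lambda>x. x / s) (dyson_resolvent A s (d s) (e s))" if "Re s > 0" for s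
    by (rule T_mat_eq_dyson_resolvent(3)[where \<psi>=\<psi> and \<psi>'=\<psi>', OF that nn(1)[OF that] nn(2)[OF that] \<psi>[OF that] \<psi>'[OF that]])
  have "\<exists>\<mu> :: real set \<Rightarrow> complex^'N^'N. positive_matrix_measure borel_nonneg \<mu> \<and> \<mu> {0..} = mat 1 \<and>
      (\<forall>s i j. Re s > 0 \<longrightarrow> has_cm_integral borel_nonneg (\<lambda>B. \<mu> B $ i $ j)
        (\<lambda>t. 1 / (complex_of_real t - (- s\<^sup>2))) (dyson_resolvent A s (d s) (e s) $ i $ j / s))"
    by (rule dyson_resolvent_stieltjes(1)[OF hol nn cnj bnd])
  then obtain \<mu> :: "real set \<Rightarrow> complex^'N^'N" where \<mu>: "positive_matrix_measure borel_nonneg \<mu>" "\<mu> {0..} = mat 1"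
      "\<forall>s i j. Re s > 0 \<longrightarrow> has_cm_integral borel_nonneg (\<lambda>B. \<mu> B $ i $ j)
        (\<lambda>t. 1 / (complex_of_real t - (- s\<^sup>2))) (dyson_resolvent A s (d s) (e s) $ i $ j / s)"
    by (elim exE conjE)
  have "is_matrix_stieltjes \<mu> (T_mat A \<psi> \<psi>')"
    unfolding is_matrix_stieltjes_def
  proof (intro ballI allI)
    fix z i j assume "z \<in> cut_plane"
    then obtain s where s: "Re s > 0" "z = - s\<^sup>2" by (rule cut_plane_square)
    have "T_mat A \<psi> \<psi>' z $ i $ j = dyson_resolvent A s (d s) (e s) $ i $ j / s"
      unfolding s(2) T[OF s(1)] by simp
    then show "has_cm_integral borel_nonneg (\<lambda>B. \<mu> B $ i $ j) (\<lambda>t. 1 / (complex_of_real t - z)) (T_mat A \<psi> \<psi>' z $ i $ j)"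
      using \<mu>(3)[rule_format, OF s(1), of i j] unfolding s(2) by (simp only:)
  qed
  then show "\<exists>\<mu> :: real set \<Rightarrow> complex^'N^'N. positive_matrix_measure borel_nonneg \<mu> \<and> \<mu> {0..} = mat 1 \<and>
      is_matrix_stieltjes \<mu> (T_mat A \<psi> \<psi>')"
    using \<mu>(1,2) by blast
  have "\<exists>\<nu>. finite_measure \<nu> \<and> sets \<nu> = sets borel_nonneg \<and> measure \<nu> {0..} = 1 \<and>
      (\<forall>s. Re s > 0 \<longrightarrow> stieltjes \<nu> (- s\<^sup>2) =
        (1 / of_nat CARD('N) * (\<Sum>i\<in>UNIV. dyson_resolvent A s (d s) (e s) $ i $ i)) / s)"
    by (rule dyson_resolvent_stieltjes(2)[OF hol nn cnj bnd])
  then obtain \<nu> where \<nu>: "finite_measure \<nu>" "sets \<nu> = sets borel_nonneg" "measure \<nu> {0..} = 1"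
      "\<And>s. Re s > 0 \<Longrightarrow> stieltjes \<nu> (- s\<^sup>2) =
        (1 / of_nat CARD('N) * (\<Sum>i\<in>UNIV. dyson_resolvent A s (d s) (e s) $ i $ i)) / s"
    by blast
  show "(\<lambda>z\<in>cut_plane. 1 / of_nat CARD('N) * trace (T_mat A \<psi> \<psi>' z)) \<in> stieltjes_class"
  proof (rule stieltjes_classI[OF \<nu>(1-3)])
    show "stieltjes \<nu> (- s\<^sup>2) = 1 / of_nat CARD('N) * trace (T_mat A \<psi> \<psi>' (- s\<^sup>2))" if "Re s > 0" for s
      unfolding \<nu>(4)[OF that] T[OF that] trace_def by (simp add: sum_divide_distrib mult.commute)
  qed
qed

theorem theorem2p4:
  fixes A :: "real^'n^'N" and \<sigma> :: "'N \<Rightarrow> 'n \<Rightarrow> real"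
  shows "(\<exists>!(\<psi>, \<psi>'). is_solution A \<sigma> \<psi> \<psi>') \<and>
    (\<forall>\<psi> \<psi>'. is_solution A \<sigma> \<psi> \<psi>' \<longrightarrow>
      (\<exists>(\<mu> :: real set \<Rightarrow> complex^'N^'N) (\<mu>' :: real set \<Rightarrow> complex^'n^'n).
         positive_matrix_measure borel_nonneg \<mu> \<and> positive_matrix_measure borel_nonneg \<mu>' \<and>
         \<mu> {0..} = mat 1 \<and> \<mu>' {0..} = mat 1 \<and>
         is_matrix_stieltjes \<mu> (T_mat A \<psi> \<psi>') \<and> is_matrix_stieltjes \<mu>' (T_tilde_mat A \<psi> \<psi>')) \<and>
      (\<lambda>z\<in>cut_plane. 1 / of_nat CARD('N) * trace (T_mat A \<psi> \<psi>' z)) \<in> stieltjes_class \<and>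
      (\<lambda>z\<in>cut_plane. 1 / of_nat CARD('n) * trace (T_tilde_mat A \<psi> \<psi>' z)) \<in> stieltjes_class)"
proof -
  let ?V = "row_weight \<sigma>" and ?W = "col_weight \<sigma>"
  note w = weights_nonneg[of \<sigma>]
  obtain d :: "complex \<Rightarrow> complex^'N" and e :: "complex \<Rightarrow> complex^'n" where
    hol: "\<And>i. (\<lambda>s. d s $ i) holomorphic_on {s. Re s > 0}" "\<And>j. (\<lambda>s. e s $ j) holomorphic_on {s. Re s > 0}"
    and nn: "\<And>s. Re s > 0 \<Longrightarrow> nonneg_re (d s)" "\<And>s. Re s > 0 \<Longrightarrow> nonneg_re (e s)"
    and cnj: "\<And>s. Re s > 0 \<Longrightarrow> d (cnj s) = (\<chi> i. cnj (d s $ i))" "\<And>s. Re s > 0 \<Longrightarrow> e (cnj s) = (\<chi> j. cnj (e s $ j))"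
    and sol: "\<And>s. Re s > 0 \<Longrightarrow> dyson_solution ?V ?W A s (d s) (e s)"
    using dyson_solution_exists[where V="?V" and W="?W" and A=A, OF w] by blast
  \<comment> \<open>A fixed point is a value of the map, so the bound that is uniform in the
    arguments applies to it.\<close>
  have dbnd: "norm (d s $ i) \<le> total_weight ?V / Re s" if s: "Re s > 0" for s i
    using dyson_step_norm[where W="?V", OF w(1) s nn(2)[OF s] nn(1)[OF s], of "transpose A" i] sol[OF s]
    unfolding dyson_solution_def by metis
  have ebnd: "norm (e s $ j) \<le> total_weight ?W / Re s" if s: "Re s > 0" for s j
    using dyson_step_norm[where W="?W", OF w(2) s nn(1)[OF s] nn(2)[OF s], of A j] sol[OF s]
    unfolding dyson_solution_def by metis
  have "\<exists>\<psi>\<in>stieltjes_class. \<forall>s. Re s > 0 \<longrightarrow> \<psi> (- s\<^sup>2) = 1 / (s * (s + d s $ i))" for i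
    by (rule reciprocal_shift_stieltjes[OF hol(1) _ _ dbnd]) (use nn cnj in \<open>auto simp: nonneg_re_def\<close>)
  then obtain \<psi> where \<psi>: "\<And>i. \<psi> i \<in> stieltjes_class" "\<And>s i. Re s > 0 \<Longrightarrow> \<psi> i (- s\<^sup>2) = 1 / (s * (s + d s $ i))"
    by metis
  have "\<exists>\<psi>\<in>stieltjes_class. \<forall>s. Re s > 0 \<longrightarrow> \<psi> (- s\<^sup>2) = 1 / (s * (s + e s $ j))" for j
    by (rule reciprocal_shift_stieltjes[OF hol(2) _ _ ebnd]) (use nn cnj in \<open>auto simp: nonneg_re_def\<close>)
  then obtain \<psi>' where \<psi>': "\<And>j. \<psi>' j \<in> stieltjes_class" "\<And>s j. Re s > 0 \<Longrightarrow> \<psi>' j (- s\<^sup>2) = 1 / (s * (s + e s $ j))"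
    by metis
  have is_sol: "is_solution A \<sigma> \<psi> \<psi>'"
    unfolding is_solution_def
  proof (rule conjI[OF _ conjI[OF _ ballI]])
    show "\<forall>i. \<psi> i \<in> stieltjes_class" "\<forall>j. \<psi>' j \<in> stieltjes_class" using \<psi>(1) \<psi>'(1) by auto
    fix z assume "z \<in> cut_plane"
    then obtain s where s: "Re s > 0" "z = - s\<^sup>2" by (rule cut_plane_square)
    note 1 = T_mat_eq_dyson_resolvent[where \<psi>=\<psi> and \<psi>'=\<psi>', OF s(1) nn(1)[OF s(1)] nn(2)[OF s(1)] \<psi>(2)[OF s(1)] \<psi>'(2)[OF s(1)]]
    note 2 = T_mat_eq_dyson_resolvent[where \<psi>=\<psi>' and \<psi>'=\<psi>, OF s(1) nn(2)[OF s(1)] nn(1)[OF s(1)] \<psi>'(2)[OF s(1)] \<psi>(2)[OF s(1)]]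
    note 3 = equations_iff_dyson_solution[where A=A and \<sigma>=\<sigma> and \<psi>=\<psi> and \<psi>'=\<psi>', OF s(1) nn(1)[OF s(1)] nn(2)[OF s(1)] \<psi>(2)[OF s(1)] \<psi>'(2)[OF s(1)]]
    show "invertible (Psi \<psi> z) \<and> invertible (Psi \<psi>' z) \<and>
        invertible (T_inverse A \<psi> \<psi>' z) \<and> invertible (T_tilde_inverse A \<psi> \<psi>' z) \<and>
        (\<forall>i. \<psi> i z = -1 / (z * (1 + 1 / of_nat CARD('n) * trace (D_tilde_mat \<sigma> i ** T_tilde_mat A \<psi> \<psi>' z)))) \<and>
        (\<forall>j. \<psi>' j z = -1 / (z * (1 + 1 / of_nat CARD('n) * trace (D_mat \<sigma> j ** T_mat A \<psi> \<psi>' z))))"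
      unfolding s(2) T_tilde_inverse_eq
      using 1(1,2) 2(1,2) 3[THEN iffD2, OF sol[OF s(1)]] by blast
  qed
  have "\<exists>!(\<psi>, \<psi>'). is_solution A \<sigma> \<psi> \<psi>'"
  proof (rule ex1I[of _ "(\<psi>, \<psi>')"])
    show "case (\<psi>, \<psi>') of (\<psi>, \<psi>') \<Rightarrow> is_solution A \<sigma> \<psi> \<psi>'" using is_sol by simp
    fix p assume "case p of (\<psi>, \<psi>') \<Rightarrow> is_solution A \<sigma> \<psi> \<psi>'"
    then show "p = (\<psi>, \<psi>')" using is_solution_unique[OF _ is_sol] by (cases p) auto
  qed
  moreover have "\<exists>\<mu> :: real set \<Rightarrow> complex^'N^'N. positive_matrix_measure borel_nonneg \<mu> \<and> \<mu> {0..} = mat 1 \<and>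
      is_matrix_stieltjes \<mu> (T_mat A \<psi> \<psi>')"
    by (rule T_mat_stieltjes(1)[OF hol nn cnj dbnd \<psi>(2) \<psi>'(2)])
  moreover have "(\<lambda>z\<in>cut_plane. 1 / of_nat CARD('N) * trace (T_mat A \<psi> \<psi>' z)) \<in> stieltjes_class"
    by (rule T_mat_stieltjes(2)[OF hol nn cnj dbnd \<psi>(2) \<psi>'(2)])
  \<comment> \<open>Transposing \<open>A\<close> and exchanging d with e turns the second matrix
    into the first, so the same lemma applies.\<close>
  moreover have "\<exists>\<mu> :: real set \<Rightarrow> complex^'n^'n. positive_matrix_measure borel_nonneg \<mu> \<and> \<mu> {0..} = mat 1 \<and>
      is_matrix_stieltjes \<mu> (T_tilde_mat A \<psi> \<psi>')"
    unfolding T_tilde_mat_eq[abs_def]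
    by (rule T_mat_stieltjes(1)[OF hol(2,1) nn(2,1) cnj(2,1) ebnd \<psi>'(2) \<psi>(2)])
  moreover have "(\<lambda>z\<in>cut_plane. 1 / of_nat CARD('n) * trace (T_tilde_mat A \<psi> \<psi>' z)) \<in> stieltjes_class"
    unfolding T_tilde_mat_eq
    by (rule T_mat_stieltjes(2)[OF hol(2,1) nn(2,1) cnj(2,1) ebnd \<psi>'(2) \<psi>(2)])
  \<comment> \<open>By uniqueness every solution is the one constructed, so its properties hold for
    all solutions.\<close>
  ultimately show ?thesis
    using is_solution_unique[OF _ is_sol] by blast
qed

end
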